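(* Let $p$ be a prime and let $A$ and $B$ be non-trivial $p$-hereditarily conjugacy separable groups. Then $A \wr B$ is $p$-hereditarily conjugacy separable if and only if at least one of the following is true: (1) $B$ is a finite $p$-group; (2) $A$ is abelian and $B$ is a $p$-group.
   Context: A $p$-group is a (possibly infinite) group in which every element has order a power of $p$. A group $G$ is $p$-conjugacy separable if for every pair of non-conjugate elements $f,g\in G$ there is a surjective homomorphism $\pi$ from $G$ onto a finite $p$-group such that $\pi(f)$ and $\pi(g)$ are not conjugate in the image. $G$ is $p$-hereditarily conjugacy separable if $G$ is $p$-conjugacy separable and so is every subgroup $H \leq G$ containing some $N \unlhd G$ with $G/N$ a finite $p$-group. $A \wr B$ denotes the restricted wreath product $A^B \rtimes B$, where $A^B$ is the group of finitely supported functions $B\to A$, on which $B$ acts by left translation of coordinates. *)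

theory Defs
  imports "HOL-Algebra.Algebra" "HOL-Computational_Algebra.Primes"
begin

(* group.ord is 0 for elements of infinite order, so these are excluded for p > 0. *)
definition p_group :: "nat \<Rightarrow> ('a, 'm) monoid_scheme \<Rightarrow> bool" where
  "p_group p G \<longleftrightarrow> group G \<and> (\<forall>x\<in>carrier G. \<exists>n. group.ord G x = p ^ n)"

definition finite_p_group :: "nat \<Rightarrow> ('a, 'm) monoid_scheme \<Rightarrow> bool" where
  "finite_p_group p G \<longleftrightarrow> p_group p G \<and> finite (carrier G)"

definition conjugate_in :: "('a, 'm) monoid_scheme \<Rightarrow> 'a \<Rightarrow> 'a \<Rightarrow> bool" where
  "conjugate_in G f g \<longleftrightarrow>
     (\<exists>x\<in>carrier G. g = x \<otimes>\<^bsub>G\<^esub> f \<otimes>\<^bsub>G\<^esub> inv\<^bsub>G\<^esub> x)"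

(* HOL cannot quantify over the type of the finite quotient. Every finite group is isomorphic
   to one with carrier in nat, so nothing is lost by fixing that type: see
   p_conjugacy_separable_iff below, where the type of the quotients is an arbitrary infinite
   type, and nat_quotient_of_quotient, where it is an arbitrary type. *)
definition p_conjugacy_separable :: "nat \<Rightarrow> ('a, 'm) monoid_scheme \<Rightarrow> bool" where
  "p_conjugacy_separable p G \<longleftrightarrow> group G \<and>
     (\<forall>f\<in>carrier G. \<forall>g\<in>carrier G. \<not> conjugate_in G f g \<longrightarrow>
        (\<exists>(Q :: nat monoid) \<pi>. finite_p_group p Q \<and> \<pi> \<in> epi G Q \<and>
           \<not> conjugate_in Q (\<pi> f) (\<pi> g)))"

definition p_hereditarily_conjugacy_separable ::
    "nat \<Rightarrow> ('a, 'm) monoid_scheme \<Rightarrow> bool" where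
  "p_hereditarily_conjugacy_separable p G \<longleftrightarrow> p_conjugacy_separable p G \<and>
     (\<forall>H N. subgroup H G \<and> N \<lhd> G \<and> finite_p_group p (G Mod N) \<and> N \<subseteq> H \<longrightarrow>
        p_conjugacy_separable p (G\<lparr>carrier := H\<rparr>))"

definition left_translate :: "('b, 'n) monoid_scheme \<Rightarrow> 'b \<Rightarrow> ('b \<Rightarrow> 'a) \<Rightarrow> 'b \<Rightarrow> 'a" where
  "left_translate B b f = (\<lambda>x\<in>carrier B. f (inv\<^bsub>B\<^esub> b \<otimes>\<^bsub>B\<^esub> x))"

(* The base group of finitely supported functions is the library's sum_group; its elements are
   extensional, i.e. undefined outside carrier B (see carrier_sum_group). *)
abbreviation wreath_base ::
    "('a, 'm) monoid_scheme \<Rightarrow> ('b, 'n) monoid_scheme \<Rightarrow> ('b \<Rightarrow> 'a) monoid" where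
  "wreath_base A B \<equiv> sum_group (carrier B) (\<lambda>_. A)"

definition wreath_product ::
    "('a, 'm) monoid_scheme \<Rightarrow> ('b, 'n) monoid_scheme \<Rightarrow> (('b \<Rightarrow> 'a) \<times> 'b) monoid"
    (infixr \<open>\<wr>\<close> 70) where
  "A \<wr> B = \<lparr>carrier = carrier (wreath_base A B) \<times> carrier B,
     monoid.mult = (\<lambda>(f, b) (g, c).
       (f \<otimes>\<^bsub>wreath_base A B\<^esub> left_translate B b g, b \<otimes>\<^bsub>B\<^esub> c)),
     one = (\<one>\<^bsub>wreath_base A B\<^esub>, \<one>\<^bsub>B\<^esub>)\<rparr>"

lemma left_translate_closed:
  assumes "group A" "group B" "b \<in> carrier B" "f \<in> carrier (wreath_base A B)"
  shows "left_translate B b f \<in> carrier (wreath_base A B)"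
proof -
  interpret B: group B by fact
  let ?S = "{x \<in> carrier B. f x \<noteq> \<one>\<^bsub>A\<^esub>}"
  have fin: "finite ?S" and f: "f \<in> carrier B \<rightarrow>\<^sub>E carrier A"
    using assms by (auto simp: carrier_sum_group)
  have "{x \<in> carrier B. left_translate B b f x \<noteq> \<one>\<^bsub>A\<^esub>} \<subseteq> (\<lambda>x. b \<otimes>\<^bsub>B\<^esub> x) ` ?S"
  proof
    fix x assume x: "x \<in> {x \<in> carrier B. left_translate B b f x \<noteq> \<one>\<^bsub>A\<^esub>}"
    then have "inv\<^bsub>B\<^esub> b \<otimes>\<^bsub>B\<^esub> x \<in> ?S" "x = b \<otimes>\<^bsub>B\<^esub> (inv\<^bsub>B\<^esub> b \<otimes>\<^bsub>B\<^esub> x)"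
      using assms by (auto simp: left_translate_def B.m_assoc[symmetric])
    then show "x \<in> (\<lambda>x. b \<otimes>\<^bsub>B\<^esub> x) ` ?S" by blast
  qed
  then have "finite {x \<in> carrier B. left_translate B b f x \<noteq> \<one>\<^bsub>A\<^esub>}"
    using fin finite_surj by blast
  moreover have "left_translate B b f \<in> carrier B \<rightarrow>\<^sub>E carrier A"
    using f assms(3) by (auto simp: left_translate_def PiE_iff)
  ultimately show ?thesis using assms by (simp add: carrier_sum_group)
qed

lemma left_translate_mult:
  assumes "group B" "b \<in> carrier B"
  shows "left_translate B b (f \<otimes>\<^bsub>wreath_base A B\<^esub> g) =
         left_translate B b f \<otimes>\<^bsub>wreath_base A B\<^esub> left_translate B b g"
proof -
  interpret B: group B by fact
  show ?thesis using assms(2) by (auto simp: left_translate_def intro!: restrict_ext)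
qed

lemma left_translate_left_translate:
  assumes "group B" "b \<in> carrier B" "c \<in> carrier B"
  shows "left_translate B b (left_translate B c f) = left_translate B (b \<otimes>\<^bsub>B\<^esub> c) f"
proof -
  interpret B: group B by fact
  show ?thesis using assms(2,3)
    by (auto simp: left_translate_def B.inv_mult_group B.m_assoc intro!: restrict_ext)
qed

lemma left_translate_one:
  assumes "group A" "group B" "f \<in> carrier (wreath_base A B)"
  shows "left_translate B \<one>\<^bsub>B\<^esub> f = f"
proof -
  interpret B: group B by fact
  show ?thesis using assms
    by (auto simp: left_translate_def carrier_sum_group PiE_iff extensional_def)
qed

lemma group_wreath_product:
  assumes A: "group A" and B: "group B"
  shows "group (A \<wr> B)"
proof -
  interpret B: group B by fact
  interpret N: group "wreath_base A B" using A by (rule sum_group)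
  note simps = wreath_product_def left_translate_closed[OF A B] left_translate_mult[OF B]
    left_translate_left_translate[OF B] left_translate_one[OF A B]
  note [simp del] = mult_sum_group one_sum_group
  show ?thesis
  proof (rule groupI)
    show "\<exists>y\<in>carrier (A \<wr> B). y \<otimes>\<^bsub>A \<wr> B\<^esub> x = \<one>\<^bsub>A \<wr> B\<^esub>" if x_in: "x \<in> carrier (A \<wr> B)" for x
    proof -
      obtain f b where x: "x = (f, b)" and f: "f \<in> carrier (wreath_base A B)"
        and b: "b \<in> carrier B"
        using x_in by (auto simp: wreath_product_def)
      let ?g = "left_translate B (inv\<^bsub>B\<^esub> b) f"
      have "?g \<in> carrier (wreath_base A B)" using f b by (simp add: simps)
      then show ?thesis using f b unfolding x
        by (intro bexI[of _ "(inv\<^bsub>wreath_base A B\<^esub> ?g, inv\<^bsub>B\<^esub> b)"])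
          (auto simp: wreath_product_def simp del: inv_sum_group)
    qed
  qed (auto simp: simps N.m_assoc B.m_assoc)
qed

lemma conjugate_in_iso:
  assumes "group Q" "group R" "h \<in> iso Q R" "x \<in> carrier Q" "y \<in> carrier Q"
  shows "conjugate_in R (h x) (h y) \<longleftrightarrow> conjugate_in Q x y"
proof -
  interpret group_hom Q R h
    using assms by (simp add: group_hom_def group_hom_axioms_def iso_def)
  have inj: "inj_on h (carrier Q)" and img: "carrier R = h ` carrier Q"
    using assms(3) by (auto simp: iso_def bij_betw_def)
  have "h y = h z \<otimes>\<^bsub>R\<^esub> h x \<otimes>\<^bsub>R\<^esub> inv\<^bsub>R\<^esub> h z \<longleftrightarrow> y = z \<otimes>\<^bsub>Q\<^esub> x \<otimes>\<^bsub>Q\<^esub> inv\<^bsub>Q\<^esub> z"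
    if "z \<in> carrier Q" for z
  proof -
    have "h z \<otimes>\<^bsub>R\<^esub> h x \<otimes>\<^bsub>R\<^esub> inv\<^bsub>R\<^esub> h z = h (z \<otimes>\<^bsub>Q\<^esub> x \<otimes>\<^bsub>Q\<^esub> inv\<^bsub>Q\<^esub> z)"
      using that assms by simp
    moreover have "z \<otimes>\<^bsub>Q\<^esub> x \<otimes>\<^bsub>Q\<^esub> inv\<^bsub>Q\<^esub> z \<in> carrier Q"
      using that assms by simp
    ultimately show ?thesis using inj_on_eq_iff[OF inj] assms(5) by metis
  qed
  then show ?thesis unfolding conjugate_in_def img by auto
qed

lemma p_group_iso:
  assumes "p_group p Q" "group R" "h \<in> iso Q R"
  shows "p_group p R"
proof -
  have Q: "group Q" using assms by (simp add: p_group_def)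
  interpret group_hom Q R h
    using Q assms by (simp add: group_hom_def group_hom_axioms_def iso_def)
  have inj: "inj_on h (carrier Q)" and img: "carrier R = h ` carrier Q"
    using assms(3) by (auto simp: iso_def bij_betw_def)
  have "group.ord R (h x) = group.ord Q x" if "x \<in> carrier Q" for x
  proof -
    have "h x [^]\<^bsub>R\<^esub> n = \<one>\<^bsub>R\<^esub> \<longleftrightarrow> x [^]\<^bsub>Q\<^esub> n = \<one>\<^bsub>Q\<^esub>" for n :: nat
    proof -
      have "h x [^]\<^bsub>R\<^esub> n = h (x [^]\<^bsub>Q\<^esub> n)" using that by (simp add: hom_nat_pow)
      then show ?thesis
        using inj that by (metis G.nat_pow_closed G.one_closed hom_one inj_on_eq_iff)
    qed
    then show ?thesis using that by (simp add: H.ord_unique G.pow_eq_id)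
  qed
  then show ?thesis using assms by (auto simp: p_group_def img)
qed

lemma quotient_transfer:
  fixes Q :: "('q, 'm) monoid_scheme" and r :: "'q \<Rightarrow> 'r"
  assumes G: "group G" and Q: "finite_p_group p Q" "\<pi> \<in> epi G Q"
    and nc: "f \<in> carrier G" "g \<in> carrier G" "\<not> conjugate_in Q (\<pi> f) (\<pi> g)"
    and r: "inj_on r (carrier Q)"
  shows "\<exists>(R :: 'r monoid) \<rho>. finite_p_group p R \<and> \<rho> \<in> epi G R \<and>
           \<not> conjugate_in R (\<rho> f) (\<rho> g)"
proof -
  have grpQ: "group Q" using Q by (simp add: finite_p_group_def p_group_def)
  then interpret Q: group Q .
  define s where "s = inv_into (carrier Q) r"
  define R :: "'r monoid" where "R = \<lparr>carrier = r ` carrier Q,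
    monoid.mult = (\<lambda>x y. r (s x \<otimes>\<^bsub>Q\<^esub> s y)), one = r \<one>\<^bsub>Q\<^esub>\<rparr>"
  have s: "s (r x) = x" if "x \<in> carrier Q" for x
    using r that by (simp add: s_def)
  have iso: "r \<in> iso Q R"
    using r by (auto simp: iso_def hom_def bij_betw_def R_def s)
  have "group R"
  proof (rule groupI)
    show "\<exists>y\<in>carrier R. y \<otimes>\<^bsub>R\<^esub> x = \<one>\<^bsub>R\<^esub>" if "x \<in> carrier R" for x
      using that by (auto simp: R_def s intro!: bexI[of _ "inv\<^bsub>Q\<^esub> (s x)"])
  qed (auto simp: R_def s Q.m_assoc)
  moreover have "finite (carrier R)" using Q by (simp add: R_def finite_p_group_def)
  ultimately have "finite_p_group p R"
    using p_group_iso iso Q by (auto simp: finite_p_group_def)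
  moreover have "r \<circ> \<pi> \<in> epi G R"
    using iso Q by (meson epi_compose iso_iff_mon_epi)
  moreover have "\<pi> f \<in> carrier Q" "\<pi> g \<in> carrier Q"
    using Q nc by (auto simp: epi_def hom_def)
  then have "\<not> conjugate_in R ((r \<circ> \<pi>) f) ((r \<circ> \<pi>) g)"
    using conjugate_in_iso[OF grpQ \<open>group R\<close> iso] nc by simp
  ultimately show ?thesis by blast
qed

lemma nat_quotient_of_quotient:
  fixes Q :: "('q, 'm) monoid_scheme"
  assumes "group G" "finite_p_group p Q" "\<pi> \<in> epi G Q"
    and "f \<in> carrier G" "g \<in> carrier G" "\<not> conjugate_in Q (\<pi> f) (\<pi> g)"
  shows "\<exists>(R :: nat monoid) \<rho>. finite_p_group p R \<and> \<rho> \<in> epi G R \<and>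
           \<not> conjugate_in R (\<rho> f) (\<rho> g)"
proof -
  have "finite (carrier Q)" using assms(2) by (simp add: finite_p_group_def)
  then obtain r :: "'q \<Rightarrow> nat" where "inj_on r (carrier Q)"
    using finite_imp_inj_to_nat_seg by blast
  then show ?thesis by (rule quotient_transfer[OF assms])
qed

lemma p_conjugacy_separable_iff:
  assumes "infinite (UNIV :: 'q set)"
  shows "p_conjugacy_separable p G \<longleftrightarrow> group G \<and>
     (\<forall>f\<in>carrier G. \<forall>g\<in>carrier G. \<not> conjugate_in G f g \<longrightarrow>
        (\<exists>(Q :: 'q monoid) \<pi>. finite_p_group p Q \<and> \<pi> \<in> epi G Q \<and>
           \<not> conjugate_in Q (\<pi> f) (\<pi> g)))"
proof -
  obtain r :: "nat \<Rightarrow> 'q" where r: "inj r"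
    using infinite_countable_subset[OF assms] by blast
  have "(\<exists>(Q :: nat monoid) \<pi>. finite_p_group p Q \<and> \<pi> \<in> epi G Q \<and>
           \<not> conjugate_in Q (\<pi> f) (\<pi> g)) \<longleftrightarrow>
        (\<exists>(Q :: 'q monoid) \<pi>. finite_p_group p Q \<and> \<pi> \<in> epi G Q \<and>
           \<not> conjugate_in Q (\<pi> f) (\<pi> g))" (is "?L \<longleftrightarrow> ?R")
    if G: "group G" "f \<in> carrier G" "g \<in> carrier G" for f g
  proof
    assume ?L
    then show ?R
      by (elim exE conjE)
        (rule quotient_transfer[OF G(1) _ _ G(2,3) _ inj_on_subset[OF r subset_UNIV]])
  next
    assume ?R
    then show ?L
      by (elim exE conjE) (rule nat_quotient_of_quotient[OF G(1) _ _ G(2,3)])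
  qed
  then show ?thesis
    unfolding p_conjugacy_separable_def by (intro conj_cong ball_cong imp_cong refl)
qed

end

theory Submission
  imports Defs
begin

text \<open>A group is \<open>p\<close>-hereditarily conjugacy separable iff for every \<open>x\<close> and every normal subgroup
  \<open>K\<close> with finite \<open>p\<close>-quotient the set of \<open>K\<close>-conjugates of \<open>x\<close> is closed in the pro-\<open>p\<close>
  topology, and \<open>K\<close> may be shrunk depending on \<open>x\<close>. In the wreath product let \<open>K\<close> consist of the
  \<open>(f, m)\<close> with \<open>m\<close> in \<open>M \<lhd> B\<close> and the products of \<open>f\<close> over the cosets \<open>sM\<close> in \<open>K\<^sub>0 \<lhd> A\<close>, where
  \<open>M\<close> meets the finite group \<open>\<langle>b\<rangle>\<close> trivially. If \<open>x = (f, b)\<close> and \<open>g = (f', b)\<close> agree modulo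
  \<open>K\<close>, an equation \<open>g = h x h\<^sup>-\<^sup>1\<close> can be solved along the orbits of \<open>b\<close> inside \<open>K\<close> as soon as
  the powers \<open>x\<^sup>n\<close> and \<open>g\<^sup>n\<close>, \<open>n\<close> the order of \<open>b\<close>, are suitably conjugate. These powers lie in
  the base group, where the hypotheses on \<open>A\<close> (for finite \<open>B\<close>) or finiteness of supports (for
  abelian \<open>A\<close>) separate them. Conversely, if \<open>x\<close> is not in \<open>\<langle>y\<rangle>\<close>, \<open>y = x\<^sup>q\<close> with \<open>q\<close> prime to
  \<open>p\<close>, then the element with values \<open>a\<close> at \<open>1\<close>, \<open>a\<^sup>-\<^sup>1\<close> at \<open>x\<close> and top part \<open>y\<close> is not conjugate
  to \<open>y\<close> but becomes so in every finite \<open>p\<close>-quotient, since there \<open>x\<close> is a power of \<open>y\<close>. If \<open>B\<close> is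
  infinite, every commutator of \<open>A\<close> dies in every finite quotient.\<close>

section \<open>Normal subgroups of finite p-power index\<close>

text \<open>Both cases rest on the kernel of a map from \<open>A \<wr> B\<close> to the wreath
  product of \<open>A/L\<close> by \<open>B/M\<close> that multiplies the values of a function over
  each coset of \<open>M\<close>. For non-abelian \<open>A\<close> such a product makes sense only
  if the cosets are single points, so \<open>M\<close> must be trivial and \<open>B\<close> itself a
  finite p-group; for abelian \<open>A\<close> every \<open>M\<close> is allowed. This is the source
  of the dichotomy in the theorem. The order of \<open>b\<close> has to be finite because the
  equation for the conjugating element is a recursion along the orbits of \<open>b\<close>: it
  closes up after \<open>n\<close> steps, which turns the compatibility condition into one on n-th
  powers, and only finitely many functions are pieced together, so the solution has finite support.
  Conversely, taking q-th powers is a bijection on every finite p-group when q is prime to p, yet x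
  is not a power of \<open>x^q\<close> when q > 1 divides the order of x. Finite p-quotients are
  handled through their kernels, so that the argument stays on the original carrier types.\<close>

definition p_open :: "nat \<Rightarrow> ('a, 'm) monoid_scheme \<Rightarrow> 'a set \<Rightarrow> bool" where
  "p_open p G N \<longleftrightarrow> N \<lhd> G \<and> finite (rcosets\<^bsub>G\<^esub> N) \<and>
     (\<forall>x\<in>carrier G. \<exists>n. x [^]\<^bsub>G\<^esub> (p ^ n :: nat) \<in> N)"

text \<open>The cosets \<open>L #> g\<close> are the basic neighbourhoods of \<open>g\<close> in the
  pro-p topology, so the complement of the set of \<open>K\<close>-conjugates of \<open>x\<close> is
  required to be open. \<open>L\<close> may depend on \<open>g\<close> but not on
  \<open>k\<close>.\<close>

definition conj_closed :: "nat \<Rightarrow> ('a, 'm) monoid_scheme \<Rightarrow> 'a set \<Rightarrow> 'a \<Rightarrow> bool" where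
  "conj_closed p G K x \<longleftrightarrow>
     (\<forall>g\<in>carrier G. (\<forall>k\<in>K. g \<noteq> k \<otimes>\<^bsub>G\<^esub> x \<otimes>\<^bsub>G\<^esub> inv\<^bsub>G\<^esub> k) \<longrightarrow>
       (\<exists>L. p_open p G L \<and> (\<forall>k\<in>K. L #>\<^bsub>G\<^esub> g \<noteq> L #>\<^bsub>G\<^esub> (k \<otimes>\<^bsub>G\<^esub> x \<otimes>\<^bsub>G\<^esub> inv\<^bsub>G\<^esub> k))))"

section \<open>Arithmetic of right cosets and of open subgroups\<close>

context group
begin

lemma inv_m_cancel [simp]:
  assumes "x \<in> carrier G" "y \<in> carrier G"
  shows "inv x \<otimes> (x \<otimes> y) = y" "x \<otimes> (inv x \<otimes> y) = y"
  using assms by (simp_all add: m_assoc[symmetric])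

lemma m_inv_eq_one_iff:
  assumes "x \<in> carrier G" "y \<in> carrier G"
  shows "x \<otimes> inv y = \<one> \<longleftrightarrow> x = y"
  using assms by (metis inv_closed inv_equality inv_inv r_inv)

lemma conj_m_cancel [simp]:
  assumes "k \<in> carrier G" "x \<in> carrier G" "y \<in> carrier G"
  shows "k \<otimes> x \<otimes> inv k \<otimes> (k \<otimes> y \<otimes> inv k) = k \<otimes> (x \<otimes> y) \<otimes> inv k"
  using assms by (simp add: m_assoc)

lemma conj_pow:
  assumes "k \<in> carrier G" "x \<in> carrier G"
  shows "(k \<otimes> x \<otimes> inv k) [^] (n::nat) = k \<otimes> x [^] n \<otimes> inv k"
  using assms by (induction n) auto

lemma r_coset_eq_iff:
  assumes "subgroup L G" "x \<in> carrier G" "y \<in> carrier G"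
  shows "L #> x = L #> y \<longleftrightarrow> x \<otimes> inv y \<in> L"
  using assms
  by (metis coset_join1 coset_join2 coset_mult_inv1 coset_mult_inv2 inv_closed m_closed subgroup.subset)

lemma r_coset_cong_mult:
  assumes "L \<lhd> G" "L #> x = L #> x'" "L #> y = L #> y'"
    "x \<in> carrier G" "x' \<in> carrier G" "y \<in> carrier G" "y' \<in> carrier G"
  shows "L #> (x \<otimes> y) = L #> (x' \<otimes> y')"
  using assms by (metis normal.rcos_sum)

lemma r_coset_cong_inv:
  assumes "L \<lhd> G" "L #> x = L #> x'" "x \<in> carrier G" "x' \<in> carrier G"
  shows "L #> inv x = L #> inv x'"
  using assms by (metis normal.rcos_inv)

lemma r_coset_cong_pow:
  assumes "L \<lhd> G" "L #> x = L #> x'" "x \<in> carrier G" "x' \<in> carrier G"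
  shows "L #> (x [^] (n::nat)) = L #> (x' [^] n)"
proof (induction n)
  case (Suc n)
  then show ?case using assms r_coset_cong_mult[OF assms(1) Suc assms(2)] by simp
qed simp

text \<open>\<open>c\<close> is any invariant with finite range whose fibres lie inside cosets of
  \<open>N\<close>; every coset is then determined by a value of \<open>c\<close>. Later proofs can
  name a finite description of an element instead of counting cosets.\<close>

lemma p_openI:
  assumes "N \<lhd> G" and fin: "finite (c ` carrier G)"
    and c: "\<And>x y. x \<in> carrier G \<Longrightarrow> y \<in> carrier G \<Longrightarrow> c x = c y \<Longrightarrow> x \<otimes> inv y \<in> N"
    and "\<And>x. x \<in> carrier G \<Longrightarrow> \<exists>n. x [^] (p ^ n :: nat) \<in> N"
  shows "p_open p G N"
proof -
  have N: "subgroup N G" using assms(1) by (rule normal_imp_subgroup)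
  define r where "r z = N #> (SOME x. x \<in> carrier G \<and> c x = z)" for z
  have "N #> x = r (c x)" if "x \<in> carrier G" for x
  proof -
    define y where "y = (SOME y. y \<in> carrier G \<and> c y = c x)"
    have "y \<in> carrier G \<and> c y = c x"
      unfolding y_def by (rule someI[of _ x]) (use that in simp)
    then have "N #> x = N #> y"
      using c[of x y] r_coset_eq_iff[OF N] that by simp
    then show ?thesis by (simp add: r_def y_def)
  qed
  then have "rcosets N \<subseteq> r ` c ` carrier G" by (auto simp: RCOSETS_def)
  then have "finite (rcosets N)" using fin by (meson finite_imageI finite_subset)
  then show ?thesis using assms by (simp add: p_open_def)
qed

lemma p_open_normal: "p_open p G N \<Longrightarrow> N \<lhd> G"
  by (simp add: p_open_def)

lemma p_open_subgroup: "p_open p G N \<Longrightarrow> subgroup N G"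
  by (simp add: p_open_def normal_imp_subgroup)

lemma p_open_finite_cosets: "p_open p G N \<Longrightarrow> finite ((\<lambda>x. N #> x) ` carrier G)"
  by (auto simp: p_open_def RCOSETS_def UNION_singleton_eq_range)

lemma subgroup_nat_pow_closed:
  assumes "subgroup N G" "x \<in> N"
  shows "x [^] (n::nat) \<in> N"
  using assms by (induction n) (auto simp: subgroup.one_closed subgroup.m_closed)

lemma subgroup_pow_prime_mono:
  assumes "subgroup N G" "x \<in> carrier G" "x [^] (p ^ n :: nat) \<in> N" "n \<le> m"
  shows "x [^] (p ^ m :: nat) \<in> N"
proof -
  have "x [^] (p ^ m :: nat) = (x [^] (p ^ n :: nat)) [^] (p ^ (m - n) :: nat)"
    using assms by (simp add: nat_pow_pow flip: power_add)
  then show ?thesis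
    using assms subgroup_nat_pow_closed by simp
qed

lemma r_coset_eq_self_iff:
  assumes "subgroup L G" "x \<in> carrier G"
  shows "L #> x = L \<longleftrightarrow> x \<in> L"
  using assms by (metis coset_join1 coset_join2 subgroup.subset)

lemma r_coset_eq_mono:
  assumes "subgroup L G" "subgroup L' G" "L \<subseteq> L'" "x \<in> carrier G" "y \<in> carrier G"
    "L #> x = L #> y"
  shows "L' #> x = L' #> y"
  using assms r_coset_eq_iff by auto

text \<open>The representatives are taken in \<open>D\<close> itself, which matters when they have
  to serve as conjugators from a given subgroup.\<close>

lemma p_open_representatives:
  assumes "p_open p G K" "D \<subseteq> carrier G"
  shows "\<exists>T\<subseteq>D. finite T \<and> (\<forall>d\<in>D. \<exists>t\<in>T. K #> d = K #> t)"
proof -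
  have "finite ((\<lambda>x. K #> x) ` D)"
    using p_open_finite_cosets[OF assms(1)] assms(2) by (meson finite_subset image_mono)
  then obtain T where "T \<subseteq> D" "finite T" "(\<lambda>x. K #> x) ` D = (\<lambda>x. K #> x) ` T"
    using finite_subset_image[OF _ subset_refl, of "\<lambda>x. K #> x" D] by blast
  then show ?thesis by (metis (no_types, lifting) image_iff)
qed

text \<open>Finitely many cosets have finitely many exponents; the largest serves for every
  representative, hence for every element.\<close>

lemma p_open_exponent:
  assumes "p_open p G N"
  shows "\<exists>m. \<forall>x\<in>carrier G. x [^] (p ^ m :: nat) \<in> N"
proof -
  have N: "N \<lhd> G" "subgroup N G"
    using assms p_open_normal p_open_subgroup by blast+
  obtain T where T: "T \<subseteq> carrier G" "finite T" "\<forall>x\<in>carrier G. \<exists>t\<in>T. N #> x = N #> t"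
    using p_open_representatives[OF assms subset_refl] by auto
  obtain e where e: "t [^] (p ^ e t :: nat) \<in> N" if "t \<in> T" for t
    using assms T(1) unfolding p_open_def by (metis subsetD)
  obtain m where m: "\<forall>n\<in>e ` T. n \<le> m"
    using T(2) by (metis finite_imageI finite_nat_set_iff_bounded_le)
  have "x [^] (p ^ m :: nat) \<in> N" if x: "x \<in> carrier G" for x
  proof -
    obtain t where t: "t \<in> T" "N #> x = N #> t" using T(3) x by blast
    then have tc: "t \<in> carrier G" using T(1) by blast
    have "t [^] (p ^ m :: nat) \<in> N"
      using subgroup_pow_prime_mono[OF N(2) tc e[OF t(1)]] m t(1) by simp
    then have "N #> (t [^] (p ^ m :: nat)) = N"
      using r_coset_eq_self_iff[OF N(2)] tc by simp
    then have "N #> (x [^] (p ^ m :: nat)) = N"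
      using r_coset_cong_pow[OF N(1) t(2) x tc] by simp
    then show ?thesis using r_coset_eq_self_iff[OF N(2)] x by simp
  qed
  then show ?thesis by blast
qed

lemma p_open_carrier: "p_open p G (carrier G)"
  by (rule p_openI[where c = "\<lambda>_. ()"]) (auto simp: normal_inv_iff subgroup_self)

lemma p_open_Int:
  assumes "p_open p G K" "p_open p G L"
  shows "p_open p G (K \<inter> L)"
proof (rule p_openI[where c = "\<lambda>x. (K #> x, L #> x)"])
  have K: "subgroup K G" and L: "subgroup L G" using assms p_open_subgroup by auto
  show "K \<inter> L \<lhd> G"
    using assms by (simp add: p_open_def normal_subgroup_intersect)
  have "(\<lambda>x. (K #> x, L #> x)) ` carrier G \<subseteq>
      (\<lambda>x. K #> x) ` carrier G \<times> (\<lambda>x. L #> x) ` carrier G" by auto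
  then show "finite ((\<lambda>x. (K #> x, L #> x)) ` carrier G)"
    using assms p_open_finite_cosets by (meson finite_SigmaI finite_subset)
  show "x \<otimes> inv y \<in> K \<inter> L" if "x \<in> carrier G" "y \<in> carrier G" "(K #> x, L #> x) = (K #> y, L #> y)" for x y
    using that r_coset_eq_iff[OF K] r_coset_eq_iff[OF L] by auto
  show "\<exists>n. x [^] (p ^ n :: nat) \<in> K \<inter> L" if x: "x \<in> carrier G" for x
  proof -
    obtain k l where "x [^] (p ^ k :: nat) \<in> K" "x [^] (p ^ l :: nat) \<in> L"
      using assms x unfolding p_open_def by blast
    then have "x [^] (p ^ max k l :: nat) \<in> K \<inter> L"
      using subgroup_pow_prime_mono[OF K x, of p k "max k l"]
        subgroup_pow_prime_mono[OF L x, of p l "max k l"] by simp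
    then show ?thesis by blast
  qed
qed

text \<open>\<open>P i\<close> is not assumed to pass to smaller subgroups, so the common
  intersection \<open>L\<close> comes with an open \<open>L'\<close> above it that satisfies
  \<open>P i\<close>. An equality of \<open>L\<close>-cosets can be pushed up to
  \<open>L'\<close>.\<close>

lemma p_open_finite_choice:
  assumes "finite I" "\<forall>i\<in>I. \<exists>L. p_open p G L \<and> P i L"
  shows "\<exists>L. p_open p G L \<and> (\<forall>i\<in>I. \<exists>L'. L \<subseteq> L' \<and> p_open p G L' \<and> P i L')"
  using assms
proof (induction I rule: finite_induct)
  case empty
  show ?case using p_open_carrier by auto
next
  case (insert i I)
  obtain L where L: "p_open p G L" "\<forall>i\<in>I. \<exists>L'. L \<subseteq> L' \<and> p_open p G L' \<and> P i L'"
    using insert by blast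
  obtain L' where L': "p_open p G L'" "P i L'" using insert.prems by blast
  show ?case
  proof (rule exI[of _ "L \<inter> L'"], intro conjI ballI)
    show "p_open p G (L \<inter> L')" using L(1) L'(1) by (rule p_open_Int)
    show "\<exists>L''. L \<inter> L' \<subseteq> L'' \<and> p_open p G L'' \<and> P j L''" if "j \<in> insert i I" for j
      using that L(2) L' by blast
  qed
qed

end

lemma (in group_hom) p_open_vimage:
  assumes "p_open p H N"
  shows "p_open p G {x \<in> carrier G. h x \<in> N}"
proof (rule G.p_openI[where c = "\<lambda>x. N #>\<^bsub>H\<^esub> h x"])
  have N: "subgroup N H" using assms by (rule H.p_open_subgroup)
  have conj: "h g \<otimes>\<^bsub>H\<^esub> y \<otimes>\<^bsub>H\<^esub> inv\<^bsub>H\<^esub> h g \<in> N" if "g \<in> carrier G" "y \<in> N" for g y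
    using that assms normal.inv_op_closed2 by (force simp: p_open_def)
  have "\<one>\<^bsub>G\<^esub> \<in> {x \<in> carrier G. h x \<in> N}" using N by (simp add: subgroup.one_closed)
  then show "{x \<in> carrier G. h x \<in> N} \<lhd> G"
    unfolding G.normal_inv_iff
    using N conj by (auto intro!: G.subgroupI simp: subgroup.m_closed subgroup.m_inv_closed)
  have "(\<lambda>x. N #>\<^bsub>H\<^esub> h x) ` carrier G \<subseteq> (\<lambda>x. N #>\<^bsub>H\<^esub> x) ` carrier H" by auto
  then show "finite ((\<lambda>x. N #>\<^bsub>H\<^esub> h x) ` carrier G)"
    using H.p_open_finite_cosets[OF assms] finite_subset by blast
  show "x \<otimes>\<^bsub>G\<^esub> inv\<^bsub>G\<^esub> y \<in> {x \<in> carrier G. h x \<in> N}"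
    if "x \<in> carrier G" "y \<in> carrier G" "N #>\<^bsub>H\<^esub> h x = N #>\<^bsub>H\<^esub> h y" for x y
    using that H.r_coset_eq_iff[OF N] by simp
  show "\<exists>n. x [^]\<^bsub>G\<^esub> (p ^ n :: nat) \<in> {x \<in> carrier G. h x \<in> N}" if "x \<in> carrier G" for x
    using that assms by (simp add: p_open_def hom_nat_pow)
qed

section \<open>Open subgroups versus subgroups and finite p-quotients\<close>

context group
begin

lemma p_open_restrict:
  assumes "subgroup H G" "p_open p G L"
  shows "p_open p (G\<lparr>carrier := H\<rparr>) (L \<inter> H)"
proof -
  interpret i: group_hom "G\<lparr>carrier := H\<rparr>" G "\<lambda>x. x"
    using assms subgroup_imp_group
    by (auto simp: group_hom_def group_hom_axioms_def hom_def subgroup.mem_carrier)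
  have "{x \<in> carrier (G\<lparr>carrier := H\<rparr>). x \<in> L} = L \<inter> H" by auto
  then show ?thesis using i.p_open_vimage[OF assms(2)] by simp
qed

text \<open>The order of a coset divides \<open>p ^ n\<close> exactly when the power with exponent
  \<open>p ^ n\<close> lies in \<open>N\<close>, and the divisors of a power of a prime are again
  powers of it, so the two ways of measuring torsion agree.\<close>

lemma p_open_iff_finite_p_group:
  assumes "Factorial_Ring.prime p" "N \<lhd> G"
  shows "p_open p G N \<longleftrightarrow> finite_p_group p (G Mod N)"
proof -
  interpret N: normal N G by fact
  interpret Q: group "G Mod N" by (rule N.factorgroup_is_group)
  have pow: "(N #> x) [^]\<^bsub>G Mod N\<^esub> (k::nat) = \<one>\<^bsub>G Mod N\<^esub> \<longleftrightarrow> x [^] k \<in> N"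
    if "x \<in> carrier G" for x k
    using that r_coset_eq_self_iff[OF N.subgroup_axioms] by (simp add: N.FactGroup_pow)
  have "(\<exists>n. group.ord (G Mod N) (N #> x) = p ^ n) \<longleftrightarrow> (\<exists>n. x [^] (p ^ n :: nat) \<in> N)"
    (is "?L \<longleftrightarrow> ?R") if x: "x \<in> carrier G" for x
  proof -
    have c: "N #> x \<in> carrier (G Mod N)" using x by (simp add: carrier_FactGroup)
    have "?R \<longleftrightarrow> (\<exists>n. Q.ord (N #> x) dvd p ^ n)"
      using pow[OF x] Q.pow_eq_id[OF c] by simp
    also have "\<dots> \<longleftrightarrow> ?L"
      using divides_primepow_nat[OF assms(1)] by auto
    finally show ?thesis by simp
  qed
  moreover have "carrier (G Mod N) = (\<lambda>x. N #> x) ` carrier G" by (rule carrier_FactGroup)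
  ultimately show ?thesis
    using assms(2) Q.group_axioms
    by (auto simp: p_open_def finite_p_group_def p_group_def FactGroup_def)
qed

text \<open>\<open>N\<close> is normal only in \<open>H\<close>, so \<open>L\<close> is cut down to
  the elements of \<open>K\<close> all of whose \<open>G\<close>-conjugates lie in \<open>N\<close>.
  Since \<open>K\<close> normalises \<open>N\<close>, whether the conjugate by \<open>g\<close> lies
  in \<open>N\<close> depends only on the coset \<open>K #> g\<close>; finitely many conditions
  therefore define \<open>L\<close>, and it stays open.\<close>

lemma p_open_core:
  assumes K: "p_open p G K" and H: "subgroup H G" and "K \<subseteq> H"
    and N: "p_open p (G\<lparr>carrier := H\<rparr>) N"
  shows "\<exists>L. p_open p G L \<and> L \<subseteq> N"
proof -
  interpret H: group "G\<lparr>carrier := H\<rparr>" using H by (rule subgroup_imp_group)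
  have Ks: "subgroup K G" using K by (rule p_open_subgroup)
  have Ns: "subgroup N G"
    using H.p_open_subgroup[OF N] H incl_subgroup by blast
  have Kconj: "g \<otimes> k \<otimes> inv g \<in> K" if "k \<in> K" "g \<in> carrier G" for k g
    using that K normal.inv_op_closed2 by (force simp: p_open_def)
  have Nconj: "k \<otimes> n \<otimes> inv k \<in> N" if "n \<in> N" "k \<in> K" for k n
    using that N H \<open>K \<subseteq> H\<close> normal.inv_op_closed2[of N "G\<lparr>carrier := H\<rparr>" k n]
    by (auto simp: p_open_def m_inv_consistent)
  have Kc: "k \<in> carrier G" if "k \<in> K" for k using that Ks by (rule subgroup.mem_carrier[rotated])
  define L where "L = {y \<in> K. \<forall>g\<in>carrier G. g \<otimes> y \<otimes> inv g \<in> N}"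
  have "L \<subseteq> N"
  proof
    fix y assume "y \<in> L"
    then have "\<one> \<otimes> y \<otimes> inv \<one> \<in> N" "y \<in> carrier G" using Kc unfolding L_def by blast+
    then show "y \<in> N" by simp
  qed
  obtain T where T: "T \<subseteq> carrier G" "finite T" "\<forall>x\<in>carrier G. \<exists>t\<in>T. K #> x = K #> t"
    using p_open_representatives[OF K subset_refl] by auto
  then obtain r where r: "r x \<in> T" "K #> x = K #> r x" if "x \<in> carrier G" for x by metis
  \<comment> \<open>\<open>R\<close> takes the coset as argument, so that elements of the same coset
    get the same representative from the finite set \<open>T\<close>.\<close>
  define R where "R S = r (SOME x. x \<in> carrier G \<and> K #> x = S)" for S
  have R: "R (K #> x) \<in> T" "x \<otimes> inv R (K #> x) \<in> K" "R (K #> x) \<in> carrier G"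
    if "x \<in> carrier G" for x
  proof -
    define y where "y = (SOME y. y \<in> carrier G \<and> K #> y = K #> x)"
    have "y \<in> carrier G \<and> K #> y = K #> x"
      unfolding y_def by (rule someI[of _ x]) (use that in simp)
    then show "R (K #> x) \<in> T" "x \<otimes> inv R (K #> x) \<in> K" "R (K #> x) \<in> carrier G"
      using r[of y] T(1) that r_coset_eq_iff[OF Ks] by (auto simp: R_def y_def)
  qed
  have "p_open p G L"
  proof (rule p_openI)
    show "L \<lhd> G"
      unfolding normal_inv_iff
    proof (intro conjI ballI)
      show "subgroup L G"
      proof (rule subgroupI)
        show "L \<noteq> {}"
          using Ks Ns by (auto simp: L_def subgroup.one_closed intro!: exI[of _ \<one>])
        show "inv a \<in> L" if "a \<in> L" for a
        proof -
          have "g \<otimes> inv a \<otimes> inv g = inv (g \<otimes> a \<otimes> inv g)" if "g \<in> carrier G" for g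
            using that \<open>a \<in> L\<close> Kc by (simp add: L_def inv_mult_group m_assoc)
          then show ?thesis using that Ks Ns by (simp add: L_def subgroup.m_inv_closed)
        qed
        show "a \<otimes> b \<in> L" if "a \<in> L" "b \<in> L" for a b
        proof -
          have "g \<otimes> (a \<otimes> b) \<otimes> inv g = (g \<otimes> a \<otimes> inv g) \<otimes> (g \<otimes> b \<otimes> inv g)"
            if "g \<in> carrier G" for g
            using that \<open>a \<in> L\<close> \<open>b \<in> L\<close> Kc by (simp add: L_def)
          then show ?thesis using that Ks Ns by (simp add: L_def subgroup.m_closed)
        qed
      qed (use Kc in \<open>auto simp: L_def\<close>)
      show "x \<otimes> y \<otimes> inv x \<in> L" if "x \<in> carrier G" "y \<in> L" for x y
      proof -
        have "g \<otimes> (x \<otimes> y \<otimes> inv x) \<otimes> inv g = (g \<otimes> x) \<otimes> y \<otimes> inv (g \<otimes> x)"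
          if "g \<in> carrier G" for g
          using that \<open>x \<in> carrier G\<close> \<open>y \<in> L\<close> Kc by (simp add: L_def inv_mult_group m_assoc)
        then show ?thesis using that Kconj by (simp add: L_def)
      qed
    qed
    \<comment> \<open>\<open>y\<close> is split as an element of \<open>K\<close> times its
      representative. The invariant records the coset of \<open>y\<close> and, for every
      \<open>t\<close> in \<open>T\<close>, the \<open>N\<close>-coset of the conjugate by
      \<open>t\<close> of the factor in \<open>K\<close>.\<close>
    define c where "c y = (K #> y, \<lambda>t\<in>T. N #> (t \<otimes> (y \<otimes> inv R (K #> y)) \<otimes> inv t))" for y
    have "c ` carrier G \<subseteq> (\<lambda>x. K #> x) ` carrier G \<times> (T \<rightarrow>\<^sub>E (\<lambda>x. N #> x) ` H)"
    proof -
      have "t \<otimes> (y \<otimes> inv R (K #> y)) \<otimes> inv t \<in> H" if "t \<in> T" "y \<in> carrier G" for t y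
        using Kconj[OF R(2)[OF that(2)], of t] \<open>K \<subseteq> H\<close> T(1) that(1) by blast
      then show ?thesis by (auto simp: c_def)
    qed
    moreover have "finite ((\<lambda>x. N #> x) ` H)"
      using H.p_open_finite_cosets[OF N] by simp
    ultimately show "finite (c ` carrier G)"
      using p_open_finite_cosets[OF K] T(2) by (meson finite_PiE finite_SigmaI finite_subset)
    show "x \<otimes> inv y \<in> L" if x: "x \<in> carrier G" and y: "y \<in> carrier G" and xy: "c x = c y" for x y
    proof -
      define u v where "u = x \<otimes> inv R (K #> x)" and "v = y \<otimes> inv R (K #> y)"
      have K_eq: "K #> x = K #> y" using xy by (simp add: c_def)
      have uv: "u \<in> K" "v \<in> K" "u \<in> carrier G" "v \<in> carrier G"
        using x y R Kc by (auto simp: u_def v_def)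
      have z: "x \<otimes> inv y = u \<otimes> inv v"
        using x y R by (simp add: u_def v_def K_eq inv_mult_group m_assoc)
      have T_N: "t \<otimes> (u \<otimes> inv v) \<otimes> inv t \<in> N" if t: "t \<in> T" for t
      proof -
        have tc: "t \<in> carrier G" using t T(1) by blast
        have "N #> (t \<otimes> u \<otimes> inv t) = N #> (t \<otimes> v \<otimes> inv t)"
          using arg_cong[OF xy, of "\<lambda>s. snd s t"] t by (simp add: c_def u_def v_def)
        then have "(t \<otimes> u \<otimes> inv t) \<otimes> inv (t \<otimes> v \<otimes> inv t) \<in> N"
          using r_coset_eq_iff[OF Ns] tc uv by simp
        then show ?thesis using tc uv by (simp add: inv_mult_group m_assoc)
      qed
      have "g \<otimes> (u \<otimes> inv v) \<otimes> inv g \<in> N" if g: "g \<in> carrier G" for g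
      proof -
        define t k where "t = R (K #> g)" and "k = g \<otimes> inv t"
        have tk: "t \<in> T" "k \<in> K" "t \<in> carrier G" "k \<in> carrier G"
          using R[OF g] Kc by (auto simp: t_def k_def)
        have "g = k \<otimes> t" using g tk by (simp add: k_def m_assoc)
        then have "g \<otimes> (u \<otimes> inv v) \<otimes> inv g = k \<otimes> (t \<otimes> (u \<otimes> inv v) \<otimes> inv t) \<otimes> inv k"
          using tk uv by (simp add: inv_mult_group m_assoc)
        then show ?thesis using T_N[OF tk(1)] Nconj tk(2) by simp
      qed
      then show ?thesis using uv Ks by (simp add: z L_def subgroup.m_closed subgroup.m_inv_closed)
    qed
    show "\<exists>n. x [^] (p ^ n :: nat) \<in> L" if x: "x \<in> carrier G" for x
    proof -
      obtain n where n: "x [^] (p ^ n :: nat) \<in> K" using K x by (auto simp: p_open_def)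
      \<comment> \<open>All conjugates of \<open>x [^] p ^ n\<close> lie in \<open>K\<close>, hence
        in \<open>H\<close>. The exponent of \<open>H/N\<close> is uniform, so one further power
        brings all of them into \<open>N\<close> at once.\<close>
      obtain m where m: "\<forall>h\<in>H. h [^] (p ^ m :: nat) \<in> N"
        using H.p_open_exponent[OF N] by (auto simp flip: nat_pow_consistent)
      let ?z = "x [^] (p ^ n :: nat)"
      have "g \<otimes> ?z [^] (p ^ m :: nat) \<otimes> inv g \<in> N" if "g \<in> carrier G" for g
      proof -
        have "(g \<otimes> ?z \<otimes> inv g) [^] (p ^ m :: nat) \<in> N"
          using m Kconj[OF n that] \<open>K \<subseteq> H\<close> by blast
        then show ?thesis using conj_pow[OF that, of ?z "p ^ m"] x by simp
      qed
      then have "?z [^] (p ^ m :: nat) \<in> L"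
        using n subgroup_nat_pow_closed[OF Ks] by (simp add: L_def)
      then show ?thesis using x by (metis nat_pow_pow power_add)
    qed
  qed
  then show ?thesis using \<open>L \<subseteq> N\<close> by blast
qed

text \<open>In one direction a homomorphism onto a finite p-group is replaced by its kernel, in the
  other an open subgroup by the quotient modulo it, which \<open>nat_quotient_of_quotient\<close>
  moves to a carrier of natural numbers.\<close>

lemma p_conjugacy_separable_iff_p_open:
  assumes p: "Factorial_Ring.prime p"
  shows "p_conjugacy_separable p G \<longleftrightarrow> (\<forall>x\<in>carrier G. conj_closed p G (carrier G) x)"
proof
  assume sep: "p_conjugacy_separable p G"
  show "\<forall>x\<in>carrier G. conj_closed p G (carrier G) x"
    unfolding conj_closed_def
  proof (intro ballI impI)
    fix x g assume x: "x \<in> carrier G" and g: "g \<in> carrier G"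
      and "\<forall>k\<in>carrier G. g \<noteq> k \<otimes> x \<otimes> inv k"
    then have "\<not> conjugate_in G x g" by (auto simp: conjugate_in_def)
    then obtain Q :: "nat monoid" and \<pi> where Q: "finite_p_group p Q" and \<pi>: "\<pi> \<in> epi G Q"
      and nc: "\<not> conjugate_in Q (\<pi> x) (\<pi> g)"
      using sep x g unfolding p_conjugacy_separable_def by meson
    interpret Q: group Q using Q by (simp add: finite_p_group_def p_group_def)
    interpret h: group_hom G Q \<pi>
      using \<pi> by (unfold_locales) (simp add: epi_def)
    have "p_open p Q {\<one>\<^bsub>Q\<^esub>}"
    proof (rule Q.p_openI[where c = "\<lambda>x. x"])
      show "\<exists>n. y [^]\<^bsub>Q\<^esub> (p ^ n :: nat) \<in> {\<one>\<^bsub>Q\<^esub>}" if "y \<in> carrier Q" for y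
        using that Q by (simp add: finite_p_group_def p_group_def) (metis Q.pow_ord_eq_1)
    qed (use Q in \<open>auto simp: Q.one_is_normal finite_p_group_def\<close>)
    then have L: "p_open p G (kernel G Q \<pi>)" (is "p_open p G ?L")
      using h.p_open_vimage by (fastforce simp: kernel_def)
    have "?L #> g \<noteq> ?L #> (k \<otimes> x \<otimes> inv k)" if k: "k \<in> carrier G" for k
    proof
      assume "?L #> g = ?L #> (k \<otimes> x \<otimes> inv k)"
      then have "\<pi> (g \<otimes> inv (k \<otimes> x \<otimes> inv k)) = \<one>\<^bsub>Q\<^esub>"
        using r_coset_eq_iff[OF p_open_subgroup[OF L]] g k x by (auto simp: kernel_def)
      then have "\<pi> g \<otimes>\<^bsub>Q\<^esub> inv\<^bsub>Q\<^esub> (\<pi> k \<otimes>\<^bsub>Q\<^esub> \<pi> x \<otimes>\<^bsub>Q\<^esub> inv\<^bsub>Q\<^esub> \<pi> k) = \<one>\<^bsub>Q\<^esub>"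
        using g k x by simp
      then have "\<pi> g = \<pi> k \<otimes>\<^bsub>Q\<^esub> \<pi> x \<otimes>\<^bsub>Q\<^esub> inv\<^bsub>Q\<^esub> \<pi> k"
        using g k x by (subst (asm) Q.m_inv_eq_one_iff) auto
      then show False using nc k by (auto simp: conjugate_in_def)
    qed
    then show "\<exists>L. p_open p G L \<and> (\<forall>k\<in>carrier G. L #> g \<noteq> L #> (k \<otimes> x \<otimes> inv k))"
      using L by blast
  qed
next
  assume closed: "\<forall>x\<in>carrier G. conj_closed p G (carrier G) x"
  show "p_conjugacy_separable p G"
    unfolding p_conjugacy_separable_def
  proof (intro conjI ballI impI)
    fix x g assume x: "x \<in> carrier G" and g: "g \<in> carrier G" and "\<not> conjugate_in G x g"
    then obtain L where L: "p_open p G L" "\<forall>k\<in>carrier G. L #> g \<noteq> L #> (k \<otimes> x \<otimes> inv k)"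
      using closed unfolding conj_closed_def conjugate_in_def by meson
    then interpret L: normal L G by (simp add: p_open_def)
    have "(\<lambda>a. L #> a) \<in> epi G (G Mod L)"
      using L.r_coset_hom_Mod by (auto simp: epi_def carrier_FactGroup)
    moreover have "finite_p_group p (G Mod L)"
      using L(1) p_open_iff_finite_p_group[OF p L.normal_axioms] by simp
    moreover have "\<not> conjugate_in (G Mod L) (L #> x) (L #> g)"
    proof
      assume "conjugate_in (G Mod L) (L #> x) (L #> g)"
      then obtain k where "k \<in> carrier G"
        "L #> g = (L #> k) <#> (L #> x) <#> inv\<^bsub>G Mod L\<^esub> (L #> k)"
        by (auto simp: conjugate_in_def carrier_FactGroup)
      then show False
        using L(2) x g by (simp add: L.inv_FactGroup L.rcos_inv L.rcos_sum carrier_FactGroup)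
    qed
    ultimately show "\<exists>(Q :: nat monoid) \<pi>. finite_p_group p Q \<and> \<pi> \<in> epi G Q \<and>
           \<not> conjugate_in Q (\<pi> x) (\<pi> g)"
      using x g by (intro nat_quotient_of_quotient[OF group_axioms])
  qed (rule group_axioms)
qed

end

section \<open>Closed conjugacy classes\<close>

context group
begin

text \<open>\<open>K\<close> is a finite union of cosets \<open>t K'\<close>, so the set of
  \<open>K\<close>-conjugates of \<open>x\<close> is a finite union of conjugates, by the elements
  \<open>t\<close>, of the closed set of \<open>K'\<close>-conjugates.\<close>

lemma conj_closed_reduce:
  assumes K: "subgroup K G" and K': "p_open p G K'" "K' \<subseteq> K"
    and x: "x \<in> carrier G" and closed: "conj_closed p G K' x"
  shows "conj_closed p G K x"
  unfolding conj_closed_def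
proof (intro ballI impI)
  fix g assume g: "g \<in> carrier G" and ng: "\<forall>k\<in>K. g \<noteq> k \<otimes> x \<otimes> inv k"
  have Kc: "k \<in> carrier G" if "k \<in> K" for k using that K by (rule subgroup.mem_carrier[rotated])
  have K's: "subgroup K' G" using K'(1) by (rule p_open_subgroup)
  obtain T where T: "T \<subseteq> K" "finite T" "\<forall>k\<in>K. \<exists>t\<in>T. K' #> k = K' #> t"
    using p_open_representatives[OF K'(1), of K] Kc by blast
  have "\<exists>L. p_open p G L \<and> (\<forall>k\<in>K'. L #> (inv t \<otimes> g \<otimes> t) \<noteq> L #> (k \<otimes> x \<otimes> inv k))"
    if t: "t \<in> T" for t
  proof -
    have tK: "t \<in> K" "t \<in> carrier G" using t T(1) Kc by auto
    have "inv t \<otimes> g \<otimes> t \<noteq> k \<otimes> x \<otimes> inv k" if k: "k \<in> K'" for k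
    proof
      have kc: "k \<in> carrier G" using k K'(2) Kc by blast
      assume "inv t \<otimes> g \<otimes> t = k \<otimes> x \<otimes> inv k"
      then have "t \<otimes> (inv t \<otimes> g \<otimes> t) \<otimes> inv t = t \<otimes> (k \<otimes> x \<otimes> inv k) \<otimes> inv t" by simp
      then have "g = (t \<otimes> k) \<otimes> x \<otimes> inv (t \<otimes> k)"
        using tK(2) g x kc by (simp add: m_assoc inv_mult_group)
      moreover have "t \<otimes> k \<in> K" using subgroup.m_closed[OF K tK(1)] k K'(2) by blast
      ultimately show False using ng by blast
    qed
    then show ?thesis using closed g tK unfolding conj_closed_def by simp
  qed
  then have "\<forall>t\<in>T. \<exists>L. p_open p G L \<and>
      (\<forall>k\<in>K'. L #> (inv t \<otimes> g \<otimes> t) \<noteq> L #> (k \<otimes> x \<otimes> inv k))"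
    by blast
  from p_open_finite_choice[OF T(2) this] obtain L where L: "p_open p G L"
    "\<forall>t\<in>T. \<exists>L'. L \<subseteq> L' \<and> p_open p G L' \<and>
       (\<forall>k\<in>K'. L' #> (inv t \<otimes> g \<otimes> t) \<noteq> L' #> (k \<otimes> x \<otimes> inv k))"
    by blast
  have "L #> g \<noteq> L #> (k \<otimes> x \<otimes> inv k)" if k: "k \<in> K" for k
  proof
    assume eq: "L #> g = L #> (k \<otimes> x \<otimes> inv k)"
    obtain t where t: "t \<in> T" "K' #> k = K' #> t" using T(3) k by blast
    have tK: "t \<in> K" "t \<in> carrier G" "k \<in> carrier G" using t T(1) Kc k by auto
    obtain L' where L': "L \<subseteq> L'" "p_open p G L'"
      "\<forall>k\<in>K'. L' #> (inv t \<otimes> g \<otimes> t) \<noteq> L' #> (k \<otimes> x \<otimes> inv k)"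
      using L(2) t(1) by blast
    have "k \<otimes> inv t \<in> K'" using t(2) r_coset_eq_iff[OF K's] tK by simp
    then have "inv t \<otimes> (k \<otimes> inv t) \<otimes> t \<in> K'"
      using K'(1) tK by (meson p_open_normal normal.inv_op_closed1)
    then have k': "inv t \<otimes> k \<in> K'" using tK by (simp add: m_assoc)
    have "L' #> g = L' #> (k \<otimes> x \<otimes> inv k)"
      using r_coset_eq_mono[OF p_open_subgroup[OF L(1)] p_open_subgroup[OF L'(2)] L'(1) _ _ eq]
        g x tK by simp
    then have "L' #> (inv t \<otimes> g \<otimes> t) = L' #> (inv t \<otimes> (k \<otimes> x \<otimes> inv k) \<otimes> t)"
      using p_open_normal[OF L'(2)] g x tK by (intro r_coset_cong_mult) auto
    also have "inv t \<otimes> (k \<otimes> x \<otimes> inv k) \<otimes> t = (inv t \<otimes> k) \<otimes> x \<otimes> inv (inv t \<otimes> k)"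
      using x tK by (simp add: m_assoc inv_mult_group)
    finally show False using L'(3) k' by blast
  qed
  then show "\<exists>L. p_open p G L \<and> (\<forall>k\<in>K. L #> g \<noteq> L #> (k \<otimes> x \<otimes> inv k))"
    using L(1) by blast
qed

text \<open>The \<open>H\<close>-class of \<open>x\<close> is the finite union of the
  \<open>K\<close>-classes of \<open>t x t^-1\<close>, where \<open>t\<close> runs through
  representatives of \<open>H\<close> modulo \<open>K\<close>. Each of these is closed in
  \<open>G\<close>, and the intersection of a separating subgroup with \<open>H\<close> separates
  inside \<open>H\<close>.\<close>

lemma conj_closed_in_open_subgroup:
  assumes K: "p_open p G K" and H: "subgroup H G" "K \<subseteq> H" and x: "x \<in> H"
    and closed: "\<And>y. y \<in> H \<Longrightarrow> conj_closed p G K y"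
  shows "conj_closed p (G\<lparr>carrier := H\<rparr>) H x"
  unfolding conj_closed_def
proof (intro ballI impI)
  fix g assume "g \<in> carrier (G\<lparr>carrier := H\<rparr>)"
    and nc: "\<forall>k\<in>H. g \<noteq> k \<otimes>\<^bsub>G\<lparr>carrier := H\<rparr>\<^esub> x \<otimes>\<^bsub>G\<lparr>carrier := H\<rparr>\<^esub> inv\<^bsub>G\<lparr>carrier := H\<rparr>\<^esub> k"
  then have g: "g \<in> H" by simp
  have Hc: "h \<in> carrier G" if "h \<in> H" for h using that H(1) by (rule subgroup.mem_carrier[rotated])
  have ng: "\<forall>k\<in>H. g \<noteq> k \<otimes> x \<otimes> inv k" using nc H(1) by (auto simp: m_inv_consistent)
  have Ks: "subgroup K G" using K by (rule p_open_subgroup)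
  obtain T where T: "T \<subseteq> H" "finite T" "\<forall>k\<in>H. \<exists>t\<in>T. K #> k = K #> t"
    using p_open_representatives[OF K, of H] Hc by blast
  have "\<exists>L. p_open p G L \<and> (\<forall>k\<in>K. L #> g \<noteq> L #> (k \<otimes> (t \<otimes> x \<otimes> inv t) \<otimes> inv k))"
    if t: "t \<in> T" for t
  proof -
    have tH: "t \<in> H" "t \<in> carrier G" using t T(1) Hc by auto
    have "g \<noteq> k \<otimes> (t \<otimes> x \<otimes> inv t) \<otimes> inv k" if k: "k \<in> K" for k
    proof -
      have "k \<in> carrier G" "x \<in> carrier G" using k x H(2) Hc by blast+
      then have "k \<otimes> (t \<otimes> x \<otimes> inv t) \<otimes> inv k = (k \<otimes> t) \<otimes> x \<otimes> inv (k \<otimes> t)"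
        using tH(2) by (simp add: m_assoc inv_mult_group)
      then show ?thesis using ng k H(2) subgroup.m_closed[OF H(1) _ tH(1)] by auto
    qed
    then show ?thesis
      using closed[of "t \<otimes> x \<otimes> inv t"] tH x Hc g H(1) unfolding conj_closed_def
      by (simp add: subgroup.m_closed subgroup.m_inv_closed)
  qed
  then have "\<forall>t\<in>T. \<exists>L. p_open p G L \<and>
      (\<forall>k\<in>K. L #> g \<noteq> L #> (k \<otimes> (t \<otimes> x \<otimes> inv t) \<otimes> inv k))"
    by blast
  from p_open_finite_choice[OF T(2) this] obtain L where L: "p_open p G L"
    "\<forall>t\<in>T. \<exists>L'. L \<subseteq> L' \<and> p_open p G L' \<and>
       (\<forall>k\<in>K. L' #> g \<noteq> L' #> (k \<otimes> (t \<otimes> x \<otimes> inv t) \<otimes> inv k))"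
    by blast
  have "(L \<inter> H) #> g \<noteq> (L \<inter> H) #> (h \<otimes> x \<otimes> inv h)" if h: "h \<in> H" for h
  proof
    assume eq: "(L \<inter> H) #> g = (L \<inter> H) #> (h \<otimes> x \<otimes> inv h)"
    obtain t where t: "t \<in> T" "K #> h = K #> t" using T(3) h by blast
    have tH: "t \<in> carrier G" using t T(1) Hc by auto
    obtain L' where L': "L \<subseteq> L'" "p_open p G L'"
      "\<forall>k\<in>K. L' #> g \<noteq> L' #> (k \<otimes> (t \<otimes> x \<otimes> inv t) \<otimes> inv k)"
      using L(2) t(1) by blast
    have k: "h \<otimes> inv t \<in> K" using t(2) r_coset_eq_iff[OF Ks] tH h Hc by simp
    have "L' #> g = L' #> (h \<otimes> x \<otimes> inv h)"
      using r_coset_eq_mono[OF subgroups_Inter_pair[OF p_open_subgroup[OF L(1)] H(1)]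
          p_open_subgroup[OF L'(2)] _ _ _ eq] L'(1) g x h Hc by auto
    also have "h \<otimes> x \<otimes> inv h = (h \<otimes> inv t) \<otimes> (t \<otimes> x \<otimes> inv t) \<otimes> inv (h \<otimes> inv t)"
      using x tH h Hc by (simp add: m_assoc inv_mult_group)
    finally show False using L'(3) k by blast
  qed
  then show "\<exists>L. p_open p (G\<lparr>carrier := H\<rparr>) L \<and> (\<forall>k\<in>H. L #>\<^bsub>G\<lparr>carrier := H\<rparr>\<^esub> g \<noteq>
      L #>\<^bsub>G\<lparr>carrier := H\<rparr>\<^esub> (k \<otimes>\<^bsub>G\<lparr>carrier := H\<rparr>\<^esub> x \<otimes>\<^bsub>G\<lparr>carrier := H\<rparr>\<^esub> inv\<^bsub>G\<lparr>carrier := H\<rparr>\<^esub> k))"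
    using p_open_restrict[OF H(1) L(1)] H(1) by (intro exI[of _ "L \<inter> H"]) (simp add: m_inv_consistent)
qed

text \<open>Conjugating by \<open>K\<close> is the same as conjugating by \<open>K\<langle>x\<rangle>\<close>, to which conjugacy separability
  applies.\<close>
lemma conj_closed_of_open_subgroup:
  assumes K: "p_open p G K" and x: "x \<in> carrier G"
    and closed: "\<And>H. subgroup H G \<Longrightarrow> K \<subseteq> H \<Longrightarrow> x \<in> H \<Longrightarrow> conj_closed p (G\<lparr>carrier := H\<rparr>) H x"
  shows "conj_closed p G K x"
  unfolding conj_closed_def
proof (intro ballI impI)
  fix g assume g: "g \<in> carrier G" and ng: "\<forall>k\<in>K. g \<noteq> k \<otimes> x \<otimes> inv k"
  have Ks: "subgroup K G" using K by (rule p_open_subgroup)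
  have Kc: "k \<in> carrier G" if "k \<in> K" for k using that Ks by (rule subgroup.mem_carrier[rotated])
  define H where "H = K <#> generate G {x}"
  have H: "subgroup H G"
    unfolding H_def using K x by (intro mult_norm_subgroup p_open_normal generate_is_subgroup) auto
  have mem: "k \<otimes> x [^] (i::int) \<in> H" if "k \<in> K" for k i
    using that x by (auto simp: H_def set_mult_def generate_pow)
  have KH: "K \<subseteq> H" using mem[where i=0] Kc by force
  have xH: "x \<in> H" using mem[OF subgroup.one_closed[OF Ks], of 1] x by simp
  have Hc: "h \<in> carrier G" if "h \<in> H" for h using that H by (rule subgroup.mem_carrier[rotated])
  have conj: "\<exists>k\<in>K. h \<otimes> x \<otimes> inv h = k \<otimes> x \<otimes> inv k" if h: "h \<in> H" for h
  proof -
    obtain k and i :: int where k: "k \<in> K" "h = k \<otimes> x [^] i"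
      using h x by (auto simp: H_def set_mult_def generate_pow)
    have "x [^] i \<otimes> x = x \<otimes> x [^] i"
      using x int_pow_mult[of x i 1] int_pow_mult[of x 1 i] by (simp add: add.commute)
    then have "x [^] i \<otimes> x \<otimes> inv (x [^] i) = x"
      using x by (simp add: m_assoc)
    moreover have "h \<otimes> x \<otimes> inv h = k \<otimes> (x [^] i \<otimes> x \<otimes> inv (x [^] i)) \<otimes> inv k"
      unfolding k(2) using Kc[OF k(1)] x by (simp add: inv_mult_group m_assoc)
    ultimately have "h \<otimes> x \<otimes> inv h = k \<otimes> x \<otimes> inv k" by simp
    with k(1) show ?thesis by blast
  qed
  show "\<exists>L. p_open p G L \<and> (\<forall>k\<in>K. L #> g \<noteq> L #> (k \<otimes> x \<otimes> inv k))"
  proof (cases "g \<in> H")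
    \<comment> \<open>Every \<open>K\<close>-conjugate of \<open>x\<close> lies in \<open>H\<close>,
      which is a union of \<open>K\<close>-cosets, so \<open>K\<close> itself separates an element
      outside \<open>H\<close>.\<close>
    case False
    have "K #> g \<noteq> K #> (k \<otimes> x \<otimes> inv k)" if k: "k \<in> K" for k
    proof
      assume "K #> g = K #> (k \<otimes> x \<otimes> inv k)"
      moreover have "k \<otimes> x \<otimes> inv k \<in> H"
        using k KH xH H by (meson subgroup.m_closed subgroup.m_inv_closed subsetD)
      ultimately have "g \<otimes> inv (k \<otimes> x \<otimes> inv k) \<in> H" "k \<otimes> x \<otimes> inv k \<in> H"
        using r_coset_eq_iff[OF Ks] g x k Kc KH by auto
      then have "g \<otimes> inv (k \<otimes> x \<otimes> inv k) \<otimes> (k \<otimes> x \<otimes> inv k) \<in> H"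
        by (rule subgroup.m_closed[OF H])
      then show False using False g x k Kc by (simp add: m_assoc)
    qed
    then show ?thesis using K by blast
  next
    case True
    have "\<forall>k\<in>H. g \<noteq> k \<otimes> x \<otimes> inv k" using ng conj by metis
    then obtain N where N: "p_open p (G\<lparr>carrier := H\<rparr>) N"
      "\<forall>k\<in>H. N #> g \<noteq> N #> (k \<otimes> x \<otimes> inv k)"
      using closed[OF H KH xH] True H unfolding conj_closed_def
      by (auto simp: m_inv_consistent cong: ball_cong)
    have Ns: "subgroup N G"
      using group.p_open_subgroup[OF subgroup_imp_group[OF H] N(1)] H incl_subgroup by blast
    \<comment> \<open>\<open>N\<close> is open only in \<open>H\<close>; its core transports the
      separation to \<open>G\<close>.\<close>
    obtain L where L: "p_open p G L" "L \<subseteq> N" using p_open_core[OF K H KH N(1)] by blast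
    have "L #> g \<noteq> L #> (k \<otimes> x \<otimes> inv k)" if k: "k \<in> K" for k
      using r_coset_eq_mono[OF p_open_subgroup[OF L(1)] Ns L(2), of g "k \<otimes> x \<otimes> inv k"]
        N(2) k KH g x Kc by auto
    then show ?thesis using L(1) by blast
  qed
qed

text \<open>The quantifier over subgroups \<open>H\<close> turns into one over groups of
  conjugators: the topology is always that of \<open>G\<close>, and only the set of admissible
  conjugators shrinks. In this form the property can be checked for one element and one
  \<open>K\<close> at a time.\<close>

lemma p_hereditarily_conjugacy_separable_iff:
  assumes p: "Factorial_Ring.prime p"
  shows "p_hereditarily_conjugacy_separable p G \<longleftrightarrow>
    (\<forall>x\<in>carrier G. \<forall>K. p_open p G K \<longrightarrow> conj_closed p G K x)" (is "?L \<longleftrightarrow> ?R")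
proof
  assume L: ?L
  show ?R
  proof (intro ballI allI impI)
    fix x K assume x: "x \<in> carrier G" and K: "p_open p G K"
    show "conj_closed p G K x"
    proof (rule conj_closed_of_open_subgroup[OF K x])
      fix H assume H: "subgroup H G" "K \<subseteq> H" "x \<in> H"
      have "p_conjugacy_separable p (G\<lparr>carrier := H\<rparr>)"
        using L H K p_open_iff_finite_p_group[OF p p_open_normal[OF K]] p_open_normal[OF K]
        unfolding p_hereditarily_conjugacy_separable_def by blast
      then show "conj_closed p (G\<lparr>carrier := H\<rparr>) H x"
        using group.p_conjugacy_separable_iff_p_open[OF subgroup_imp_group[OF H(1)] p] H(3) by simp
    qed
  qed
next
  assume R: ?R
  have "p_conjugacy_separable p (G\<lparr>carrier := H\<rparr>)"
    if H: "subgroup H G" and N: "N \<lhd> G" "finite_p_group p (G Mod N)" "N \<subseteq> H" for H N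
  proof -
    have "p_open p G N" using N p_open_iff_finite_p_group[OF p N(1)] by simp
    then have "conj_closed p (G\<lparr>carrier := H\<rparr>) H x" if "x \<in> H" for x
      using conj_closed_in_open_subgroup[of p N H x] H N(3) that R
      by (meson subgroup.mem_carrier)
    then show ?thesis
      using group.p_conjugacy_separable_iff_p_open[OF subgroup_imp_group[OF H] p] by simp
  qed
  moreover have "p_conjugacy_separable p G"
    using R p_open_carrier p_conjugacy_separable_iff_p_open[OF p] by blast
  ultimately show ?L
    unfolding p_hereditarily_conjugacy_separable_def by blast
qed

text \<open>The only conjugate of the identity is the identity, so closedness at
  \<open>\<one>\<close> is residual finiteness with respect to p-quotients; an intersection of
  finitely many subgroups handles all of \<open>E\<close> together.\<close>

lemma conj_closed_separates_finite:
  assumes closed: "conj_closed p G (carrier G) \<one>" and E: "finite E" "E \<subseteq> carrier G"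
  shows "\<exists>M. p_open p G M \<and> M \<inter> E \<subseteq> {\<one>}"
proof -
  have "\<exists>L. p_open p G L \<and> e \<notin> L" if e: "e \<in> E - {\<one>}" for e
  proof -
    have "e \<in> carrier G" "\<forall>k\<in>carrier G. e \<noteq> k \<otimes> \<one> \<otimes> inv k" using e E by auto
    then obtain L where L: "p_open p G L" "L #> e \<noteq> L #> (\<one> \<otimes> \<one> \<otimes> inv \<one>)"
      using closed unfolding conj_closed_def by blast
    then show ?thesis
      using \<open>e \<in> carrier G\<close> r_coset_eq_iff[OF p_open_subgroup[OF L(1)]] by auto
  qed
  then obtain L where "p_open p G L" "\<forall>e\<in>E - {\<one>}. \<exists>L'. L \<subseteq> L' \<and> p_open p G L' \<and> e \<notin> L'"
    using p_open_finite_choice[of "E - {\<one>}" p "\<lambda>e L. e \<notin> L"] E(1) by auto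
  then show ?thesis by blast
qed

end

section \<open>Wreath products\<close>

locale wreath = A: group A + B: group B
  for A :: "('a, 'm) monoid_scheme" and B :: "('b, 'n) monoid_scheme"
begin

sublocale W: group "A \<wr> B"
  using A.group_axioms B.group_axioms by (rule group_wreath_product)

lemma base_iff:
  "f \<in> carrier (wreath_base A B) \<longleftrightarrow>
     f \<in> carrier B \<rightarrow>\<^sub>E carrier A \<and> finite {s \<in> carrier B. f s \<noteq> \<one>\<^bsub>A\<^esub>}"
  by (simp add: carrier_sum_group)

lemma base_closed [simp]:
  "f \<in> carrier (wreath_base A B) \<Longrightarrow> s \<in> carrier B \<Longrightarrow> f s \<in> carrier A"
  by (auto simp: base_iff)

lemma base_eqI:
  assumes "f \<in> carrier (wreath_base A B)" "g \<in> carrier (wreath_base A B)"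
    "\<And>s. s \<in> carrier B \<Longrightarrow> f s = g s"
  shows "f = g"
  using assms by (auto simp: base_iff intro: PiE_ext)

lemma wreath_carrier_iff:
  "x \<in> carrier (A \<wr> B) \<longleftrightarrow> fst x \<in> carrier (wreath_base A B) \<and> snd x \<in> carrier B"
  by (cases x) (simp add: wreath_product_def)

lemma fst_closed [simp]: "x \<in> carrier (A \<wr> B) \<Longrightarrow> fst x \<in> carrier (wreath_base A B)"
  and snd_closed [simp]: "x \<in> carrier (A \<wr> B) \<Longrightarrow> snd x \<in> carrier B"
  by (simp_all add: wreath_carrier_iff)

lemma wreath_eqI:
  assumes "x \<in> carrier (A \<wr> B)" "y \<in> carrier (A \<wr> B)"
    "\<And>s. s \<in> carrier B \<Longrightarrow> fst x s = fst y s" "snd x = snd y"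
  shows "x = y"
  using assms base_eqI[of "fst x" "fst y"] by (simp add: prod_eq_iff)

lemma fst_mult_base: "fst (x \<otimes>\<^bsub>A \<wr> B\<^esub> y) =
    fst x \<otimes>\<^bsub>wreath_base A B\<^esub> left_translate B (snd x) (fst y)"
  and snd_mult [simp]: "snd (x \<otimes>\<^bsub>A \<wr> B\<^esub> y) = snd x \<otimes>\<^bsub>B\<^esub> snd y"
  by (simp_all add: wreath_product_def split_def)

lemma fst_mult [simp]:
  "s \<in> carrier B \<Longrightarrow> fst (x \<otimes>\<^bsub>A \<wr> B\<^esub> y) s = fst x s \<otimes>\<^bsub>A\<^esub> fst y (inv\<^bsub>B\<^esub> (snd x) \<otimes>\<^bsub>B\<^esub> s)"
  by (simp add: fst_mult_base left_translate_def)

lemma fst_one [simp]: "s \<in> carrier B \<Longrightarrow> fst \<one>\<^bsub>A \<wr> B\<^esub> s = \<one>\<^bsub>A\<^esub>"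
  and snd_one [simp]: "snd \<one>\<^bsub>A \<wr> B\<^esub> = \<one>\<^bsub>B\<^esub>"
  by (simp_all add: wreath_product_def)

lemma snd_inv [simp]:
  assumes "x \<in> carrier (A \<wr> B)"
  shows "snd (inv\<^bsub>A \<wr> B\<^esub> x) = inv\<^bsub>B\<^esub> (snd x)"
proof -
  have "snd (inv\<^bsub>A \<wr> B\<^esub> x) \<otimes>\<^bsub>B\<^esub> snd x = \<one>\<^bsub>B\<^esub>"
    using assms by (metis snd_mult W.l_inv snd_one)
  then show ?thesis using assms by (intro B.inv_equality[symmetric]) auto
qed

lemma fst_inv [simp]:
  assumes "x \<in> carrier (A \<wr> B)" "s \<in> carrier B"
  shows "fst (inv\<^bsub>A \<wr> B\<^esub> x) s = inv\<^bsub>A\<^esub> (fst x (snd x \<otimes>\<^bsub>B\<^esub> s))"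
proof -
  have "fst (inv\<^bsub>A \<wr> B\<^esub> x \<otimes>\<^bsub>A \<wr> B\<^esub> x) s = \<one>\<^bsub>A\<^esub>" using assms by (simp del: fst_mult)
  then have "fst (inv\<^bsub>A \<wr> B\<^esub> x) s \<otimes>\<^bsub>A\<^esub> fst x (snd x \<otimes>\<^bsub>B\<^esub> s) = \<one>\<^bsub>A\<^esub>" using assms
    by (subst (asm) fst_mult) auto
  then show ?thesis using assms by (simp add: A.inv_equality)
qed

lemma snd_pow [simp]:
  "x \<in> carrier (A \<wr> B) \<Longrightarrow> snd (x [^]\<^bsub>A \<wr> B\<^esub> (n::nat)) = snd x [^]\<^bsub>B\<^esub> n"
  by (induction n) auto

lemma snd_group_hom: "group_hom (A \<wr> B) B snd"
  by unfold_locales (auto simp: hom_def)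

definition single :: "'a \<Rightarrow> 'b \<Rightarrow> ('b \<Rightarrow> 'a) \<times> 'b" where
  "single a t = (\<lambda>s\<in>carrier B. if s = t then a else \<one>\<^bsub>A\<^esub>, \<one>\<^bsub>B\<^esub>)"

definition top_elem :: "'b \<Rightarrow> ('b \<Rightarrow> 'a) \<times> 'b" where
  "top_elem b = (\<lambda>s\<in>carrier B. \<one>\<^bsub>A\<^esub>, b)"

lemma fst_single [simp]: "s \<in> carrier B \<Longrightarrow> fst (single a t) s = (if s = t then a else \<one>\<^bsub>A\<^esub>)"
  and snd_single [simp]: "snd (single a t) = \<one>\<^bsub>B\<^esub>"
  and fst_top_elem [simp]: "s \<in> carrier B \<Longrightarrow> fst (top_elem b) s = \<one>\<^bsub>A\<^esub>"
  and snd_top_elem [simp]: "snd (top_elem b) = b"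
  by (simp_all add: single_def top_elem_def)

lemma single_closed [simp]:
  assumes "a \<in> carrier A"
  shows "single a t \<in> carrier (A \<wr> B)"
proof -
  have "finite {s \<in> carrier B. (if s = t then a else \<one>\<^bsub>A\<^esub>) \<noteq> \<one>\<^bsub>A\<^esub>}"
    by (rule finite_subset[of _ "{t}"]) auto
  then show ?thesis
    using assms by (auto simp: wreath_carrier_iff base_iff single_def cong: conj_cong)
qed

lemma top_elem_closed [simp]: "b \<in> carrier B \<Longrightarrow> top_elem b \<in> carrier (A \<wr> B)"
  by (simp add: wreath_carrier_iff base_iff top_elem_def)

lemma single_hom: "t \<in> carrier B \<Longrightarrow> group_hom A (A \<wr> B) (\<lambda>a. single a t)"
  by unfold_locales (auto simp: hom_def intro!: wreath_eqI)

lemma top_elem_hom: "group_hom B (A \<wr> B) top_elem"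
  by unfold_locales (auto simp: hom_def intro!: wreath_eqI)

lemma conj_top_elem_single:
  assumes "a \<in> carrier A" "b \<in> carrier B" "t \<in> carrier B"
  shows "top_elem b \<otimes>\<^bsub>A \<wr> B\<^esub> single a t \<otimes>\<^bsub>A \<wr> B\<^esub> inv\<^bsub>A \<wr> B\<^esub> (top_elem b) = single a (b \<otimes>\<^bsub>B\<^esub> t)"
  using assms
  by (intro wreath_eqI) (auto simp: B.inv_solve_left')

end

text \<open>\<open>\<theta> f s\<close> stands for the product of \<open>f\<close> over the coset \<open>sM\<close>; it makes sense both if \<open>M\<close> is
  trivial and if \<open>A\<close> is abelian.\<close>
locale wreath_coset_map = wreath A B
  for A :: "('a, 'm) monoid_scheme" and B :: "('b, 'n) monoid_scheme" +
  fixes M :: "'b set" and \<theta> :: "('b \<Rightarrow> 'a) \<Rightarrow> 'b \<Rightarrow> 'a"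
  assumes M: "M \<lhd> B"
    and \<theta>_closed: "f \<in> carrier (wreath_base A B) \<Longrightarrow> s \<in> carrier B \<Longrightarrow> \<theta> f s \<in> carrier A"
    and \<theta>_mult: "f \<in> carrier (wreath_base A B) \<Longrightarrow> g \<in> carrier (wreath_base A B) \<Longrightarrow>
      s \<in> carrier B \<Longrightarrow> \<theta> (f \<otimes>\<^bsub>wreath_base A B\<^esub> g) s = \<theta> f s \<otimes>\<^bsub>A\<^esub> \<theta> g s"
    and \<theta>_translate: "b \<in> carrier B \<Longrightarrow> f \<in> carrier (wreath_base A B) \<Longrightarrow> s \<in> carrier B \<Longrightarrow>
      \<theta> (left_translate B b f) s = \<theta> f (inv\<^bsub>B\<^esub> b \<otimes>\<^bsub>B\<^esub> s)"
    and \<theta>_right: "f \<in> carrier (wreath_base A B) \<Longrightarrow> s \<in> carrier B \<Longrightarrow> m \<in> M \<Longrightarrow>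
      \<theta> f (s \<otimes>\<^bsub>B\<^esub> m) = \<theta> f s"
    and \<theta>_isolated: "f \<in> carrier (wreath_base A B) \<Longrightarrow> s \<in> carrier B \<Longrightarrow>
      (\<And>m. m \<in> M \<Longrightarrow> m \<noteq> \<one>\<^bsub>B\<^esub> \<Longrightarrow> f (s \<otimes>\<^bsub>B\<^esub> m) = \<one>\<^bsub>A\<^esub>) \<Longrightarrow> \<theta> f s = f s"
begin

lemma M_subgroup: "subgroup M B"
  using M by (rule normal_imp_subgroup)

lemma M_carrier [simp]: "m \<in> M \<Longrightarrow> m \<in> carrier B"
  using M_subgroup by (rule subgroup.mem_carrier)

lemma \<theta>_left:
  assumes "f \<in> carrier (wreath_base A B)" "s \<in> carrier B" "m \<in> M"
  shows "\<theta> f (m \<otimes>\<^bsub>B\<^esub> s) = \<theta> f s"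
proof -
  have "inv\<^bsub>B\<^esub> s \<otimes>\<^bsub>B\<^esub> m \<otimes>\<^bsub>B\<^esub> s \<in> M" using assms M normal.inv_op_closed1 by metis
  moreover have "m \<otimes>\<^bsub>B\<^esub> s = s \<otimes>\<^bsub>B\<^esub> (inv\<^bsub>B\<^esub> s \<otimes>\<^bsub>B\<^esub> m \<otimes>\<^bsub>B\<^esub> s)" using assms by (simp add: B.m_assoc)
  ultimately show ?thesis using \<theta>_right assms by metis
qed

text \<open>In \<open>\<Theta>_mult\<close> the top part of the left factor shifts the point, so
  \<open>\<Theta>\<close> is a crossed homomorphism: the base component of the map to the wreath
  product over \<open>B/M\<close>.\<close>

definition \<Theta> :: "('b \<Rightarrow> 'a) \<times> 'b \<Rightarrow> 'b \<Rightarrow> 'a" where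
  "\<Theta> x s = \<theta> (fst x) s"

lemma \<Theta>_closed [simp]: "x \<in> carrier (A \<wr> B) \<Longrightarrow> s \<in> carrier B \<Longrightarrow> \<Theta> x s \<in> carrier A"
  by (simp add: \<Theta>_def \<theta>_closed)

lemma \<Theta>_mult [simp]:
  assumes "x \<in> carrier (A \<wr> B)" "y \<in> carrier (A \<wr> B)" "s \<in> carrier B"
  shows "\<Theta> (x \<otimes>\<^bsub>A \<wr> B\<^esub> y) s = \<Theta> x s \<otimes>\<^bsub>A\<^esub> \<Theta> y (inv\<^bsub>B\<^esub> (snd x) \<otimes>\<^bsub>B\<^esub> s)"
  using assms left_translate_closed[OF A.group_axioms B.group_axioms]
  by (simp add: \<Theta>_def fst_mult_base \<theta>_mult \<theta>_translate del: mult_sum_group)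

lemma \<Theta>_one [simp]:
  assumes "s \<in> carrier B"
  shows "\<Theta> \<one>\<^bsub>A \<wr> B\<^esub> s = \<one>\<^bsub>A\<^esub>"
  using \<Theta>_mult[of "\<one>\<^bsub>A \<wr> B\<^esub>" "\<one>\<^bsub>A \<wr> B\<^esub>" s] assms by (simp add: A.l_cancel_one')

lemma \<Theta>_inv [simp]:
  assumes "x \<in> carrier (A \<wr> B)" "s \<in> carrier B"
  shows "\<Theta> (inv\<^bsub>A \<wr> B\<^esub> x) s = inv\<^bsub>A\<^esub> (\<Theta> x (snd x \<otimes>\<^bsub>B\<^esub> s))"
proof -
  have "\<Theta> (inv\<^bsub>A \<wr> B\<^esub> x) s \<otimes>\<^bsub>A\<^esub> \<Theta> x (snd x \<otimes>\<^bsub>B\<^esub> s) = \<one>\<^bsub>A\<^esub>"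
    using assms \<Theta>_mult[of "inv\<^bsub>A \<wr> B\<^esub> x" x s] by simp
  then show ?thesis using assms by (simp add: A.inv_equality)
qed

lemma \<Theta>_left: "x \<in> carrier (A \<wr> B) \<Longrightarrow> s \<in> carrier B \<Longrightarrow> m \<in> M \<Longrightarrow> \<Theta> x (m \<otimes>\<^bsub>B\<^esub> s) = \<Theta> x s"
  by (simp add: \<Theta>_def \<theta>_left)

lemma \<Theta>_cong_M:
  assumes "x \<in> carrier (A \<wr> B)" "s \<in> carrier B" "t \<in> carrier B" "s \<otimes>\<^bsub>B\<^esub> inv\<^bsub>B\<^esub> t \<in> M"
  shows "\<Theta> x s = \<Theta> x t"
  using \<Theta>_left[OF assms(1,3,4)] assms by (simp add: B.m_assoc)

text \<open>The locale evaluates \<open>\<theta>\<close> only where a function is isolated in its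
  coset. The quotient of \<open>x\<close> by \<open>y\<close> is trivial on the whole coset, hence
  isolated there with value one, and multiplicativity transfers this to \<open>x\<close> and
  \<open>y\<close>.\<close>

lemma \<Theta>_local:
  assumes x: "x \<in> carrier (A \<wr> B)" and y: "y \<in> carrier (A \<wr> B)" and s: "s \<in> carrier B"
    and snd: "snd x = snd y"
    and eq: "\<And>m. m \<in> M \<Longrightarrow> fst x (s \<otimes>\<^bsub>B\<^esub> m) = fst y (s \<otimes>\<^bsub>B\<^esub> m)"
  shows "\<Theta> x s = \<Theta> y s"
proof -
  let ?z = "x \<otimes>\<^bsub>A \<wr> B\<^esub> inv\<^bsub>A \<wr> B\<^esub> y"
  have "fst ?z (s \<otimes>\<^bsub>B\<^esub> m) = \<one>\<^bsub>A\<^esub>" if "m \<in> M" for m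
    using that x y s eq[OF that] by (simp add: snd)
  moreover have "fst ?z s = \<one>\<^bsub>A\<^esub>"
    using calculation[of "\<one>\<^bsub>B\<^esub>"] M_subgroup s by (simp add: subgroup.one_closed)
  ultimately have "\<Theta> ?z s = \<one>\<^bsub>A\<^esub>"
    unfolding \<Theta>_def using x y s by (subst \<theta>_isolated) auto
  then have "\<Theta> x s \<otimes>\<^bsub>A\<^esub> inv\<^bsub>A\<^esub> (\<Theta> y s) = \<one>\<^bsub>A\<^esub>"
    using x y s by (simp add: snd)
  then show ?thesis using x y s by (simp add: A.m_inv_eq_one_iff)
qed

text \<open>A top part in \<open>M\<close> fixes every coset, so the crossed homomorphism is an
  ordinary one along the powers of \<open>x\<close>.\<close>

lemma \<Theta>_pow:
  assumes x: "x \<in> carrier (A \<wr> B)" "snd x \<in> M" and s: "s \<in> carrier B"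
  shows "\<Theta> (x [^]\<^bsub>A \<wr> B\<^esub> (n::nat)) s = \<Theta> x s [^]\<^bsub>A\<^esub> n"
proof (induction n)
  case (Suc n)
  have "snd x [^]\<^bsub>B\<^esub> n \<in> M" using B.subgroup_nat_pow_closed[OF M_subgroup x(2)] .
  then show ?case using x s Suc M_subgroup by (simp add: \<Theta>_left subgroup.m_inv_closed)
qed (use s in simp)

lemma \<Theta>_single:
  assumes a: "a \<in> carrier A" and s: "s \<in> carrier B" and t: "t \<in> carrier B"
  shows "\<Theta> (single a t) s = (if inv\<^bsub>B\<^esub> s \<otimes>\<^bsub>B\<^esub> t \<in> M then a else \<one>\<^bsub>A\<^esub>)"
proof (cases "inv\<^bsub>B\<^esub> s \<otimes>\<^bsub>B\<^esub> t \<in> M")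
  case True
  have "\<Theta> (single a t) s = \<Theta> (single a t) (s \<otimes>\<^bsub>B\<^esub> (inv\<^bsub>B\<^esub> s \<otimes>\<^bsub>B\<^esub> t))"
    unfolding \<Theta>_def by (rule \<theta>_right[symmetric]) (use a s t True in auto)
  also have "\<dots> = \<theta> (fst (single a t)) t" using s t by (simp add: \<Theta>_def)
  also have "\<dots> = a"
    using a t by (subst \<theta>_isolated) (auto simp: B.r_cancel_one)
  finally show ?thesis using True by simp
next
  case False
  have "s \<otimes>\<^bsub>B\<^esub> m \<noteq> t" if "m \<in> M" for m using False that s t by auto
  moreover have "s \<noteq> t" using False s M_subgroup by (auto simp: subgroup.one_closed)
  ultimately show ?thesis
    unfolding \<Theta>_def using a s t False by (subst \<theta>_isolated) auto
qed

text \<open>For normal \<open>L\<close> this is the kernel of the map to the wreath product of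
  \<open>A/L\<close> by \<open>B/M\<close> given by \<open>\<Theta>\<close> and
  \<open>snd\<close>.\<close>

definition coset_subgroup :: "'a set \<Rightarrow> (('b \<Rightarrow> 'a) \<times> 'b) set" where
  "coset_subgroup L = {x \<in> carrier (A \<wr> B). snd x \<in> M \<and> (\<forall>s\<in>carrier B. \<Theta> x s \<in> L)}"

lemma top_elem_in_coset_subgroup:
  assumes "subgroup L A" "m \<in> M"
  shows "top_elem m \<in> coset_subgroup L"
proof -
  have "\<Theta> (top_elem m) s = \<one>\<^bsub>A\<^esub>" if "s \<in> carrier B" for s
    unfolding \<Theta>_def using that assms(2) by (subst \<theta>_isolated) auto
  then show ?thesis using assms by (simp add: coset_subgroup_def subgroup.one_closed)
qed

lemma coset_subgroup_normal:
  assumes L: "L \<lhd> A"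
  shows "coset_subgroup L \<lhd> A \<wr> B"
  unfolding W.normal_inv_iff
proof (intro conjI ballI)
  have Ls: "subgroup L A" using L by (rule normal_imp_subgroup)
  show "subgroup (coset_subgroup L) (A \<wr> B)"
  proof (rule W.subgroupI)
    show "coset_subgroup L \<noteq> {}"
      using top_elem_in_coset_subgroup[OF Ls subgroup.one_closed[OF M_subgroup]] by blast
  qed (use Ls M_subgroup in \<open>auto simp: coset_subgroup_def subgroup.m_closed subgroup.m_inv_closed\<close>)
  show "k \<otimes>\<^bsub>A \<wr> B\<^esub> x \<otimes>\<^bsub>A \<wr> B\<^esub> inv\<^bsub>A \<wr> B\<^esub> k \<in> coset_subgroup L"
    if k: "k \<in> carrier (A \<wr> B)" and x: "x \<in> coset_subgroup L" for k x
  proof -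
    have xc: "x \<in> carrier (A \<wr> B)" "snd x \<in> M" using x by (auto simp: coset_subgroup_def)
    have sM: "snd k \<otimes>\<^bsub>B\<^esub> snd x \<otimes>\<^bsub>B\<^esub> inv\<^bsub>B\<^esub> (snd k) \<in> M"
      using M xc k by (simp add: normal.inv_op_closed2)
    have "\<Theta> (k \<otimes>\<^bsub>A \<wr> B\<^esub> x \<otimes>\<^bsub>A \<wr> B\<^esub> inv\<^bsub>A \<wr> B\<^esub> k) s \<in> L" if s: "s \<in> carrier B" for s
    proof -
      \<comment> \<open>Modulo \<open>M\<close> the top part of \<open>x\<close> is trivial, so the
        shifts caused by \<open>k\<close> and its inverse cancel on cosets.\<close>
      have "\<Theta> k (snd k \<otimes>\<^bsub>B\<^esub> (inv\<^bsub>B\<^esub> (snd k \<otimes>\<^bsub>B\<^esub> snd x) \<otimes>\<^bsub>B\<^esub> s)) = \<Theta> k s"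
        by (rule \<Theta>_cong_M)
          (use k xc s subgroup.m_inv_closed[OF M_subgroup sM] in
            \<open>auto simp: B.inv_mult_group B.m_assoc\<close>)
      then have "\<Theta> (k \<otimes>\<^bsub>A \<wr> B\<^esub> x \<otimes>\<^bsub>A \<wr> B\<^esub> inv\<^bsub>A \<wr> B\<^esub> k) s =
          \<Theta> k s \<otimes>\<^bsub>A\<^esub> \<Theta> x (inv\<^bsub>B\<^esub> (snd k) \<otimes>\<^bsub>B\<^esub> s) \<otimes>\<^bsub>A\<^esub> inv\<^bsub>A\<^esub> (\<Theta> k s)"
        using k xc s by simp
      moreover have "\<Theta> x (inv\<^bsub>B\<^esub> (snd k) \<otimes>\<^bsub>B\<^esub> s) \<in> L"
        using k x s by (simp add: coset_subgroup_def)
      ultimately show ?thesis using k s normal.inv_op_closed2[OF L] by simp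
    qed
    then show ?thesis using k xc sM by (simp add: coset_subgroup_def)
  qed
qed

text \<open>An element is described up to the subgroup by the \<open>M\<close>-coset of its top part
  and the \<open>L\<close>-cosets of \<open>\<Theta>\<close> at finitely many representatives. For
  torsion, one p-power moves the top part into \<open>M\<close>; from then on powers are taken
  coordinatewise and the uniform exponent of \<open>A/L\<close> applies.\<close>

lemma coset_subgroup_p_open:
  assumes M: "p_open p B M" and L: "p_open p A L"
  shows "p_open p (A \<wr> B) (coset_subgroup L)"
proof -
  have Ls: "subgroup L A" using L by (rule A.p_open_subgroup)
  obtain T where T: "T \<subseteq> carrier B" "finite T"
    "\<forall>s\<in>carrier B. \<exists>t\<in>T. M #>\<^bsub>B\<^esub> s = M #>\<^bsub>B\<^esub> t"
    using B.p_open_representatives[OF M subset_refl] by auto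
  define c where "c x = (M #>\<^bsub>B\<^esub> snd x, \<lambda>t\<in>T. L #>\<^bsub>A\<^esub> \<Theta> x t)" for x
  show ?thesis
  proof (rule W.p_openI)
    show "coset_subgroup L \<lhd> A \<wr> B"
      using L by (intro coset_subgroup_normal A.p_open_normal)
    have "c ` carrier (A \<wr> B) \<subseteq>
        (\<lambda>x. M #>\<^bsub>B\<^esub> x) ` carrier B \<times> (T \<rightarrow>\<^sub>E (\<lambda>x. L #>\<^bsub>A\<^esub> x) ` carrier A)"
    proof (intro image_subsetI)
      fix x assume "x \<in> carrier (A \<wr> B)"
      then have "snd x \<in> carrier B" "\<And>t. t \<in> T \<Longrightarrow> \<Theta> x t \<in> carrier A"
        using T(1) by auto
      then show "c x \<in> (\<lambda>x. M #>\<^bsub>B\<^esub> x) ` carrier B \<times> (T \<rightarrow>\<^sub>E (\<lambda>x. L #>\<^bsub>A\<^esub> x) ` carrier A)"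
        unfolding c_def by auto
    qed
    moreover have "finite ((\<lambda>x. M #>\<^bsub>B\<^esub> x) ` carrier B \<times> (T \<rightarrow>\<^sub>E (\<lambda>x. L #>\<^bsub>A\<^esub> x) ` carrier A))"
      using B.p_open_finite_cosets[OF M] A.p_open_finite_cosets[OF L] T(2)
      by (intro finite_SigmaI finite_PiE) auto
    ultimately show "finite (c ` carrier (A \<wr> B))" by (rule finite_subset)
    show "x \<otimes>\<^bsub>A \<wr> B\<^esub> inv\<^bsub>A \<wr> B\<^esub> y \<in> coset_subgroup L"
      if x: "x \<in> carrier (A \<wr> B)" and y: "y \<in> carrier (A \<wr> B)" and eq: "c x = c y" for x y
    proof -
      have sM: "snd x \<otimes>\<^bsub>B\<^esub> inv\<^bsub>B\<^esub> (snd y) \<in> M"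
        using eq B.r_coset_eq_iff[OF M_subgroup] x y by (simp add: c_def)
      have "\<Theta> x s \<otimes>\<^bsub>A\<^esub> inv\<^bsub>A\<^esub> (\<Theta> y (snd y \<otimes>\<^bsub>B\<^esub> (inv\<^bsub>B\<^esub> (snd x) \<otimes>\<^bsub>B\<^esub> s))) \<in> L"
        if s: "s \<in> carrier B" for s
      proof -
        obtain t where t: "t \<in> T" "M #>\<^bsub>B\<^esub> s = M #>\<^bsub>B\<^esub> t" using T(3) s by blast
        have tc: "t \<in> carrier B" using t(1) T(1) by blast
        have st: "s \<otimes>\<^bsub>B\<^esub> inv\<^bsub>B\<^esub> t \<in> M" using t(2) B.r_coset_eq_iff[OF M_subgroup] s tc by simp
        have "\<Theta> y (snd y \<otimes>\<^bsub>B\<^esub> (inv\<^bsub>B\<^esub> (snd x) \<otimes>\<^bsub>B\<^esub> s)) = \<Theta> y s"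
          by (rule \<Theta>_cong_M)
            (use x y s subgroup.m_inv_closed[OF M_subgroup sM] in
              \<open>auto simp: B.inv_mult_group B.m_assoc\<close>)
        moreover have "\<Theta> x s = \<Theta> x t" "\<Theta> y s = \<Theta> y t"
          using \<Theta>_cong_M st x y s tc by auto
        moreover have "L #>\<^bsub>A\<^esub> \<Theta> x t = L #>\<^bsub>A\<^esub> \<Theta> y t"
          using arg_cong[OF eq, of "\<lambda>z. snd z t"] t(1) by (simp add: c_def)
        ultimately show ?thesis using A.r_coset_eq_iff[OF Ls] x y tc by simp
      qed
      then show ?thesis using x y sM by (simp add: coset_subgroup_def)
    qed
    show "\<exists>n. x [^]\<^bsub>A \<wr> B\<^esub> (p ^ n :: nat) \<in> coset_subgroup L" if x: "x \<in> carrier (A \<wr> B)" for x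
    proof -
      obtain n where n: "snd x [^]\<^bsub>B\<^esub> (p ^ n :: nat) \<in> M"
        using M snd_closed[OF x] unfolding p_open_def by blast
      obtain m where m: "\<forall>a\<in>carrier A. a [^]\<^bsub>A\<^esub> (p ^ m :: nat) \<in> L"
        using A.p_open_exponent[OF L] by blast
      define z where "z = x [^]\<^bsub>A \<wr> B\<^esub> (p ^ n :: nat)"
      have z: "z \<in> carrier (A \<wr> B)" "snd z \<in> M" using x n by (simp_all add: z_def)
      then have "z [^]\<^bsub>A \<wr> B\<^esub> (p ^ m :: nat) \<in> coset_subgroup L"
        using m B.subgroup_nat_pow_closed[OF M_subgroup z(2)]
        by (simp add: coset_subgroup_def \<Theta>_pow)
      then show ?thesis using x unfolding z_def by (metis W.nat_pow_pow power_add)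
    qed
  qed
qed

end

section \<open>Coset subgroups inside a given normal subgroup, and the conjugacy equation\<close>

context wreath_coset_map
begin

text \<open>Conjugation by the top element of \<open>s m s^-1\<close>, which lies in
  \<open>K\<close>, carries \<open>single a s\<close> to \<open>single a (s m)\<close>. The product
  is therefore a commutator with an element of \<open>K\<close>.\<close>

lemma single_swap_in_normal:
  assumes K: "K \<lhd> A \<wr> B" and top: "\<And>m. m \<in> M \<Longrightarrow> top_elem m \<in> K"
    and a: "a \<in> carrier A" and s: "s \<in> carrier B" and m: "m \<in> M"
  shows "inv\<^bsub>A \<wr> B\<^esub> (single a (s \<otimes>\<^bsub>B\<^esub> m)) \<otimes>\<^bsub>A \<wr> B\<^esub> single a s \<in> K"
proof -
  define c where "c = s \<otimes>\<^bsub>B\<^esub> m \<otimes>\<^bsub>B\<^esub> inv\<^bsub>B\<^esub> s"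
  have c: "c \<in> M" using s m M by (simp add: c_def normal.inv_op_closed2)
  have Ks: "subgroup K (A \<wr> B)" using K by (rule normal_imp_subgroup)
  let ?X = "single a s" and ?C = "top_elem c"
  have cX: "?X \<in> carrier (A \<wr> B)" "?C \<in> carrier (A \<wr> B)" "?C \<in> K"
    using a c top by auto
  have "single a (s \<otimes>\<^bsub>B\<^esub> m) = ?C \<otimes>\<^bsub>A \<wr> B\<^esub> ?X \<otimes>\<^bsub>A \<wr> B\<^esub> inv\<^bsub>A \<wr> B\<^esub> ?C"
    using conj_top_elem_single[of a c s] a s m c by (simp add: c_def B.m_assoc)
  then have "inv\<^bsub>A \<wr> B\<^esub> (single a (s \<otimes>\<^bsub>B\<^esub> m)) \<otimes>\<^bsub>A \<wr> B\<^esub> ?X =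
      ?C \<otimes>\<^bsub>A \<wr> B\<^esub> (inv\<^bsub>A \<wr> B\<^esub> ?X \<otimes>\<^bsub>A \<wr> B\<^esub> inv\<^bsub>A \<wr> B\<^esub> ?C \<otimes>\<^bsub>A \<wr> B\<^esub> ?X)"
    using cX by (simp add: W.inv_mult_group W.m_assoc)
  moreover have "inv\<^bsub>A \<wr> B\<^esub> ?X \<otimes>\<^bsub>A \<wr> B\<^esub> inv\<^bsub>A \<wr> B\<^esub> ?C \<otimes>\<^bsub>A \<wr> B\<^esub> ?X \<in> K"
    using normal.inv_op_closed1[OF K cX(1) subgroup.m_inv_closed[OF Ks cX(3)]] .
  ultimately show ?thesis using subgroup.m_closed[OF Ks cX(3)] by simp
qed

text \<open>The induction moves the values of an element along cosets of \<open>M\<close> until the support meets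
  the coset in a single point.\<close>
lemma coset_subgroup_subset:
  assumes K: "K \<lhd> A \<wr> B" and L: "subgroup L A"
    and single: "\<And>a. a \<in> L \<Longrightarrow> single a \<one>\<^bsub>B\<^esub> \<in> K"
    and top: "\<And>m. m \<in> M \<Longrightarrow> top_elem m \<in> K"
  shows "coset_subgroup L \<subseteq> K"
proof
  have Ks: "subgroup K (A \<wr> B)" using K by (rule normal_imp_subgroup)
  have single_at: "single a t \<in> K" if "a \<in> L" "t \<in> carrier B" for a t
    using conj_top_elem_single[of a t "\<one>\<^bsub>B\<^esub>"] that subgroup.mem_carrier[OF L]
      normal.inv_op_closed2[OF K _ single[OF that(1)], of "top_elem t"] by simp
  have base: "x \<in> K" if "x \<in> carrier (A \<wr> B)" "snd x = \<one>\<^bsub>B\<^esub>" "\<forall>s\<in>carrier B. \<Theta> x s \<in> L" for x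
    using that
  proof (induction "card {s \<in> carrier B. fst x s \<noteq> \<one>\<^bsub>A\<^esub>}" arbitrary: x rule: less_induct)
    case less
    note x = less.prems
    let ?S = "\<lambda>x. {s \<in> carrier B. fst x s \<noteq> \<one>\<^bsub>A\<^esub>}"
    have fin: "finite (?S x)" using fst_closed[OF x(1)] by (simp add: base_iff)
    \<comment> \<open>Multiplication by some \<open>g\<close> in \<open>K\<close> that creates no
      support point and clears one makes the support smaller; the induction hypothesis puts the
      product into \<open>K\<close>, and with it \<open>x\<close>.\<close>
    have step: "x \<in> K" if g: "g \<in> K" "snd g = \<one>\<^bsub>B\<^esub>" "\<forall>s\<in>carrier B. \<Theta> g s \<in> L"
      and s: "s \<in> ?S x" "\<And>u. u \<in> carrier B \<Longrightarrow> fst x u = \<one>\<^bsub>A\<^esub> \<Longrightarrow> fst (x \<otimes>\<^bsub>A \<wr> B\<^esub> g) u = \<one>\<^bsub>A\<^esub>"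
        "fst (x \<otimes>\<^bsub>A \<wr> B\<^esub> g) s = \<one>\<^bsub>A\<^esub>" for g s
    proof -
      have gc: "g \<in> carrier (A \<wr> B)" using subgroup.mem_carrier[OF Ks g(1)] .
      have "?S (x \<otimes>\<^bsub>A \<wr> B\<^esub> g) \<subset> ?S x" using s by blast
      then have "card (?S (x \<otimes>\<^bsub>A \<wr> B\<^esub> g)) < card (?S x)" by (rule psubset_card_mono[OF fin])
      moreover have "\<forall>s\<in>carrier B. \<Theta> (x \<otimes>\<^bsub>A \<wr> B\<^esub> g) s \<in> L"
        using x g gc L by (simp add: subgroup.m_closed)
      ultimately have "x \<otimes>\<^bsub>A \<wr> B\<^esub> g \<in> K" using less.hyps[of "x \<otimes>\<^bsub>A \<wr> B\<^esub> g"] x g gc by simp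
      then have "x \<otimes>\<^bsub>A \<wr> B\<^esub> g \<otimes>\<^bsub>A \<wr> B\<^esub> inv\<^bsub>A \<wr> B\<^esub> g \<in> K"
        using g(1) Ks by (simp add: subgroup.m_closed subgroup.m_inv_closed)
      then show ?thesis using x gc by (simp add: W.m_assoc)
    qed
    show ?case
    proof (cases "?S x = {}")
      case True
      then have "x = \<one>\<^bsub>A \<wr> B\<^esub>" using x by (intro wreath_eqI) auto
      then show ?thesis using Ks by (simp add: subgroup.one_closed)
    next
      case False
      then obtain s where s: "s \<in> carrier B" "fst x s \<noteq> \<one>\<^bsub>A\<^esub>" by blast
      show ?thesis
      proof (cases "\<exists>m\<in>M. m \<noteq> \<one>\<^bsub>B\<^esub> \<and> fst x (s \<otimes>\<^bsub>B\<^esub> m) \<noteq> \<one>\<^bsub>A\<^esub>")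
        case True
        then obtain m where m: "m \<in> M" "m \<noteq> \<one>\<^bsub>B\<^esub>" "fst x (s \<otimes>\<^bsub>B\<^esub> m) \<noteq> \<one>\<^bsub>A\<^esub>" by blast
        define t where "t = s \<otimes>\<^bsub>B\<^esub> m"
        define a where "a = fst x t"
        \<comment> \<open>Two support points share a coset. \<open>g\<close> carries the value at
          \<open>t\<close> over to \<open>s\<close>, which is in the support already, so the support
          loses \<open>t\<close> while \<open>\<Theta> x\<close> does not change.\<close>
        define g where "g = inv\<^bsub>A \<wr> B\<^esub> (single a t) \<otimes>\<^bsub>A \<wr> B\<^esub> single a s"
        have t: "t \<in> carrier B" "t \<noteq> s" using m s by (auto simp: t_def B.r_cancel_one)
        have a: "a \<in> carrier A" using x t by (simp add: a_def)
        have coset: "inv\<^bsub>B\<^esub> u \<otimes>\<^bsub>B\<^esub> t \<in> M \<longleftrightarrow> inv\<^bsub>B\<^esub> u \<otimes>\<^bsub>B\<^esub> s \<in> M" if u: "u \<in> carrier B" for u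
        proof
          assume "inv\<^bsub>B\<^esub> u \<otimes>\<^bsub>B\<^esub> t \<in> M"
          then have "inv\<^bsub>B\<^esub> u \<otimes>\<^bsub>B\<^esub> t \<otimes>\<^bsub>B\<^esub> inv\<^bsub>B\<^esub> m \<in> M"
            using m M_subgroup by (simp add: subgroup.m_closed subgroup.m_inv_closed)
          then show "inv\<^bsub>B\<^esub> u \<otimes>\<^bsub>B\<^esub> s \<in> M" using u s m by (simp add: t_def B.m_assoc)
        next
          assume "inv\<^bsub>B\<^esub> u \<otimes>\<^bsub>B\<^esub> s \<in> M"
          then have "inv\<^bsub>B\<^esub> u \<otimes>\<^bsub>B\<^esub> s \<otimes>\<^bsub>B\<^esub> m \<in> M"
            using m M_subgroup by (simp add: subgroup.m_closed)
          then show "inv\<^bsub>B\<^esub> u \<otimes>\<^bsub>B\<^esub> t \<in> M" using u s m by (simp add: t_def B.m_assoc)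
        qed
        show ?thesis
        proof (rule step)
          show "g \<in> K" unfolding g_def t_def
            using single_swap_in_normal[OF K top a s(1) m(1)] .
          show "snd g = \<one>\<^bsub>B\<^esub>" using a by (simp add: g_def)
          show "\<forall>u\<in>carrier B. \<Theta> g u \<in> L"
            using a s t coset L by (simp add: g_def \<Theta>_single subgroup.one_closed)
          show "t \<in> ?S x" using m t by (simp add: t_def)
          show "fst (x \<otimes>\<^bsub>A \<wr> B\<^esub> g) u = \<one>\<^bsub>A\<^esub>" if "u \<in> carrier B" "fst x u = \<one>\<^bsub>A\<^esub>" for u
            using that a s x(2) m by (auto simp: g_def t_def)
          show "fst (x \<otimes>\<^bsub>A \<wr> B\<^esub> g) t = \<one>\<^bsub>A\<^esub>"
            using t a x(2) by (simp add: g_def flip: a_def)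
        qed
      next
        case False
        define a where "a = fst x s"
        \<comment> \<open>Here \<open>s\<close> is alone in its coset, so the value there is a value
          of \<open>\<Theta> x\<close>, lies in \<open>L\<close> and can be removed
          outright.\<close>
        have "\<Theta> x s = a"
          unfolding \<Theta>_def a_def using x s False by (intro \<theta>_isolated) auto
        then have a: "a \<in> L" "a \<in> carrier A" using x s L subgroup.mem_carrier by fastforce+
        show ?thesis
        proof (rule step)
          show "inv\<^bsub>A \<wr> B\<^esub> (single a s) \<in> K"
            using single_at[OF a(1) s(1)] Ks by (simp add: subgroup.m_inv_closed)
          show "\<forall>u\<in>carrier B. \<Theta> (inv\<^bsub>A \<wr> B\<^esub> (single a s)) u \<in> L"
            using a s L by (simp add: \<Theta>_single subgroup.m_inv_closed subgroup.one_closed)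
          show "s \<in> ?S x" using s by simp
          show "fst (x \<otimes>\<^bsub>A \<wr> B\<^esub> inv\<^bsub>A \<wr> B\<^esub> (single a s)) u = \<one>\<^bsub>A\<^esub>"
            if "u \<in> carrier B" "fst x u = \<one>\<^bsub>A\<^esub>" for u
            using that a s x(2) by auto
          show "fst (x \<otimes>\<^bsub>A \<wr> B\<^esub> inv\<^bsub>A \<wr> B\<^esub> (single a s)) s = \<one>\<^bsub>A\<^esub>"
            using s a x(2) by (simp flip: a_def)
        qed (use a in simp)
      qed
    qed
  qed
  fix x assume x: "x \<in> coset_subgroup L"
  then have xc: "x \<in> carrier (A \<wr> B)" "snd x \<in> M" "\<forall>s\<in>carrier B. \<Theta> x s \<in> L"
    by (auto simp: coset_subgroup_def)
  let ?t = "top_elem (snd x)"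
  have t: "?t \<in> coset_subgroup L" using top_elem_in_coset_subgroup[OF L xc(2)] .
  have "x \<otimes>\<^bsub>A \<wr> B\<^esub> inv\<^bsub>A \<wr> B\<^esub> ?t \<in> K"
  proof (rule base)
    show "\<forall>s\<in>carrier B. \<Theta> (x \<otimes>\<^bsub>A \<wr> B\<^esub> inv\<^bsub>A \<wr> B\<^esub> ?t) s \<in> L"
      using xc t L by (simp add: coset_subgroup_def subgroup.m_closed subgroup.m_inv_closed)
  qed (use xc in auto)
  then have "x \<otimes>\<^bsub>A \<wr> B\<^esub> inv\<^bsub>A \<wr> B\<^esub> ?t \<otimes>\<^bsub>A \<wr> B\<^esub> ?t \<in> K"
    using top[OF xc(2)] by (rule subgroup.m_closed[OF Ks])
  then show "x \<in> K" using xc by (simp add: W.m_assoc)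
qed

text \<open>With \<open>b = snd x\<close>, the equation \<open>g h = h x\<close> for a base element
  \<open>h\<close> determines the value of \<open>h\<close> at \<open>b s\<close> from that at
  \<open>s\<close>. Started with \<open>k\<close> where the index \<open>\<iota>\<close> is 0, the
  recursion gives \<open>g^i k x^-i\<close> after \<open>i\<close> steps, and \<open>pow\<close>
  says that it closes up after \<open>n\<close> steps. Since \<open>\<iota>\<close> is constant on
  cosets of \<open>M\<close>, the pieces can be assembled without leaving the coset
  subgroup.\<close>

lemma conjugate_by_coset_subgroup:
  fixes \<iota> :: "'b \<Rightarrow> nat"
  assumes L: "L \<lhd> A" and x: "x \<in> carrier (A \<wr> B)" and g: "g \<in> carrier (A \<wr> B)"
    and snd: "snd g = snd x"
    and \<iota>: "\<And>s. s \<in> carrier B \<Longrightarrow> \<iota> s < n"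
      "\<And>s. s \<in> carrier B \<Longrightarrow> \<iota> (snd x \<otimes>\<^bsub>B\<^esub> s) = Suc (\<iota> s) mod n"
      "\<And>s m. s \<in> carrier B \<Longrightarrow> m \<in> M \<Longrightarrow> \<iota> (s \<otimes>\<^bsub>B\<^esub> m) = \<iota> s"
    and gx: "g \<otimes>\<^bsub>A \<wr> B\<^esub> inv\<^bsub>A \<wr> B\<^esub> x \<in> coset_subgroup L"
    and k: "k \<in> coset_subgroup L" "snd k = \<one>\<^bsub>B\<^esub>"
    and pow: "\<And>s. s \<in> carrier B \<Longrightarrow> \<iota> s = 0 \<Longrightarrow>
      fst (g [^]\<^bsub>A \<wr> B\<^esub> n \<otimes>\<^bsub>A \<wr> B\<^esub> k \<otimes>\<^bsub>A \<wr> B\<^esub> inv\<^bsub>A \<wr> B\<^esub> (x [^]\<^bsub>A \<wr> B\<^esub> n)) s = fst k s"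
  shows "\<exists>h\<in>coset_subgroup L. g = h \<otimes>\<^bsub>A \<wr> B\<^esub> x \<otimes>\<^bsub>A \<wr> B\<^esub> inv\<^bsub>A \<wr> B\<^esub> h"
proof -
  let ?K = "coset_subgroup L"
  have K: "?K \<lhd> A \<wr> B" using L by (rule coset_subgroup_normal)
  then have Ks: "subgroup ?K (A \<wr> B)" by (rule normal_imp_subgroup)
  have kc: "k \<in> carrier (A \<wr> B)" using subgroup.mem_carrier[OF Ks k(1)] .
  define y where "y i = g [^]\<^bsub>A \<wr> B\<^esub> i \<otimes>\<^bsub>A \<wr> B\<^esub> k \<otimes>\<^bsub>A \<wr> B\<^esub> inv\<^bsub>A \<wr> B\<^esub> (x [^]\<^bsub>A \<wr> B\<^esub> i)" for i :: nat
  have yc: "y i \<in> carrier (A \<wr> B)" for i using x g kc by (simp add: y_def)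
  have snd_y: "snd (y i) = \<one>\<^bsub>B\<^esub>" for i using x g kc k(2) by (simp add: y_def snd)
  have y0: "y 0 = k" using kc by (simp add: y_def)
  \<comment> \<open>Modulo the coset subgroup \<open>g\<close> equals \<open>x\<close>, so
    \<open>y i\<close> is congruent to a conjugate of \<open>k\<close>.\<close>
  have yK: "y i \<in> ?K" for i
  proof -
    have "?K #>\<^bsub>A \<wr> B\<^esub> g = ?K #>\<^bsub>A \<wr> B\<^esub> x" using gx W.r_coset_eq_iff[OF Ks g x] by simp
    then have "?K #>\<^bsub>A \<wr> B\<^esub> (g [^]\<^bsub>A \<wr> B\<^esub> i) = ?K #>\<^bsub>A \<wr> B\<^esub> (x [^]\<^bsub>A \<wr> B\<^esub> i)"
      using W.r_coset_cong_pow[OF K _ g x] by simp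
    then have "?K #>\<^bsub>A \<wr> B\<^esub> y i =
        ?K #>\<^bsub>A \<wr> B\<^esub> (x [^]\<^bsub>A \<wr> B\<^esub> i \<otimes>\<^bsub>A \<wr> B\<^esub> k \<otimes>\<^bsub>A \<wr> B\<^esub> inv\<^bsub>A \<wr> B\<^esub> (x [^]\<^bsub>A \<wr> B\<^esub> i))"
      unfolding y_def using x g kc by (intro W.r_coset_cong_mult[OF K]) auto
    also have "\<dots> = ?K"
      using normal.inv_op_closed2[OF K _ k(1), of "x [^]\<^bsub>A \<wr> B\<^esub> i"] x kc
        W.r_coset_eq_self_iff[OF Ks] by simp
    finally show ?thesis using W.r_coset_eq_self_iff[OF Ks yc] by simp
  qed
  have y_Suc: "g \<otimes>\<^bsub>A \<wr> B\<^esub> y i = y (Suc i) \<otimes>\<^bsub>A \<wr> B\<^esub> x" for i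
    using x g kc by (simp add: y_def W.nat_pow_Suc2 W.inv_mult_group W.m_assoc del: W.nat_pow_Suc nat_pow_Suc)
  \<comment> \<open>The value at \<open>s\<close> comes from the piece numbered by the position of
    \<open>s\<close> on its orbit; only \<open>n\<close> pieces occur, whence the finite
    support.\<close>
  define h where "h = (\<lambda>s\<in>carrier B. fst (y (\<iota> s)) s, \<one>\<^bsub>B\<^esub>)"
  have fst_h: "fst h s = fst (y (\<iota> s)) s" if "s \<in> carrier B" for s using that by (simp add: h_def)
  have "{s \<in> carrier B. fst (y (\<iota> s)) s \<noteq> \<one>\<^bsub>A\<^esub>} \<subseteq> (\<Union>i<n. {s \<in> carrier B. fst (y i) s \<noteq> \<one>\<^bsub>A\<^esub>})"
    using \<iota>(1) by auto
  moreover have "finite (\<Union>i<n. {s \<in> carrier B. fst (y i) s \<noteq> \<one>\<^bsub>A\<^esub>})"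
    using fst_closed[OF yc] by (auto simp: base_iff)
  ultimately have "finite {s \<in> carrier B. fst (y (\<iota> s)) s \<noteq> \<one>\<^bsub>A\<^esub>}" by (rule finite_subset)
  then have hc: "h \<in> carrier (A \<wr> B)"
    using yc by (auto simp: wreath_carrier_iff base_iff h_def cong: conj_cong)
  have "\<Theta> h s = \<Theta> (y (\<iota> s)) s" if "s \<in> carrier B" for s
    using that by (intro \<Theta>_local hc yc) (auto simp: fst_h \<iota>(3) snd_y h_def)
  then have hK: "h \<in> ?K"
    using yK hc M_subgroup by (auto simp: coset_subgroup_def h_def subgroup.one_closed)
  have "g \<otimes>\<^bsub>A \<wr> B\<^esub> h = h \<otimes>\<^bsub>A \<wr> B\<^esub> x"
  proof (rule wreath_eqI)
    fix s assume s: "s \<in> carrier B"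
    define u where "u = inv\<^bsub>B\<^esub> (snd x) \<otimes>\<^bsub>B\<^esub> s"
    have u: "u \<in> carrier B" using x s by (simp add: u_def)
    have "\<iota> s = Suc (\<iota> u) mod n" using \<iota>(2)[OF u] x s by (simp add: u_def)
    then have "fst (y (\<iota> s)) s = fst (y (Suc (\<iota> u))) s"
    proof (cases "Suc (\<iota> u) < n")
      \<comment> \<open>The wrap-around: the step from index \<open>n - 1\<close> leads back to
        index 0, where \<open>y n\<close> has to agree with \<open>y 0 = k\<close>.\<close>
      case False
      then have "Suc (\<iota> u) = n" using \<iota>(1)[OF u] by simp
      moreover have "\<iota> s = 0" using calculation \<open>\<iota> s = Suc (\<iota> u) mod n\<close> by simp
      ultimately show ?thesis using pow[OF s] y0 by (simp add: y_def)
    qed simp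
    moreover have "fst (g \<otimes>\<^bsub>A \<wr> B\<^esub> y (\<iota> u)) s = fst (y (Suc (\<iota> u)) \<otimes>\<^bsub>A \<wr> B\<^esub> x) s"
      by (simp only: y_Suc)
    ultimately show "fst (g \<otimes>\<^bsub>A \<wr> B\<^esub> h) s = fst (h \<otimes>\<^bsub>A \<wr> B\<^esub> x) s"
      using s u x g by (simp add: snd fst_h snd_y h_def flip: u_def)
  qed (use hc g x snd in \<open>auto simp: h_def\<close>)
  then have "g = h \<otimes>\<^bsub>A \<wr> B\<^esub> x \<otimes>\<^bsub>A \<wr> B\<^esub> inv\<^bsub>A \<wr> B\<^esub> h"
    using g hc x by (metis W.inv_solve_right W.m_closed)
  then show ?thesis using hK by blast
qed

text \<open>Everything but the case in \<open>sep\<close> is easy. If the top parts are not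
  conjugate under \<open>M\<close>, closedness in \<open>B\<close> is pulled back along
  \<open>snd\<close>. If they are, conjugation by a top element of the coset subgroup makes them
  equal. If \<open>g\<close> then differs from \<open>x\<close> modulo the coset subgroup, that
  subgroup separates, because conjugation by its own elements keeps \<open>x\<close> in its
  coset.\<close>

lemma conj_closed_coset_subgroup:
  assumes M_open: "p_open p B M" and L: "p_open p A L" and x: "x \<in> carrier (A \<wr> B)"
    and closed: "conj_closed p B M (snd x)"
    and sep: "\<And>g. g \<in> carrier (A \<wr> B) \<Longrightarrow> snd g = snd x \<Longrightarrow>
      g \<otimes>\<^bsub>A \<wr> B\<^esub> inv\<^bsub>A \<wr> B\<^esub> x \<in> coset_subgroup L \<Longrightarrow>
      \<forall>k\<in>coset_subgroup L. g \<noteq> k \<otimes>\<^bsub>A \<wr> B\<^esub> x \<otimes>\<^bsub>A \<wr> B\<^esub> inv\<^bsub>A \<wr> B\<^esub> k \<Longrightarrow>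
      \<exists>N. p_open p (A \<wr> B) N \<and> (\<forall>k\<in>coset_subgroup L.
        N #>\<^bsub>A \<wr> B\<^esub> g \<noteq> N #>\<^bsub>A \<wr> B\<^esub> (k \<otimes>\<^bsub>A \<wr> B\<^esub> x \<otimes>\<^bsub>A \<wr> B\<^esub> inv\<^bsub>A \<wr> B\<^esub> k))"
  shows "conj_closed p (A \<wr> B) (coset_subgroup L) x"
  unfolding conj_closed_def
proof (intro ballI impI)
  let ?K = "coset_subgroup L"
  have K: "p_open p (A \<wr> B) ?K" using M_open L by (rule coset_subgroup_p_open)
  have Kn: "?K \<lhd> A \<wr> B" using K by (rule W.p_open_normal)
  have Ks: "subgroup ?K (A \<wr> B)" using K by (rule W.p_open_subgroup)
  have Kc: "k \<in> carrier (A \<wr> B)" "snd k \<in> M" if "k \<in> ?K" for k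
    using that by (auto simp: coset_subgroup_def)
  fix g assume g: "g \<in> carrier (A \<wr> B)"
    and ng: "\<forall>k\<in>?K. g \<noteq> k \<otimes>\<^bsub>A \<wr> B\<^esub> x \<otimes>\<^bsub>A \<wr> B\<^esub> inv\<^bsub>A \<wr> B\<^esub> k"
  show "\<exists>N. p_open p (A \<wr> B) N \<and> (\<forall>k\<in>?K.
      N #>\<^bsub>A \<wr> B\<^esub> g \<noteq> N #>\<^bsub>A \<wr> B\<^esub> (k \<otimes>\<^bsub>A \<wr> B\<^esub> x \<otimes>\<^bsub>A \<wr> B\<^esub> inv\<^bsub>A \<wr> B\<^esub> k))"
  proof (cases "\<exists>m\<in>M. snd g = m \<otimes>\<^bsub>B\<^esub> snd x \<otimes>\<^bsub>B\<^esub> inv\<^bsub>B\<^esub> m")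
    case False
    then obtain N where N: "p_open p B N"
      "\<forall>m\<in>M. N #>\<^bsub>B\<^esub> snd g \<noteq> N #>\<^bsub>B\<^esub> (m \<otimes>\<^bsub>B\<^esub> snd x \<otimes>\<^bsub>B\<^esub> inv\<^bsub>B\<^esub> m)"
      using closed g unfolding conj_closed_def by (meson snd_closed)
    let ?N = "{x \<in> carrier (A \<wr> B). snd x \<in> N}"
    have N': "p_open p (A \<wr> B) ?N"
      using group_hom.p_open_vimage[OF snd_group_hom N(1)] .
    have "?N #>\<^bsub>A \<wr> B\<^esub> g \<noteq> ?N #>\<^bsub>A \<wr> B\<^esub> (k \<otimes>\<^bsub>A \<wr> B\<^esub> x \<otimes>\<^bsub>A \<wr> B\<^esub> inv\<^bsub>A \<wr> B\<^esub> k)" if k: "k \<in> ?K" for k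
    proof
      assume "?N #>\<^bsub>A \<wr> B\<^esub> g = ?N #>\<^bsub>A \<wr> B\<^esub> (k \<otimes>\<^bsub>A \<wr> B\<^esub> x \<otimes>\<^bsub>A \<wr> B\<^esub> inv\<^bsub>A \<wr> B\<^esub> k)"
      then have "snd g \<otimes>\<^bsub>B\<^esub> inv\<^bsub>B\<^esub> (snd k \<otimes>\<^bsub>B\<^esub> snd x \<otimes>\<^bsub>B\<^esub> inv\<^bsub>B\<^esub> (snd k)) \<in> N"
        using W.r_coset_eq_iff[OF W.p_open_subgroup[OF N']] g x Kc[OF k] by simp
      then show False
        using N(2) Kc[OF k] B.r_coset_eq_iff[OF B.p_open_subgroup[OF N(1)]] g x by simp
    qed
    then show ?thesis using N' by blast
  next
    case True
    then obtain m where m: "m \<in> M" "snd g = m \<otimes>\<^bsub>B\<^esub> snd x \<otimes>\<^bsub>B\<^esub> inv\<^bsub>B\<^esub> m" by blast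
    let ?t = "top_elem m"
    have t: "?t \<in> ?K" "?t \<in> carrier (A \<wr> B)"
      using top_elem_in_coset_subgroup[OF A.p_open_subgroup[OF L] m(1)] m(1) by auto
    define g' where "g' = inv\<^bsub>A \<wr> B\<^esub> ?t \<otimes>\<^bsub>A \<wr> B\<^esub> g \<otimes>\<^bsub>A \<wr> B\<^esub> ?t"
    have g'c: "g' \<in> carrier (A \<wr> B)" using g t by (simp add: g'_def)
    have g_g': "g = ?t \<otimes>\<^bsub>A \<wr> B\<^esub> g' \<otimes>\<^bsub>A \<wr> B\<^esub> inv\<^bsub>A \<wr> B\<^esub> ?t"
      using g t by (simp add: g'_def W.m_assoc)
    have snd_g': "snd g' = snd x" using m x g t by (simp add: g'_def B.m_assoc)
    have conj: "inv\<^bsub>A \<wr> B\<^esub> ?t \<otimes>\<^bsub>A \<wr> B\<^esub> (k \<otimes>\<^bsub>A \<wr> B\<^esub> x \<otimes>\<^bsub>A \<wr> B\<^esub> inv\<^bsub>A \<wr> B\<^esub> k) \<otimes>\<^bsub>A \<wr> B\<^esub> ?t =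
      (inv\<^bsub>A \<wr> B\<^esub> ?t \<otimes>\<^bsub>A \<wr> B\<^esub> k) \<otimes>\<^bsub>A \<wr> B\<^esub> x \<otimes>\<^bsub>A \<wr> B\<^esub> inv\<^bsub>A \<wr> B\<^esub> (inv\<^bsub>A \<wr> B\<^esub> ?t \<otimes>\<^bsub>A \<wr> B\<^esub> k)"
      if "k \<in> ?K" for k
      using Kc[OF that] t x by (simp add: W.m_assoc W.inv_mult_group)
    have tk: "?t \<otimes>\<^bsub>A \<wr> B\<^esub> k \<in> ?K" "inv\<^bsub>A \<wr> B\<^esub> ?t \<otimes>\<^bsub>A \<wr> B\<^esub> k \<in> ?K" if "k \<in> ?K" for k
      using that t Ks by (simp_all add: subgroup.m_closed subgroup.m_inv_closed)
    have ng': "g' \<noteq> k \<otimes>\<^bsub>A \<wr> B\<^esub> x \<otimes>\<^bsub>A \<wr> B\<^esub> inv\<^bsub>A \<wr> B\<^esub> k" if k: "k \<in> ?K" for k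
    proof
      assume "g' = k \<otimes>\<^bsub>A \<wr> B\<^esub> x \<otimes>\<^bsub>A \<wr> B\<^esub> inv\<^bsub>A \<wr> B\<^esub> k"
      then have "g = (?t \<otimes>\<^bsub>A \<wr> B\<^esub> k) \<otimes>\<^bsub>A \<wr> B\<^esub> x \<otimes>\<^bsub>A \<wr> B\<^esub> inv\<^bsub>A \<wr> B\<^esub> (?t \<otimes>\<^bsub>A \<wr> B\<^esub> k)"
        unfolding g_g' using t x Kc[OF k] by (simp add: W.m_assoc W.inv_mult_group)
      then show False using ng tk(1)[OF k] by blast
    qed
    have "\<exists>N. p_open p (A \<wr> B) N \<and> (\<forall>k\<in>?K.
        N #>\<^bsub>A \<wr> B\<^esub> g' \<noteq> N #>\<^bsub>A \<wr> B\<^esub> (k \<otimes>\<^bsub>A \<wr> B\<^esub> x \<otimes>\<^bsub>A \<wr> B\<^esub> inv\<^bsub>A \<wr> B\<^esub> k))"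
    proof (cases "g' \<otimes>\<^bsub>A \<wr> B\<^esub> inv\<^bsub>A \<wr> B\<^esub> x \<in> ?K")
      case True
      then show ?thesis using sep[OF g'c snd_g'] ng' by blast
    next
      case False
      have "?K #>\<^bsub>A \<wr> B\<^esub> g' \<noteq> ?K #>\<^bsub>A \<wr> B\<^esub> (k \<otimes>\<^bsub>A \<wr> B\<^esub> x \<otimes>\<^bsub>A \<wr> B\<^esub> inv\<^bsub>A \<wr> B\<^esub> k)" if k: "k \<in> ?K" for k
      proof
        assume eq: "?K #>\<^bsub>A \<wr> B\<^esub> g' = ?K #>\<^bsub>A \<wr> B\<^esub> (k \<otimes>\<^bsub>A \<wr> B\<^esub> x \<otimes>\<^bsub>A \<wr> B\<^esub> inv\<^bsub>A \<wr> B\<^esub> k)"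
        have "k \<otimes>\<^bsub>A \<wr> B\<^esub> x \<otimes>\<^bsub>A \<wr> B\<^esub> inv\<^bsub>A \<wr> B\<^esub> k \<otimes>\<^bsub>A \<wr> B\<^esub> inv\<^bsub>A \<wr> B\<^esub> x =
            k \<otimes>\<^bsub>A \<wr> B\<^esub> (x \<otimes>\<^bsub>A \<wr> B\<^esub> inv\<^bsub>A \<wr> B\<^esub> k \<otimes>\<^bsub>A \<wr> B\<^esub> inv\<^bsub>A \<wr> B\<^esub> x)"
          using Kc[OF k] x by (simp add: W.m_assoc)
        also have "\<dots> \<in> ?K"
          using normal.inv_op_closed2[OF Kn x subgroup.m_inv_closed[OF Ks k]] subgroup.m_closed[OF Ks k]
          by simp
        finally have "?K #>\<^bsub>A \<wr> B\<^esub> (k \<otimes>\<^bsub>A \<wr> B\<^esub> x \<otimes>\<^bsub>A \<wr> B\<^esub> inv\<^bsub>A \<wr> B\<^esub> k) = ?K #>\<^bsub>A \<wr> B\<^esub> x"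
          using W.r_coset_eq_iff[OF Ks] Kc[OF k] x by simp
        then show False using eq False W.r_coset_eq_iff[OF Ks g'c x] by simp
      qed
      then show ?thesis using K by blast
    qed
    then obtain N where N: "p_open p (A \<wr> B) N" "\<forall>k\<in>?K.
        N #>\<^bsub>A \<wr> B\<^esub> g' \<noteq> N #>\<^bsub>A \<wr> B\<^esub> (k \<otimes>\<^bsub>A \<wr> B\<^esub> x \<otimes>\<^bsub>A \<wr> B\<^esub> inv\<^bsub>A \<wr> B\<^esub> k)" by blast
    have "N #>\<^bsub>A \<wr> B\<^esub> g \<noteq> N #>\<^bsub>A \<wr> B\<^esub> (k \<otimes>\<^bsub>A \<wr> B\<^esub> x \<otimes>\<^bsub>A \<wr> B\<^esub> inv\<^bsub>A \<wr> B\<^esub> k)" if k: "k \<in> ?K" for k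
    proof
      assume "N #>\<^bsub>A \<wr> B\<^esub> g = N #>\<^bsub>A \<wr> B\<^esub> (k \<otimes>\<^bsub>A \<wr> B\<^esub> x \<otimes>\<^bsub>A \<wr> B\<^esub> inv\<^bsub>A \<wr> B\<^esub> k)"
      then have "N #>\<^bsub>A \<wr> B\<^esub> g' = N #>\<^bsub>A \<wr> B\<^esub>
          (inv\<^bsub>A \<wr> B\<^esub> ?t \<otimes>\<^bsub>A \<wr> B\<^esub> (k \<otimes>\<^bsub>A \<wr> B\<^esub> x \<otimes>\<^bsub>A \<wr> B\<^esub> inv\<^bsub>A \<wr> B\<^esub> k) \<otimes>\<^bsub>A \<wr> B\<^esub> ?t)"
        unfolding g'_def using W.p_open_normal[OF N(1)] g x Kc[OF k] t
        by (intro W.r_coset_cong_mult) auto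
      then show False using N(2) tk(2)[OF k] conj[OF k] by simp
    qed
    then show ?thesis using N(1) by blast
  qed
qed

end

section \<open>The two positive cases\<close>

text \<open>The powers of \<open>b\<close> act freely on the cosets of \<open>M\<close>, up to the
  period \<open>n\<close>: \<open>b^i r m = r m'\<close> would put \<open>b^i\<close> into the
  normal subgroup \<open>M\<close>. Every double coset \<open><b> s M\<close> is thus a cycle of
  \<open>n\<close> cosets of \<open>M\<close>, and \<open>\<iota>\<close> is the position on it,
  counted from a chosen representative.\<close>

lemma (in group) cyclic_coset_index:
  fixes n :: nat
  assumes b: "b \<in> carrier G" "b [^] n = \<one>" "0 < n" and M: "M \<lhd> G"
    and disj: "\<And>i. 0 < i \<Longrightarrow> i < n \<Longrightarrow> b [^] i \<notin> M"
  shows "\<exists>\<iota>. (\<forall>s\<in>carrier G. \<iota> s < n \<and> \<iota> (b \<otimes> s) = Suc (\<iota> s) mod n \<and> (\<forall>m\<in>M. \<iota> (s \<otimes> m) = \<iota> s))"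
proof -
  have Ms: "subgroup M G" using M by (rule normal_imp_subgroup)
  have Mc: "m \<in> carrier G" if "m \<in> M" for m using subgroup.mem_carrier[OF Ms that] .
  have pow_mod: "b [^] i = b [^] (i mod n)" for i
  proof -
    have "b [^] (n * (i div n)) = \<one>" using b by (simp flip: nat_pow_pow)
    then have "b [^] (i mod n) = b [^] (n * (i div n)) \<otimes> b [^] (i mod n)" using b by simp
    also have "\<dots> = b [^] i" using b by (simp add: nat_pow_mult)
    finally show ?thesis by simp
  qed
  have le: "i = j" if "i \<le> j" "j < n" "r \<in> carrier G" "m \<in> M" "m' \<in> M"
    "b [^] i \<otimes> r \<otimes> m = b [^] j \<otimes> r \<otimes> m'" for i j r m m'
  proof (rule ccontr)
    assume "i \<noteq> j"
    have "b [^] j = b [^] i \<otimes> b [^] (j - i)" using that b by (simp add: nat_pow_mult)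
    then have "b [^] i \<otimes> (r \<otimes> m) = b [^] i \<otimes> (b [^] (j - i) \<otimes> r \<otimes> m')"
      using that b Mc by (simp add: m_assoc)
    then have "r \<otimes> m = b [^] (j - i) \<otimes> r \<otimes> m'" using that b Mc by simp
    then have "r \<otimes> m \<otimes> inv m' \<otimes> inv r = b [^] (j - i) \<otimes> r \<otimes> m' \<otimes> inv m' \<otimes> inv r" by simp
    also have "\<dots> = b [^] (j - i)" using that b Mc by (simp add: m_assoc)
    finally have "b [^] (j - i) = r \<otimes> (m \<otimes> inv m') \<otimes> inv r" using that Mc by (simp add: m_assoc)
    then have "b [^] (j - i) \<in> M"
      using normal.inv_op_closed2[OF M] that Ms by (simp add: subgroup.m_closed subgroup.m_inv_closed)
    then show False using disj[of "j - i"] \<open>i \<noteq> j\<close> that by simp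
  qed
  have uniq: "i = j" if "i < n" "j < n" "r \<in> carrier G" "m \<in> M" "m' \<in> M"
    "b [^] i \<otimes> r \<otimes> m = b [^] j \<otimes> r \<otimes> m'" for i j r m m'
    using le[of i j r m m'] le[of j i r m' m] that by (metis nat_le_linear)
  define orb where "orb s = {b [^] i \<otimes> s \<otimes> m | i m. i < n \<and> m \<in> M}" for s
  have orbI: "b [^] i \<otimes> s \<otimes> m \<in> orb s" if "m \<in> M" for i :: nat and s m
    unfolding orb_def using that b(3) pow_mod[of i] by (auto intro!: exI[of _ "i mod n"])
  have orb_trans: "orb t \<subseteq> orb s" if t: "t \<in> orb s" and s: "s \<in> carrier G" for s t
  proof
    fix u assume "u \<in> orb t"
    then obtain i :: nat and m' where "m' \<in> M" "u = b [^] i \<otimes> t \<otimes> m'" by (auto simp: orb_def)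
    moreover obtain j :: nat and m where "m \<in> M" "t = b [^] j \<otimes> s \<otimes> m" using t by (auto simp: orb_def)
    ultimately have *: "m \<in> M" "m' \<in> M" "u = b [^] i \<otimes> (b [^] j \<otimes> s \<otimes> m) \<otimes> m'" by simp_all
    then have "u = b [^] (i + j) \<otimes> s \<otimes> (m \<otimes> m')"
      using s b Mc by (simp add: m_assoc flip: nat_pow_mult)
    then show "u \<in> orb s" using orbI * Ms by (simp add: subgroup.m_closed)
  qed
  have orb_sym: "s \<in> orb t" if t: "t \<in> orb s" and s: "s \<in> carrier G" for s t
  proof -
    obtain i m where *: "i < n" "m \<in> M" "t = b [^] i \<otimes> s \<otimes> m" using t by (auto simp: orb_def)
    have "b [^] (n - i) \<otimes> t \<otimes> inv m = (b [^] (n - i) \<otimes> b [^] i) \<otimes> s"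
      using * s b Mc by (simp add: m_assoc)
    also have "\<dots> = s" using * s b by (simp add: nat_pow_mult)
    finally show ?thesis using orbI[of "inv m" "n - i" t] * Ms by (simp add: subgroup.m_inv_closed)
  qed
  have orb_c: "orb s \<subseteq> carrier G" if "s \<in> carrier G" for s using that b Mc by (auto simp: orb_def)
  have orb_eq: "orb t = orb s" if "t \<in> orb s" "s \<in> carrier G" for s t
    using orb_trans orb_sym orb_c that by blast
  \<comment> \<open>\<open>r\<close> depends on the set \<open>orb s\<close> only, so all points of
    one double coset are measured from the same representative.\<close>
  define r where "r s = (SOME t. t \<in> orb s)" for s
  have r_in: "r s \<in> orb s" if "s \<in> carrier G" for s
    unfolding r_def
    by (rule someI[of "\<lambda>t. t \<in> orb s", OF orbI[OF subgroup.one_closed[OF Ms], of 0]])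
  have r_eq: "r t = r s" if "t \<in> orb s" "s \<in> carrier G" for s t
    using orb_eq[OF that] by (simp add: r_def)
  have r_c: "r s \<in> carrier G" if "s \<in> carrier G" for s using r_in[OF that] orb_c[OF that] by blast
  define \<iota> where "\<iota> s = (SOME i. i < n \<and> (\<exists>m\<in>M. s = b [^] i \<otimes> r s \<otimes> m))" for s
  have \<iota>: "\<iota> s < n \<and> (\<exists>m\<in>M. s = b [^] \<iota> s \<otimes> r s \<otimes> m)" if s: "s \<in> carrier G" for s
    unfolding \<iota>_def
    by (rule someI_ex) (use orb_sym[OF r_in[OF s] s] in \<open>auto simp: orb_def\<close>)
  have \<iota>_unique: "\<iota> s = i mod n" if s: "s \<in> carrier G" and m: "m \<in> M" and eq: "s = b [^] i \<otimes> r s \<otimes> m" for s i m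
  proof -
    obtain m' where m': "m' \<in> M" "s = b [^] \<iota> s \<otimes> r s \<otimes> m'" using \<iota>[OF s] by blast
    have "b [^] \<iota> s \<otimes> r s \<otimes> m' = b [^] (i mod n) \<otimes> r s \<otimes> m"
      using m'(2) eq pow_mod[of i] by simp
    then show ?thesis using uniq[OF _ _ r_c[OF s] m'(1) m] \<iota>[OF s] b(3) by simp
  qed
  have "\<iota> (b \<otimes> s) = Suc (\<iota> s) mod n \<and> (\<forall>m\<in>M. \<iota> (s \<otimes> m) = \<iota> s)" if s: "s \<in> carrier G" for s
  proof (intro conjI ballI)
    obtain m' where m': "m' \<in> M" "s = b [^] \<iota> s \<otimes> r s \<otimes> m'" using \<iota>[OF s] by blast
    have "b \<otimes> s \<in> orb s" using orbI[OF subgroup.one_closed[OF Ms], of 1 s] s b by simp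
    then have r: "r (b \<otimes> s) = r s" using r_eq s by blast
    show "\<iota> (b \<otimes> s) = Suc (\<iota> s) mod n"
    proof (rule \<iota>_unique)
      have "b \<otimes> s = b \<otimes> (b [^] \<iota> s \<otimes> r s \<otimes> m')" using m'(2) by simp
      also have "\<dots> = b \<otimes> b [^] \<iota> s \<otimes> r s \<otimes> m'"
        using b Mc[OF m'(1)] r_c[OF s] by (simp add: m_assoc)
      also have "b \<otimes> b [^] \<iota> s = b [^] Suc (\<iota> s)" using nat_pow_Suc2[OF b(1)] by simp
      finally show "b \<otimes> s = b [^] Suc (\<iota> s) \<otimes> r (b \<otimes> s) \<otimes> m'" using r by simp
    qed (use b s m' in auto)
    fix m assume m: "m \<in> M"
    have "s \<otimes> m \<in> orb s" using orbI[OF m, of 0 s] s by simp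
    then have r: "r (s \<otimes> m) = r s" using r_eq s by blast
    have "\<iota> (s \<otimes> m) = \<iota> s mod n"
    proof (rule \<iota>_unique)
      have "s \<otimes> m = b [^] \<iota> s \<otimes> r s \<otimes> m' \<otimes> m" using m'(2) by simp
      then show "s \<otimes> m = b [^] \<iota> s \<otimes> r (s \<otimes> m) \<otimes> (m' \<otimes> m)"
        using r b Mc[OF m] Mc[OF m'(1)] r_c[OF s] by (simp add: m_assoc)
    qed (use m m' s Mc Ms in \<open>auto simp: subgroup.m_closed\<close>)
    then show "\<iota> (s \<otimes> m) = \<iota> s" using \<iota>[OF s] by simp
  qed
  then show ?thesis using \<iota> by blast
qed

text \<open>The support over the image is the image of the support, so both sides fall into the same
  branch of \<open>gfinprod\<close>, and the finite case applies to the supports. The sets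
  themselves may be infinite cosets.\<close>

lemma (in comm_monoid) gfinprod_reindex:
  assumes "inj_on h S" "f \<in> h ` S \<rightarrow> carrier G"
  shows "gfinprod G f (h ` S) = gfinprod G (\<lambda>x. f (h x)) S"
proof -
  have "{x \<in> h ` S. f x \<noteq> \<one>} = h ` {x \<in> S. f (h x) \<noteq> \<one>}" by auto
  moreover have "inj_on h {x \<in> S. f (h x) \<noteq> \<one>}" using assms(1) by (rule inj_on_subset) auto
  ultimately show ?thesis
    using assms(2) by (auto simp: gfinprod_def finite_image_iff Pi_iff intro!: finprod_reindex)
qed

section \<open>The two coset maps, and the case of a finite top group\<close>

context wreath
begin

lemma wreath_coset_map_trivial: "wreath_coset_map A B {\<one>\<^bsub>B\<^esub>} (\<lambda>f. f)"
  by (intro wreath_coset_map.intro wreath_axioms wreath_coset_map_axioms.intro)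
    (auto simp: left_translate_def B.one_is_normal)

definition coset_prod :: "'b set \<Rightarrow> ('b \<Rightarrow> 'a) \<Rightarrow> 'b \<Rightarrow> 'a" where
  "coset_prod M f s = gfinprod A f (s <#\<^bsub>B\<^esub> M)"

text \<open>Commutativity makes the product over a coset multiplicative, finite supports keep it
  finite even if \<open>M\<close> is infinite, and left translation merely permutes the
  cosets.\<close>

lemma wreath_coset_map_coset_prod:
  assumes A: "comm_group A" and M: "M \<lhd> B"
  shows "wreath_coset_map A B M (coset_prod M)"
proof -
  interpret AC: comm_group A by fact
  have Ms: "subgroup M B" using M by (rule normal_imp_subgroup)
  have Mc: "m \<in> carrier B" if "m \<in> M" for m using subgroup.mem_carrier[OF Ms that] .
  have coset: "s <#\<^bsub>B\<^esub> M = (\<lambda>m. s \<otimes>\<^bsub>B\<^esub> m) ` M" for s by (auto simp: l_coset_def)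
  have cc: "u \<in> carrier B" if "u \<in> s <#\<^bsub>B\<^esub> M" "s \<in> carrier B" for u s
    using that Mc by (auto simp: coset)
  have fin: "finite {u \<in> s <#\<^bsub>B\<^esub> M. f u \<noteq> \<one>\<^bsub>A\<^esub>}"
    if "f \<in> carrier (wreath_base A B)" "s \<in> carrier B" for f s
    by (rule finite_subset[of _ "{u \<in> carrier B. f u \<noteq> \<one>\<^bsub>A\<^esub>}"])
      (use that cc in \<open>auto simp: base_iff\<close>)
  have Pi: "f \<in> (s <#\<^bsub>B\<^esub> M) \<rightarrow> carrier A"
    if "f \<in> carrier (wreath_base A B)" "s \<in> carrier B" for f s
    using that cc by auto
  show ?thesis
  proof (intro wreath_coset_map.intro wreath_axioms wreath_coset_map_axioms.intro)
    show "M \<lhd> B" by fact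
    fix f s assume f: "f \<in> carrier (wreath_base A B)" and s: "s \<in> carrier B"
    show "coset_prod M f s \<in> carrier A" unfolding coset_prod_def using Pi[OF f s] by simp
    show "coset_prod M (f \<otimes>\<^bsub>wreath_base A B\<^esub> g) s = coset_prod M f s \<otimes>\<^bsub>A\<^esub> coset_prod M g s"
      if g: "g \<in> carrier (wreath_base A B)" for g
    proof -
      have "coset_prod M (f \<otimes>\<^bsub>wreath_base A B\<^esub> g) s = gfinprod A (\<lambda>i. f i \<otimes>\<^bsub>A\<^esub> g i) (s <#\<^bsub>B\<^esub> M)"
        unfolding coset_prod_def using f g s cc
        by (intro AC.gfinprod_cong) (auto simp: simp_implies_def)
      then show ?thesis
        using AC.gfinprod_distrib[OF fin[OF f s] fin[OF g s] Pi[OF f s] Pi[OF g s]]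
        by (simp add: coset_prod_def)
    qed
    show "coset_prod M (left_translate B b f) s = coset_prod M f (inv\<^bsub>B\<^esub> b \<otimes>\<^bsub>B\<^esub> s)" if b: "b \<in> carrier B" for b
    proof -
      have eq: "(inv\<^bsub>B\<^esub> b \<otimes>\<^bsub>B\<^esub> s) <#\<^bsub>B\<^esub> M = (\<lambda>u. inv\<^bsub>B\<^esub> b \<otimes>\<^bsub>B\<^esub> u) ` (s <#\<^bsub>B\<^esub> M)"
        using b s Mc by (force simp: coset image_image B.m_assoc)
      have "coset_prod M f (inv\<^bsub>B\<^esub> b \<otimes>\<^bsub>B\<^esub> s) = gfinprod A (\<lambda>u. f (inv\<^bsub>B\<^esub> b \<otimes>\<^bsub>B\<^esub> u)) (s <#\<^bsub>B\<^esub> M)"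
        unfolding coset_prod_def eq using b s cc f
        by (intro AC.gfinprod_reindex) (auto simp: inj_on_def)
      also have "\<dots> = coset_prod M (left_translate B b f) s"
        unfolding coset_prod_def using b s cc f
        by (intro AC.gfinprod_cong) (auto simp: simp_implies_def left_translate_def)
      finally show ?thesis by simp
    qed
    show "coset_prod M f (s \<otimes>\<^bsub>B\<^esub> m) = coset_prod M f s" if m: "m \<in> M" for m
    proof -
      have "m <#\<^bsub>B\<^esub> M = M"
      proof
        show "M \<subseteq> m <#\<^bsub>B\<^esub> M"
        proof
          fix u assume u: "u \<in> M"
          have "u = m \<otimes>\<^bsub>B\<^esub> (inv\<^bsub>B\<^esub> m \<otimes>\<^bsub>B\<^esub> u)" using Mc m u by simp
          moreover have "inv\<^bsub>B\<^esub> m \<otimes>\<^bsub>B\<^esub> u \<in> M"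
            using m u Ms by (simp add: subgroup.m_closed subgroup.m_inv_closed)
          ultimately show "u \<in> m <#\<^bsub>B\<^esub> M" unfolding coset by (rule image_eqI)
        qed
      qed (use m Ms in \<open>auto simp: coset subgroup.m_closed\<close>)
      then have "(s \<otimes>\<^bsub>B\<^esub> m) <#\<^bsub>B\<^esub> M = s <#\<^bsub>B\<^esub> M"
        using B.lcos_m_assoc[of M s m] s m Mc by auto
      then show ?thesis by (simp add: coset_prod_def)
    qed
    show "coset_prod M f s = f s"
      if iso: "\<And>m. m \<in> M \<Longrightarrow> m \<noteq> \<one>\<^bsub>B\<^esub> \<Longrightarrow> f (s \<otimes>\<^bsub>B\<^esub> m) = \<one>\<^bsub>A\<^esub>"
    proof -
      have "s \<in> s <#\<^bsub>B\<^esub> M" using s subgroup.one_closed[OF Ms] by (force simp: coset)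
      moreover have "f u = \<one>\<^bsub>A\<^esub>" if u: "u \<in> (s <#\<^bsub>B\<^esub> M) - {s}" for u
      proof -
        obtain m where "m \<in> M" "u = s \<otimes>\<^bsub>B\<^esub> m" "u \<noteq> s" using u by (auto simp: coset)
        then show ?thesis using iso[of m] s by (cases "m = \<one>\<^bsub>B\<^esub>") auto
      qed
      ultimately have "coset_prod M f s = gfinprod A f {s}"
        unfolding coset_prod_def using Pi[OF f s]
        by (intro AC.gfinprod_mono_neutral_cong_right) auto
      then show ?thesis using f s by simp
    qed
  qed
qed

text \<open>With \<open>M\<close> trivial the coset subgroup consists of the base elements with
  values in \<open>K0\<close>, and the n-th powers of \<open>x\<close> and \<open>g\<close> decide
  coordinate by coordinate: if they are \<open>K0\<close>-conjugate everywhere, the recursion along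
  orbits can be started; otherwise the hypothesis on \<open>A\<close> separates one bad
  coordinate.\<close>

lemma p_hereditarily_conjugacy_separable_finite:
  assumes p: "Factorial_Ring.prime p" and B: "finite_p_group p B"
    and A: "p_hereditarily_conjugacy_separable p A"
  shows "p_hereditarily_conjugacy_separable p (A \<wr> B)"
  unfolding W.p_hereditarily_conjugacy_separable_iff[OF p]
proof (intro ballI allI impI)
  fix x K assume x: "x \<in> carrier (A \<wr> B)" and K: "p_open p (A \<wr> B) K"
  interpret t: wreath_coset_map A B "{\<one>\<^bsub>B\<^esub>}" "\<lambda>f. f" by (rule wreath_coset_map_trivial)
  have \<Theta>: "t.\<Theta> y s = fst y s" for y s by (simp add: t.\<Theta>_def)
  have B1: "p_open p B {\<one>\<^bsub>B\<^esub>}"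
  proof (rule B.p_openI[where c = "\<lambda>x. x"])
    show "\<exists>n. y [^]\<^bsub>B\<^esub> (p ^ n :: nat) \<in> {\<one>\<^bsub>B\<^esub>}" if "y \<in> carrier B" for y
      using that B by (simp add: finite_p_group_def p_group_def) (metis B.pow_ord_eq_1)
  qed (use B in \<open>auto simp: B.one_is_normal finite_p_group_def\<close>)
  define K0 where "K0 = {a \<in> carrier A. single a \<one>\<^bsub>B\<^esub> \<in> K}"
  have K0: "p_open p A K0"
    unfolding K0_def by (rule group_hom.p_open_vimage[OF single_hom[OF B.one_closed] K])
  then have K0n: "K0 \<lhd> A" and K0s: "subgroup K0 A"
    using A.p_open_normal A.p_open_subgroup by auto
  have Ks: "subgroup K (A \<wr> B)" using K by (rule W.p_open_subgroup)
  let ?K = "t.coset_subgroup K0"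
  have K': "p_open p (A \<wr> B) ?K" using B1 K0 by (rule t.coset_subgroup_p_open)
  have "top_elem \<one>\<^bsub>B\<^esub> = \<one>\<^bsub>A \<wr> B\<^esub>" by (intro wreath_eqI) auto
  then have sub: "?K \<subseteq> K"
    using W.p_open_normal[OF K] K0s subgroup.one_closed[OF Ks]
    by (intro t.coset_subgroup_subset) (auto simp: K0_def)
  have "conj_closed p (A \<wr> B) ?K x"
  proof (rule t.conj_closed_coset_subgroup[OF B1 K0 x])
    show "conj_closed p B {\<one>\<^bsub>B\<^esub>} (snd x)"
      unfolding conj_closed_def using x B1 B.r_coset_eq_iff[OF B.p_open_subgroup[OF B1]]
      by (auto simp: B.m_inv_eq_one_iff intro!: exI[of _ "{\<one>\<^bsub>B\<^esub>}"])
    fix g assume g: "g \<in> carrier (A \<wr> B)" and snd: "snd g = snd x"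
      and gx: "g \<otimes>\<^bsub>A \<wr> B\<^esub> inv\<^bsub>A \<wr> B\<^esub> x \<in> ?K"
      and ng: "\<forall>k\<in>?K. g \<noteq> k \<otimes>\<^bsub>A \<wr> B\<^esub> x \<otimes>\<^bsub>A \<wr> B\<^esub> inv\<^bsub>A \<wr> B\<^esub> k"
    define n where "n = B.ord (snd x)"
    have n: "0 < n" "snd x [^]\<^bsub>B\<^esub> n = \<one>\<^bsub>B\<^esub>"
      using B p x prime_gt_0_nat by (auto simp: n_def finite_p_group_def p_group_def) (metis zero_less_power neq0_conv snd_closed)
    have "snd x [^]\<^bsub>B\<^esub> i \<notin> {\<one>\<^bsub>B\<^esub>}" if "0 < i" "i < n" for i
      using that x B.pow_eq_id[of "snd x" i] by (auto simp: n_def dest: dvd_imp_le)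
    then obtain \<iota> where \<iota>: "\<forall>s\<in>carrier B. \<iota> s < n \<and> \<iota> (snd x \<otimes>\<^bsub>B\<^esub> s) = Suc (\<iota> s) mod n \<and>
        (\<forall>m\<in>{\<one>\<^bsub>B\<^esub>}. \<iota> (s \<otimes>\<^bsub>B\<^esub> m) = \<iota> s)"
      using B.cyclic_coset_index[of "snd x" n "{\<one>\<^bsub>B\<^esub>}"] n x B.one_is_normal by auto
    define P P' where "P = fst (x [^]\<^bsub>A \<wr> B\<^esub> n)" and "P' = fst (g [^]\<^bsub>A \<wr> B\<^esub> n)"
    have PA: "P s \<in> carrier A" "P' s \<in> carrier A" if "s \<in> carrier B" for s
      using that x g by (auto simp: P_def P'_def)
    have "\<exists>s\<in>carrier B. \<forall>k\<in>K0. P' s \<noteq> k \<otimes>\<^bsub>A\<^esub> P s \<otimes>\<^bsub>A\<^esub> inv\<^bsub>A\<^esub> k"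
    proof (rule ccontr)
      assume "\<not> ?thesis"
      then obtain \<kappa> where \<kappa>: "\<And>s. s \<in> carrier B \<Longrightarrow> \<kappa> s \<in> K0"
        "\<And>s. s \<in> carrier B \<Longrightarrow> P' s = \<kappa> s \<otimes>\<^bsub>A\<^esub> P s \<otimes>\<^bsub>A\<^esub> inv\<^bsub>A\<^esub> (\<kappa> s)" by metis
      have \<kappa>A: "\<kappa> s \<in> carrier A" if "s \<in> carrier B" for s
        using subgroup.mem_carrier[OF K0s \<kappa>(1)[OF that]] .
      \<comment> \<open>Independent choices of \<open>\<kappa> s\<close> form a base element because
        \<open>B\<close> is finite.\<close>
      define k where "k = (restrict \<kappa> (carrier B), \<one>\<^bsub>B\<^esub>)"
      have kc: "k \<in> carrier (A \<wr> B)"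
        using B \<kappa>A by (auto simp: k_def wreath_carrier_iff base_iff finite_p_group_def)
      have "\<exists>h\<in>?K. g = h \<otimes>\<^bsub>A \<wr> B\<^esub> x \<otimes>\<^bsub>A \<wr> B\<^esub> inv\<^bsub>A \<wr> B\<^esub> h"
      proof (rule t.conjugate_by_coset_subgroup[OF K0n x g snd, of \<iota> n k])
        show "k \<in> ?K" using kc \<kappa>(1) by (auto simp: t.coset_subgroup_def \<Theta>, auto simp: k_def)
        fix s assume s: "s \<in> carrier B"
        have "fst (g [^]\<^bsub>A \<wr> B\<^esub> n \<otimes>\<^bsub>A \<wr> B\<^esub> k \<otimes>\<^bsub>A \<wr> B\<^esub> inv\<^bsub>A \<wr> B\<^esub> (x [^]\<^bsub>A \<wr> B\<^esub> n)) s =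
            P' s \<otimes>\<^bsub>A\<^esub> \<kappa> s \<otimes>\<^bsub>A\<^esub> inv\<^bsub>A\<^esub> (P s)"
          using s x g kc n by (simp add: P_def P'_def snd k_def)
        also have "\<dots> = fst k s" using s \<kappa>A PA by (simp add: \<kappa>(2) A.m_assoc k_def)
        finally show "fst (g [^]\<^bsub>A \<wr> B\<^esub> n \<otimes>\<^bsub>A \<wr> B\<^esub> k \<otimes>\<^bsub>A \<wr> B\<^esub> inv\<^bsub>A \<wr> B\<^esub> (x [^]\<^bsub>A \<wr> B\<^esub> n)) s = fst k s" .
      qed (use \<iota> gx in \<open>auto simp: k_def\<close>)
      then show False using ng by blast
    qed
    then obtain s where s: "s \<in> carrier B" "\<forall>k\<in>K0. P' s \<noteq> k \<otimes>\<^bsub>A\<^esub> P s \<otimes>\<^bsub>A\<^esub> inv\<^bsub>A\<^esub> k" by blast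
    have "conj_closed p A K0 (P s)"
      using A K0 PA s(1) A.p_hereditarily_conjugacy_separable_iff[OF p] by blast
    then obtain L where L: "p_open p A L"
      "\<forall>k\<in>K0. L #>\<^bsub>A\<^esub> P' s \<noteq> L #>\<^bsub>A\<^esub> (k \<otimes>\<^bsub>A\<^esub> P s \<otimes>\<^bsub>A\<^esub> inv\<^bsub>A\<^esub> k)"
      using s PA(2)[OF s(1)] unfolding conj_closed_def by blast
    let ?N = "t.coset_subgroup L"
    have N: "p_open p (A \<wr> B) ?N" using B1 L(1) by (rule t.coset_subgroup_p_open)
    have "?N #>\<^bsub>A \<wr> B\<^esub> g \<noteq> ?N #>\<^bsub>A \<wr> B\<^esub> (k \<otimes>\<^bsub>A \<wr> B\<^esub> x \<otimes>\<^bsub>A \<wr> B\<^esub> inv\<^bsub>A \<wr> B\<^esub> k)" if k: "k \<in> ?K" for k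
    proof
      have kc: "k \<in> carrier (A \<wr> B)" "snd k = \<one>\<^bsub>B\<^esub>" "fst k s \<in> K0"
        using k s(1) by (auto simp: t.coset_subgroup_def \<Theta>)
      assume "?N #>\<^bsub>A \<wr> B\<^esub> g = ?N #>\<^bsub>A \<wr> B\<^esub> (k \<otimes>\<^bsub>A \<wr> B\<^esub> x \<otimes>\<^bsub>A \<wr> B\<^esub> inv\<^bsub>A \<wr> B\<^esub> k)"
      then have "?N #>\<^bsub>A \<wr> B\<^esub> (g [^]\<^bsub>A \<wr> B\<^esub> n) =
          ?N #>\<^bsub>A \<wr> B\<^esub> ((k \<otimes>\<^bsub>A \<wr> B\<^esub> x \<otimes>\<^bsub>A \<wr> B\<^esub> inv\<^bsub>A \<wr> B\<^esub> k) [^]\<^bsub>A \<wr> B\<^esub> n)"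
        using g x kc by (intro W.r_coset_cong_pow W.p_open_normal[OF N]) auto
      then have "g [^]\<^bsub>A \<wr> B\<^esub> n \<otimes>\<^bsub>A \<wr> B\<^esub> inv\<^bsub>A \<wr> B\<^esub> (k \<otimes>\<^bsub>A \<wr> B\<^esub> x [^]\<^bsub>A \<wr> B\<^esub> n \<otimes>\<^bsub>A \<wr> B\<^esub> inv\<^bsub>A \<wr> B\<^esub> k) \<in> ?N"
        using W.r_coset_eq_iff[OF W.p_open_subgroup[OF N]] g x kc by (simp add: W.conj_pow)
      then have "P' s \<otimes>\<^bsub>A\<^esub> inv\<^bsub>A\<^esub> (fst k s \<otimes>\<^bsub>A\<^esub> P s \<otimes>\<^bsub>A\<^esub> inv\<^bsub>A\<^esub> (fst k s)) \<in> L"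
        using g x kc s(1) n by (auto simp: t.coset_subgroup_def \<Theta> P_def P'_def snd)
      then show False
        using bspec[OF L(2) kc(3)] kc(1) PA s(1) A.r_coset_eq_iff[OF A.p_open_subgroup[OF L(1)]]
        by simp
    qed
    then show "\<exists>N. p_open p (A \<wr> B) N \<and> (\<forall>k\<in>?K.
        N #>\<^bsub>A \<wr> B\<^esub> g \<noteq> N #>\<^bsub>A \<wr> B\<^esub> (k \<otimes>\<^bsub>A \<wr> B\<^esub> x \<otimes>\<^bsub>A \<wr> B\<^esub> inv\<^bsub>A \<wr> B\<^esub> k))"
      using N by blast
  qed
  then show "conj_closed p (A \<wr> B) K x" by (rule W.conj_closed_reduce[OF Ks K' sub x])
qed

end

section \<open>The case of an abelian base and a top group that is a p-group\<close>

context wreath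
begin

text \<open>The \<open>n\<close>-th powers lie in the base group, so they can be compared there. A coset \<open>dM\<close> that
  matches the two supports contains one of finitely many elements, so a single \<open>M\<close> can be chosen
  that keeps all relevant points and commutators apart.\<close>
lemma separate_by_powers:
  assumes A: "comm_group A"
    and A_res: "\<And>E. finite E \<Longrightarrow> E \<subseteq> carrier A \<Longrightarrow> \<exists>L. p_open p A L \<and> L \<inter> E \<subseteq> {\<one>\<^bsub>A\<^esub>}"
    and B_res: "\<And>E. finite E \<Longrightarrow> E \<subseteq> carrier B \<Longrightarrow> \<exists>M. p_open p B M \<and> M \<inter> E \<subseteq> {\<one>\<^bsub>B\<^esub>}"
    and M0: "p_open p B M0" and x: "x \<in> carrier (A \<wr> B)" and g: "g \<in> carrier (A \<wr> B)"
    and snd: "snd g = snd x" and n: "snd x [^]\<^bsub>B\<^esub> (n::nat) = \<one>\<^bsub>B\<^esub>"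
    and diff: "\<And>d. d \<in> M0 \<Longrightarrow> d \<otimes>\<^bsub>B\<^esub> snd x = snd x \<otimes>\<^bsub>B\<^esub> d \<Longrightarrow>
      \<exists>s\<in>carrier B. fst (g [^]\<^bsub>A \<wr> B\<^esub> n) s \<noteq> fst (x [^]\<^bsub>A \<wr> B\<^esub> n) (inv\<^bsub>B\<^esub> d \<otimes>\<^bsub>B\<^esub> s)"
  shows "\<exists>N. p_open p (A \<wr> B) N \<and> (\<forall>k\<in>carrier (A \<wr> B). snd k \<in> M0 \<longrightarrow>
    N #>\<^bsub>A \<wr> B\<^esub> g \<noteq> N #>\<^bsub>A \<wr> B\<^esub> (k \<otimes>\<^bsub>A \<wr> B\<^esub> x \<otimes>\<^bsub>A \<wr> B\<^esub> inv\<^bsub>A \<wr> B\<^esub> k))"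
proof -
  interpret AC: comm_group A by fact
  define b where "b = snd x"
  define P P' where "P = fst (x [^]\<^bsub>A \<wr> B\<^esub> n)" and "P' = fst (g [^]\<^bsub>A \<wr> B\<^esub> n)"
  have b: "b \<in> carrier B" using x by (simp add: b_def)
  have Pb: "P \<in> carrier (wreath_base A B)" "P' \<in> carrier (wreath_base A B)"
    using x g by (simp_all add: P_def P'_def)
  define S S' where "S = {s \<in> carrier B. P s \<noteq> \<one>\<^bsub>A\<^esub>}" and "S' = {s \<in> carrier B. P' s \<noteq> \<one>\<^bsub>A\<^esub>}"
  have S: "finite S" "finite S'" "S \<subseteq> carrier B" "S' \<subseteq> carrier B"
    using Pb by (auto simp: S_def S'_def base_iff)
  \<comment> \<open>If a translation is to match the support \<open>S\<close> of \<open>x^n\<close>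
    with the support \<open>S'\<close> of \<open>g^n\<close>, it takes some \<open>s\<close> to some
    \<open>t\<close> and hence is \<open>t s^-1\<close>. The identity is added for the untranslated
    support and for empty \<open>S\<close>.\<close>
  define D where "D = insert \<one>\<^bsub>B\<^esub> ((\<lambda>(t, s). t \<otimes>\<^bsub>B\<^esub> inv\<^bsub>B\<^esub> s) ` (S' \<times> S))"
  have D: "finite D" "D \<subseteq> carrier B" using S by (auto simp: D_def)
  define E where "E = S' \<union> (\<lambda>(d, s). d \<otimes>\<^bsub>B\<^esub> s) ` (D \<times> S)"
  have E: "finite E" "E \<subseteq> carrier B" using S D by (auto simp: E_def)
  have E_mem: "d \<otimes>\<^bsub>B\<^esub> s \<in> E" if "d \<in> D" "s \<in> S" for d s using that by (force simp: E_def)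
  \<comment> \<open>An \<open>M\<close> that avoids the first part keeps distinct points of
    \<open>E\<close> in distinct cosets; avoiding the second part makes elements of \<open>D\<close>
    that commute with \<open>b\<close> modulo \<open>M\<close> commute with
    \<open>b\<close>.\<close>
  define EB where "EB = (\<lambda>(u, v). inv\<^bsub>B\<^esub> u \<otimes>\<^bsub>B\<^esub> v) ` (E \<times> E) \<union>
    (\<lambda>d. d \<otimes>\<^bsub>B\<^esub> b \<otimes>\<^bsub>B\<^esub> inv\<^bsub>B\<^esub> d \<otimes>\<^bsub>B\<^esub> inv\<^bsub>B\<^esub> b) ` D"
  have "finite EB" "EB \<subseteq> carrier B" using E D b by (auto simp: EB_def)
  then obtain M1 where M1: "p_open p B M1" "M1 \<inter> EB \<subseteq> {\<one>\<^bsub>B\<^esub>}" using B_res by blast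
  \<comment> \<open>An \<open>L\<close> that avoids these quotients distinguishes different values
    of the two powers; the identity stands for points outside the supports.\<close>
  define EA where "EA = (\<lambda>(a, a'). a \<otimes>\<^bsub>A\<^esub> inv\<^bsub>A\<^esub> a') ` (insert \<one>\<^bsub>A\<^esub> (P' ` S') \<times> insert \<one>\<^bsub>A\<^esub> (P ` S))"
  have "finite EA" "EA \<subseteq> carrier A"
    using S Pb by (auto simp: EA_def S_def S'_def)
  then obtain L where L: "p_open p A L" "L \<inter> EA \<subseteq> {\<one>\<^bsub>A\<^esub>}" using A_res by blast
  have L_eq: "P' s = P t" if "s \<in> carrier B" "t \<in> carrier B" "P' s \<otimes>\<^bsub>A\<^esub> inv\<^bsub>A\<^esub> (P t) \<in> L" for s t
  proof -
    have "P' s \<in> insert \<one>\<^bsub>A\<^esub> (P' ` S')" "P t \<in> insert \<one>\<^bsub>A\<^esub> (P ` S)"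
      using that by (auto simp: S_def S'_def)
    then have "P' s \<otimes>\<^bsub>A\<^esub> inv\<^bsub>A\<^esub> (P t) \<in> EA" unfolding EA_def by force
    then have "P' s \<otimes>\<^bsub>A\<^esub> inv\<^bsub>A\<^esub> (P t) = \<one>\<^bsub>A\<^esub>" using that L(2) by blast
    then show ?thesis using that Pb by (simp add: A.m_inv_eq_one_iff)
  qed
  define M where "M = M0 \<inter> M1"
  have M: "p_open p B M" unfolding M_def using M0 M1(1) by (rule B.p_open_Int)
  have Mn: "M \<lhd> B" and Ms: "subgroup M B" using M B.p_open_normal B.p_open_subgroup by auto
  interpret c: wreath_coset_map A B M "coset_prod M"
    using A Mn by (rule wreath_coset_map_coset_prod)
  have M_E: "u = v" if "u \<in> E" "v \<in> E" "inv\<^bsub>B\<^esub> u \<otimes>\<^bsub>B\<^esub> v \<in> M" for u v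
  proof -
    have "inv\<^bsub>B\<^esub> u \<otimes>\<^bsub>B\<^esub> v \<in> EB" using that(1,2) by (force simp: EB_def)
    then have "inv\<^bsub>B\<^esub> u \<otimes>\<^bsub>B\<^esub> v = \<one>\<^bsub>B\<^esub>" using that(3) M1(2) by (auto simp: M_def)
    then show ?thesis using that E(2) by (metis B.inv_equality B.inv_inv B.inv_closed subsetD)
  qed
  have \<Theta>_eq: "c.\<Theta> y s = fst y s"
    if "y \<in> carrier (A \<wr> B)" "s \<in> carrier B"
      "\<And>t. t \<in> carrier B \<Longrightarrow> fst y t \<noteq> \<one>\<^bsub>A\<^esub> \<Longrightarrow> inv\<^bsub>B\<^esub> s \<otimes>\<^bsub>B\<^esub> t \<in> M \<Longrightarrow> t = s" for y s
    unfolding c.\<Theta>_def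
  proof (rule c.\<theta>_isolated)
    show "fst y (s \<otimes>\<^bsub>B\<^esub> m) = \<one>\<^bsub>A\<^esub>" if "m \<in> M" "m \<noteq> \<one>\<^bsub>B\<^esub>" for m
      using that \<open>s \<in> carrier B\<close>
        \<open>\<And>t. t \<in> carrier B \<Longrightarrow> fst y t \<noteq> \<one>\<^bsub>A\<^esub> \<Longrightarrow> inv\<^bsub>B\<^esub> s \<otimes>\<^bsub>B\<^esub> t \<in> M \<Longrightarrow> t = s\<close>[of "s \<otimes>\<^bsub>B\<^esub> m"]
      by auto
  qed (use that in auto)
  have \<Theta>_g: "c.\<Theta> (g [^]\<^bsub>A \<wr> B\<^esub> n) s = P' s" if "s \<in> E" for s
    unfolding P'_def
  proof (rule \<Theta>_eq)
    show "t = s" if "t \<in> carrier B" "fst (g [^]\<^bsub>A \<wr> B\<^esub> n) t \<noteq> \<one>\<^bsub>A\<^esub>" "inv\<^bsub>B\<^esub> s \<otimes>\<^bsub>B\<^esub> t \<in> M" for t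
      using that M_E[OF \<open>s \<in> E\<close>, of t] by (auto simp: E_def S'_def P'_def)
  qed (use that E g in auto)
  \<comment> \<open>Translation by \<open>d\<close> brings the support of \<open>x^n\<close> into
    \<open>E\<close>, whose points lie in different cosets, so \<open>s\<close> is isolated
    too.\<close>
  have \<Theta>_x: "c.\<Theta> (x [^]\<^bsub>A \<wr> B\<^esub> n) s = P s" if s: "s \<in> carrier B" and d: "d \<in> D" "d \<otimes>\<^bsub>B\<^esub> s \<in> E" for s d
    unfolding P_def
  proof (rule \<Theta>_eq)
    fix t assume t: "t \<in> carrier B" "fst (x [^]\<^bsub>A \<wr> B\<^esub> n) t \<noteq> \<one>\<^bsub>A\<^esub>" "inv\<^bsub>B\<^esub> s \<otimes>\<^bsub>B\<^esub> t \<in> M"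
    have dc: "d \<in> carrier B" using d D by blast
    have "inv\<^bsub>B\<^esub> (d \<otimes>\<^bsub>B\<^esub> s) \<otimes>\<^bsub>B\<^esub> (d \<otimes>\<^bsub>B\<^esub> t) = inv\<^bsub>B\<^esub> s \<otimes>\<^bsub>B\<^esub> t"
      using s t dc by (simp add: B.inv_mult_group B.m_assoc)
    then have "d \<otimes>\<^bsub>B\<^esub> s = d \<otimes>\<^bsub>B\<^esub> t"
      using M_E[OF d(2) E_mem[OF d(1)], of t] t by (simp add: S_def P_def)
    then show "t = s" using s t dc by simp
  qed (use s x in auto)
  let ?N = "c.coset_subgroup L"
  have N: "p_open p (A \<wr> B) ?N" using M L(1) by (rule c.coset_subgroup_p_open)
  have "?N #>\<^bsub>A \<wr> B\<^esub> g \<noteq> ?N #>\<^bsub>A \<wr> B\<^esub> (k \<otimes>\<^bsub>A \<wr> B\<^esub> x \<otimes>\<^bsub>A \<wr> B\<^esub> inv\<^bsub>A \<wr> B\<^esub> k)"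
    if k: "k \<in> carrier (A \<wr> B)" "snd k \<in> M0" for k
  proof
    assume eq: "?N #>\<^bsub>A \<wr> B\<^esub> g = ?N #>\<^bsub>A \<wr> B\<^esub> (k \<otimes>\<^bsub>A \<wr> B\<^esub> x \<otimes>\<^bsub>A \<wr> B\<^esub> inv\<^bsub>A \<wr> B\<^esub> k)"
    define c where "c = snd k"
    have cc: "c \<in> carrier B" "c \<in> M0" using k by (simp_all add: c_def)
    have "?N #>\<^bsub>A \<wr> B\<^esub> (g [^]\<^bsub>A \<wr> B\<^esub> n) =
        ?N #>\<^bsub>A \<wr> B\<^esub> ((k \<otimes>\<^bsub>A \<wr> B\<^esub> x \<otimes>\<^bsub>A \<wr> B\<^esub> inv\<^bsub>A \<wr> B\<^esub> k) [^]\<^bsub>A \<wr> B\<^esub> n)"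
      using g x k eq by (intro W.r_coset_cong_pow W.p_open_normal[OF N]) auto
    then have "g [^]\<^bsub>A \<wr> B\<^esub> n \<otimes>\<^bsub>A \<wr> B\<^esub> inv\<^bsub>A \<wr> B\<^esub> (k \<otimes>\<^bsub>A \<wr> B\<^esub> x [^]\<^bsub>A \<wr> B\<^esub> n \<otimes>\<^bsub>A \<wr> B\<^esub> inv\<^bsub>A \<wr> B\<^esub> k) \<in> ?N"
      using W.r_coset_eq_iff[OF W.p_open_subgroup[OF N]] g x k by (simp add: W.conj_pow)
    then have "c.\<Theta> (g [^]\<^bsub>A \<wr> B\<^esub> n) s \<otimes>\<^bsub>A\<^esub> inv\<^bsub>A\<^esub> (c.\<Theta> k s \<otimes>\<^bsub>A\<^esub>
        c.\<Theta> (x [^]\<^bsub>A \<wr> B\<^esub> n) (inv\<^bsub>B\<^esub> c \<otimes>\<^bsub>B\<^esub> s) \<otimes>\<^bsub>A\<^esub> inv\<^bsub>A\<^esub> (c.\<Theta> k s)) \<in> L"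
      if "s \<in> carrier B" for s
      using that g x k cc n by (auto simp: c.coset_subgroup_def snd simp flip: c_def)
    \<comment> \<open>Commutativity of \<open>A\<close> removes the base part of \<open>k\<close>;
      only its top part \<open>c\<close> matters from here on.\<close>
    moreover have "c.\<Theta> k s \<otimes>\<^bsub>A\<^esub> c.\<Theta> (x [^]\<^bsub>A \<wr> B\<^esub> n) (inv\<^bsub>B\<^esub> c \<otimes>\<^bsub>B\<^esub> s) \<otimes>\<^bsub>A\<^esub> inv\<^bsub>A\<^esub> (c.\<Theta> k s) =
        c.\<Theta> (x [^]\<^bsub>A \<wr> B\<^esub> n) (inv\<^bsub>B\<^esub> c \<otimes>\<^bsub>B\<^esub> s)" if "s \<in> carrier B" for s
      using that x k cc by (simp add: AC.m_comm[of "c.\<Theta> k s"] A.m_assoc)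
    ultimately have L_mem: "c.\<Theta> (g [^]\<^bsub>A \<wr> B\<^esub> n) s \<otimes>\<^bsub>A\<^esub>
        inv\<^bsub>A\<^esub> (c.\<Theta> (x [^]\<^bsub>A \<wr> B\<^esub> n) (inv\<^bsub>B\<^esub> c \<otimes>\<^bsub>B\<^esub> s)) \<in> L" if "s \<in> carrier B" for s
      using that by simp
    have "g \<otimes>\<^bsub>A \<wr> B\<^esub> inv\<^bsub>A \<wr> B\<^esub> (k \<otimes>\<^bsub>A \<wr> B\<^esub> x \<otimes>\<^bsub>A \<wr> B\<^esub> inv\<^bsub>A \<wr> B\<^esub> k) \<in> ?N"
      using eq W.r_coset_eq_iff[OF W.p_open_subgroup[OF N]] g x k by simp
    then have "b \<otimes>\<^bsub>B\<^esub> inv\<^bsub>B\<^esub> (c \<otimes>\<^bsub>B\<^esub> b \<otimes>\<^bsub>B\<^esub> inv\<^bsub>B\<^esub> c) \<in> M"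
      using g x k by (simp add: c.coset_subgroup_def snd b_def c_def)
    then have M_comm: "M #>\<^bsub>B\<^esub> b = M #>\<^bsub>B\<^esub> (c \<otimes>\<^bsub>B\<^esub> b \<otimes>\<^bsub>B\<^esub> inv\<^bsub>B\<^esub> c)"
      using B.r_coset_eq_iff[OF Ms] b cc by simp
    \<comment> \<open>\<open>c\<close> commutes with \<open>b\<close> only modulo \<open>M\<close>.
      It is replaced by an element of the finite set \<open>D\<close> that translates the coset
      values of \<open>x^n\<close> in the same way and truly commutes with \<open>b\<close>, so that
      \<open>diff\<close> applies.\<close>
    have "\<exists>d\<in>D. d \<in> M0 \<and> d \<otimes>\<^bsub>B\<^esub> b = b \<otimes>\<^bsub>B\<^esub> d \<and> (\<forall>s\<in>carrier B.
        c.\<Theta> (x [^]\<^bsub>A \<wr> B\<^esub> n) (inv\<^bsub>B\<^esub> c \<otimes>\<^bsub>B\<^esub> s) = c.\<Theta> (x [^]\<^bsub>A \<wr> B\<^esub> n) (inv\<^bsub>B\<^esub> d \<otimes>\<^bsub>B\<^esub> s))"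
    proof (cases "S = {}")
      case True
      have one: "c.\<Theta> (x [^]\<^bsub>A \<wr> B\<^esub> n) s = \<one>\<^bsub>A\<^esub>" if "s \<in> carrier B" for s
      proof -
        have "P t = \<one>\<^bsub>A\<^esub>" if "t \<in> carrier B" for t using True that by (auto simp: S_def)
        then show ?thesis using \<Theta>_eq[of "x [^]\<^bsub>A \<wr> B\<^esub> n" s] that x by (simp add: P_def)
      qed
      show ?thesis
        using b cc subgroup.one_closed[OF B.p_open_subgroup[OF M0]]
        by (intro bexI[of _ "\<one>\<^bsub>B\<^esub>"]) (auto simp: D_def one)
    next
      case False
      then obtain s where s: "s \<in> S" by blast
      have sc: "s \<in> carrier B" "P s \<noteq> \<one>\<^bsub>A\<^esub>" using s by (auto simp: S_def)
      have one_D: "\<one>\<^bsub>B\<^esub> \<in> D" by (simp add: D_def)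
      have "\<one>\<^bsub>B\<^esub> \<otimes>\<^bsub>B\<^esub> s \<in> E" using E_mem[OF one_D s] .
      then have x_s: "c.\<Theta> (x [^]\<^bsub>A \<wr> B\<^esub> n) s = P s" using \<Theta>_x[OF sc(1) one_D] by simp
      \<comment> \<open>The nontrivial value of \<open>x^n\<close> at \<open>s\<close> is carried to
        \<open>c s\<close>, so \<open>g^n\<close> must have a support point in the coset of
        \<open>c s\<close>.\<close>
      have "\<exists>t\<in>S'. inv\<^bsub>B\<^esub> (c \<otimes>\<^bsub>B\<^esub> s) \<otimes>\<^bsub>B\<^esub> t \<in> M"
      proof (rule ccontr)
        assume no: "\<not> ?thesis"
        have cs: "c \<otimes>\<^bsub>B\<^esub> s \<in> carrier B" using cc sc by simp
        have "c.\<Theta> (g [^]\<^bsub>A \<wr> B\<^esub> n) (c \<otimes>\<^bsub>B\<^esub> s) = P' (c \<otimes>\<^bsub>B\<^esub> s)"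
          unfolding P'_def by (rule \<Theta>_eq) (use no cs g in \<open>auto simp: S'_def P'_def\<close>)
        moreover have "P' (c \<otimes>\<^bsub>B\<^esub> s) = \<one>\<^bsub>A\<^esub>"
        proof (rule ccontr)
          assume "P' (c \<otimes>\<^bsub>B\<^esub> s) \<noteq> \<one>\<^bsub>A\<^esub>"
          then have "c \<otimes>\<^bsub>B\<^esub> s \<in> S'" using cs by (simp add: S'_def)
          then show False using no cs subgroup.one_closed[OF Ms] by force
        qed
        moreover have "c.\<Theta> (g [^]\<^bsub>A \<wr> B\<^esub> n) (c \<otimes>\<^bsub>B\<^esub> s) \<otimes>\<^bsub>A\<^esub> inv\<^bsub>A\<^esub> (P s) \<in> L"
          using L_mem[OF cs] x_s cc sc by simp
        ultimately have "P' (c \<otimes>\<^bsub>B\<^esub> s) = P s" using L_eq[OF cs sc(1)] by simp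
        then show False using \<open>P' (c \<otimes>\<^bsub>B\<^esub> s) = \<one>\<^bsub>A\<^esub>\<close> sc(2) by simp
      qed
      then obtain t where t: "t \<in> S'" "inv\<^bsub>B\<^esub> (c \<otimes>\<^bsub>B\<^esub> s) \<otimes>\<^bsub>B\<^esub> t \<in> M" by blast
      have tc: "t \<in> carrier B" using t(1) by (simp add: S'_def)
      define d where "d = t \<otimes>\<^bsub>B\<^esub> inv\<^bsub>B\<^esub> s"
      have dD: "d \<in> D" using t(1) s by (force simp: d_def D_def)
      have dc: "d \<in> carrier B" using tc sc by (simp add: d_def)
      have "s \<otimes>\<^bsub>B\<^esub> (inv\<^bsub>B\<^esub> (c \<otimes>\<^bsub>B\<^esub> s) \<otimes>\<^bsub>B\<^esub> t) \<otimes>\<^bsub>B\<^esub> inv\<^bsub>B\<^esub> s \<in> M"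
        using normal.inv_op_closed2[OF Mn sc(1) t(2)] .
      then have "inv\<^bsub>B\<^esub> c \<otimes>\<^bsub>B\<^esub> d \<in> M"
        using sc tc cc by (simp add: d_def B.inv_mult_group B.m_assoc)
      then have "c \<otimes>\<^bsub>B\<^esub> (inv\<^bsub>B\<^esub> c \<otimes>\<^bsub>B\<^esub> d) \<otimes>\<^bsub>B\<^esub> inv\<^bsub>B\<^esub> c \<in> M" "inv\<^bsub>B\<^esub> (inv\<^bsub>B\<^esub> c \<otimes>\<^bsub>B\<^esub> d) \<in> M"
        using normal.inv_op_closed2[OF Mn cc(1)] subgroup.m_inv_closed[OF Ms] by auto
      then have dc_M: "d \<otimes>\<^bsub>B\<^esub> inv\<^bsub>B\<^esub> c \<in> M" "inv\<^bsub>B\<^esub> d \<otimes>\<^bsub>B\<^esub> c \<in> M"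
        using cc dc by (simp_all add: B.inv_mult_group)
      have "d \<otimes>\<^bsub>B\<^esub> inv\<^bsub>B\<^esub> c \<otimes>\<^bsub>B\<^esub> c \<in> M0"
        using dc_M(1) cc(2) subgroup.m_closed[OF B.p_open_subgroup[OF M0]] by (auto simp: M_def)
      then have dM0: "d \<in> M0" using cc dc by (simp add: B.m_assoc)
      have dc_eq: "M #>\<^bsub>B\<^esub> d = M #>\<^bsub>B\<^esub> c" using B.r_coset_eq_iff[OF Ms dc cc(1)] dc_M(1) by simp
      have "M #>\<^bsub>B\<^esub> (d \<otimes>\<^bsub>B\<^esub> b \<otimes>\<^bsub>B\<^esub> inv\<^bsub>B\<^esub> d) = M #>\<^bsub>B\<^esub> (c \<otimes>\<^bsub>B\<^esub> b \<otimes>\<^bsub>B\<^esub> inv\<^bsub>B\<^esub> c)"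
        using dc cc b dc_eq by (intro B.r_coset_cong_mult[OF Mn] B.r_coset_cong_inv[OF Mn]) auto
      then have "d \<otimes>\<^bsub>B\<^esub> b \<otimes>\<^bsub>B\<^esub> inv\<^bsub>B\<^esub> d \<otimes>\<^bsub>B\<^esub> inv\<^bsub>B\<^esub> b \<in> M"
        unfolding M_comm[symmetric] by (subst (asm) B.r_coset_eq_iff[OF Ms]) (use dc b in auto)
      moreover have "d \<otimes>\<^bsub>B\<^esub> b \<otimes>\<^bsub>B\<^esub> inv\<^bsub>B\<^esub> d \<otimes>\<^bsub>B\<^esub> inv\<^bsub>B\<^esub> b \<in> EB" using dD by (simp add: EB_def)
      ultimately have "d \<otimes>\<^bsub>B\<^esub> b \<otimes>\<^bsub>B\<^esub> inv\<^bsub>B\<^esub> d \<otimes>\<^bsub>B\<^esub> inv\<^bsub>B\<^esub> b = \<one>\<^bsub>B\<^esub>"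
        using M1(2) by (auto simp: M_def)
      then have "d \<otimes>\<^bsub>B\<^esub> b \<otimes>\<^bsub>B\<^esub> inv\<^bsub>B\<^esub> d = b" using dc b by (simp add: B.m_inv_eq_one_iff)
      then have "d \<otimes>\<^bsub>B\<^esub> b \<otimes>\<^bsub>B\<^esub> inv\<^bsub>B\<^esub> d \<otimes>\<^bsub>B\<^esub> d = b \<otimes>\<^bsub>B\<^esub> d" by simp
      then have db: "d \<otimes>\<^bsub>B\<^esub> b = b \<otimes>\<^bsub>B\<^esub> d" using dc b by (simp add: B.m_assoc)
      have "c.\<Theta> (x [^]\<^bsub>A \<wr> B\<^esub> n) (inv\<^bsub>B\<^esub> c \<otimes>\<^bsub>B\<^esub> u) = c.\<Theta> (x [^]\<^bsub>A \<wr> B\<^esub> n) (inv\<^bsub>B\<^esub> d \<otimes>\<^bsub>B\<^esub> u)"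
        if u: "u \<in> carrier B" for u
        using c.\<Theta>_left[of "x [^]\<^bsub>A \<wr> B\<^esub> n" "inv\<^bsub>B\<^esub> c \<otimes>\<^bsub>B\<^esub> u" "inv\<^bsub>B\<^esub> d \<otimes>\<^bsub>B\<^esub> c"] dc_M(2) u x cc dc
        by (simp add: B.m_assoc)
      then show ?thesis using dD dM0 db by blast
    qed
    then obtain d where d: "d \<in> D" "d \<in> M0" "d \<otimes>\<^bsub>B\<^esub> b = b \<otimes>\<^bsub>B\<^esub> d"
      and \<Theta>_d: "\<And>s. s \<in> carrier B \<Longrightarrow>
        c.\<Theta> (x [^]\<^bsub>A \<wr> B\<^esub> n) (inv\<^bsub>B\<^esub> c \<otimes>\<^bsub>B\<^esub> s) = c.\<Theta> (x [^]\<^bsub>A \<wr> B\<^esub> n) (inv\<^bsub>B\<^esub> d \<otimes>\<^bsub>B\<^esub> s)" by blast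
    have dc: "d \<in> carrier B" using d(1) D(2) by blast
    obtain s where s: "s \<in> carrier B" "P' s \<noteq> P (inv\<^bsub>B\<^esub> d \<otimes>\<^bsub>B\<^esub> s)"
      using diff[of d] d by (auto simp: b_def P_def P'_def)
    have ds: "inv\<^bsub>B\<^esub> d \<otimes>\<^bsub>B\<^esub> s \<in> carrier B" "d \<otimes>\<^bsub>B\<^esub> (inv\<^bsub>B\<^esub> d \<otimes>\<^bsub>B\<^esub> s) = s" using s dc by simp_all
    \<comment> \<open>A point of disagreement lies in the support of \<open>g^n\<close> or in the
      \<open>d\<close>-translate of that of \<open>x^n\<close>, and \<open>E\<close> contains
      both.\<close>
    have sE: "s \<in> E"
    proof (cases "P' s = \<one>\<^bsub>A\<^esub>")
      case True
      then have "inv\<^bsub>B\<^esub> d \<otimes>\<^bsub>B\<^esub> s \<in> S" using s ds by (auto simp: S_def)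
      then show ?thesis using E_mem[OF d(1)] ds(2) by metis
    qed (use s in \<open>simp add: E_def S'_def\<close>)
    have "P' s \<otimes>\<^bsub>A\<^esub> inv\<^bsub>A\<^esub> (P (inv\<^bsub>B\<^esub> d \<otimes>\<^bsub>B\<^esub> s)) \<in> L"
      using L_mem[OF s(1)] \<Theta>_d[OF s(1)] \<Theta>_g[OF sE] \<Theta>_x[OF ds(1) d(1)] ds(2) sE by simp
    then show False using L_eq[OF s(1) ds(1)] s(2) by simp
  qed
  then show ?thesis using N by blast
qed

text \<open>\<open>M\<close> is shrunk for two purposes: its top elements must lie in
  \<open>K\<close>, and it must miss the nontrivial powers of \<open>b\<close>, so that
  \<open>b\<close> moves cosets with full period \<open>n\<close>. If \<open>g\<close> is no
  conjugate of \<open>x\<close> under the coset subgroup, then no \<open>d\<close> in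
  \<open>M\<close> commuting with \<open>b\<close> translates \<open>x^n\<close> into
  \<open>g^n\<close>, and the powers separate.\<close>

lemma p_hereditarily_conjugacy_separable_abelian:
  assumes p: "Factorial_Ring.prime p" and A: "comm_group A" and B: "p_group p B"
    and A_sep: "p_hereditarily_conjugacy_separable p A"
    and B_sep: "p_hereditarily_conjugacy_separable p B"
  shows "p_hereditarily_conjugacy_separable p (A \<wr> B)"
  unfolding W.p_hereditarily_conjugacy_separable_iff[OF p]
proof (intro ballI allI impI)
  have A_res: "\<exists>L. p_open p A L \<and> L \<inter> E \<subseteq> {\<one>\<^bsub>A\<^esub>}" if "finite E" "E \<subseteq> carrier A" for E
    using that A_sep A.p_open_carrier A.p_hereditarily_conjugacy_separable_iff[OF p]
    by (intro A.conj_closed_separates_finite) auto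
  have B_res: "\<exists>L. p_open p B L \<and> L \<inter> E \<subseteq> {\<one>\<^bsub>B\<^esub>}" if "finite E" "E \<subseteq> carrier B" for E
    using that B_sep B.p_open_carrier B.p_hereditarily_conjugacy_separable_iff[OF p]
    by (intro B.conj_closed_separates_finite) auto
  fix x K assume x: "x \<in> carrier (A \<wr> B)" and K: "p_open p (A \<wr> B) K"
  have Ks: "subgroup K (A \<wr> B)" using K by (rule W.p_open_subgroup)
  define b where "b = snd x"
  have b: "b \<in> carrier B" using x by (simp add: b_def)
  define n where "n = B.ord b"
  have n: "0 < n" "b [^]\<^bsub>B\<^esub> n = \<one>\<^bsub>B\<^esub>"
    using B p b prime_gt_0_nat by (auto simp: n_def p_group_def)
  define K0 where "K0 = {a \<in> carrier A. single a \<one>\<^bsub>B\<^esub> \<in> K}"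
  have K0: "p_open p A K0"
    unfolding K0_def by (rule group_hom.p_open_vimage[OF single_hom[OF B.one_closed] K])
  define M1 where "M1 = {m \<in> carrier B. top_elem m \<in> K}"
  have M1: "p_open p B M1"
    unfolding M1_def by (rule group_hom.p_open_vimage[OF top_elem_hom K])
  obtain M2 where M2: "p_open p B M2" "M2 \<inter> (\<lambda>i. b [^]\<^bsub>B\<^esub> i) ` {0<..<n} \<subseteq> {\<one>\<^bsub>B\<^esub>}"
    using B_res[of "(\<lambda>i. b [^]\<^bsub>B\<^esub> i) ` {0<..<n}"] b by auto
  define M where "M = M1 \<inter> M2"
  have M: "p_open p B M" unfolding M_def using M1 M2(1) by (rule B.p_open_Int)
  interpret c: wreath_coset_map A B M "coset_prod M"
    using A B.p_open_normal[OF M] by (rule wreath_coset_map_coset_prod)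
  have disj: "b [^]\<^bsub>B\<^esub> i \<notin> M" if "0 < i" "i < n" for i
  proof
    assume "b [^]\<^bsub>B\<^esub> i \<in> M"
    then have "b [^]\<^bsub>B\<^esub> i = \<one>\<^bsub>B\<^esub>" using M2(2) that by (auto simp: M_def)
    then show False using that b B.pow_eq_id[OF b, of i] by (auto simp: n_def dest: dvd_imp_le)
  qed
  obtain \<iota> where \<iota>: "\<forall>s\<in>carrier B. \<iota> s < n \<and> \<iota> (b \<otimes>\<^bsub>B\<^esub> s) = Suc (\<iota> s) mod n \<and>
      (\<forall>m\<in>M. \<iota> (s \<otimes>\<^bsub>B\<^esub> m) = \<iota> s)"
    using B.cyclic_coset_index[OF b n(2,1) B.p_open_normal[OF M] disj] by auto
  let ?K = "c.coset_subgroup K0"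
  have K': "p_open p (A \<wr> B) ?K" using M K0 by (rule c.coset_subgroup_p_open)
  have K's: "subgroup ?K (A \<wr> B)" and K'n: "?K \<lhd> A \<wr> B"
    using K' W.p_open_subgroup W.p_open_normal by auto
  have sub: "?K \<subseteq> K"
  proof (rule c.coset_subgroup_subset[OF W.p_open_normal[OF K] A.p_open_subgroup[OF K0]])
    show "single a \<one>\<^bsub>B\<^esub> \<in> K" if "a \<in> K0" for a using that by (simp add: K0_def)
    show "top_elem m \<in> K" if "m \<in> M" for m using that unfolding M_def M1_def by blast
  qed
  have "conj_closed p (A \<wr> B) ?K x"
  proof (rule c.conj_closed_coset_subgroup[OF M K0 x])
    show "conj_closed p B M (snd x)"
      using B_sep M b B.p_hereditarily_conjugacy_separable_iff[OF p] unfolding b_def by blast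
    fix g assume g: "g \<in> carrier (A \<wr> B)" and snd: "snd g = snd x"
      and gx: "g \<otimes>\<^bsub>A \<wr> B\<^esub> inv\<^bsub>A \<wr> B\<^esub> x \<in> ?K"
      and ng: "\<forall>k\<in>?K. g \<noteq> k \<otimes>\<^bsub>A \<wr> B\<^esub> x \<otimes>\<^bsub>A \<wr> B\<^esub> inv\<^bsub>A \<wr> B\<^esub> k"
    have "\<exists>N. p_open p (A \<wr> B) N \<and> (\<forall>k\<in>carrier (A \<wr> B). snd k \<in> M \<longrightarrow>
      N #>\<^bsub>A \<wr> B\<^esub> g \<noteq> N #>\<^bsub>A \<wr> B\<^esub> (k \<otimes>\<^bsub>A \<wr> B\<^esub> x \<otimes>\<^bsub>A \<wr> B\<^esub> inv\<^bsub>A \<wr> B\<^esub> k))"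
    proof (rule separate_by_powers[OF A A_res B_res M x g snd])
      show "snd x [^]\<^bsub>B\<^esub> n = \<one>\<^bsub>B\<^esub>" using n(2) by (simp add: b_def)
      fix d assume d: "d \<in> M" "d \<otimes>\<^bsub>B\<^esub> snd x = snd x \<otimes>\<^bsub>B\<^esub> d"
      show "\<exists>s\<in>carrier B. fst (g [^]\<^bsub>A \<wr> B\<^esub> n) s \<noteq> fst (x [^]\<^bsub>A \<wr> B\<^esub> n) (inv\<^bsub>B\<^esub> d \<otimes>\<^bsub>B\<^esub> s)"
      proof (rule ccontr)
        assume "\<not> ?thesis"
        then have eq: "fst (g [^]\<^bsub>A \<wr> B\<^esub> n) s = fst (x [^]\<^bsub>A \<wr> B\<^esub> n) (inv\<^bsub>B\<^esub> d \<otimes>\<^bsub>B\<^esub> s)"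
          if "s \<in> carrier B" for s using that by blast
        have dc: "d \<in> carrier B" using d(1) by simp
        let ?t = "top_elem d"
        have t: "?t \<in> ?K" "?t \<in> carrier (A \<wr> B)"
          using c.top_elem_in_coset_subgroup[OF A.p_open_subgroup[OF K0] d(1)] dc by auto
        \<comment> \<open>Conjugation by the top element of \<open>d\<close> yields \<open>y\<close>
          with \<open>y^n = g^n\<close> and the top part of \<open>x\<close>, so the recursion
          closes up with the trivial starting value.\<close>
        define y where "y = ?t \<otimes>\<^bsub>A \<wr> B\<^esub> x \<otimes>\<^bsub>A \<wr> B\<^esub> inv\<^bsub>A \<wr> B\<^esub> ?t"
        have yc: "y \<in> carrier (A \<wr> B)" using t x by (simp add: y_def)
        have snd_y: "snd y = b"
          using x dc d(2) by (simp add: y_def b_def B.m_assoc)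
        have y_pow: "y [^]\<^bsub>A \<wr> B\<^esub> n = g [^]\<^bsub>A \<wr> B\<^esub> n"
        proof (rule wreath_eqI)
          fix s assume s: "s \<in> carrier B"
          have "fst (y [^]\<^bsub>A \<wr> B\<^esub> n) s = fst (x [^]\<^bsub>A \<wr> B\<^esub> n) (inv\<^bsub>B\<^esub> d \<otimes>\<^bsub>B\<^esub> s)"
            using x t(2) dc s n(2) by (simp add: y_def W.conj_pow flip: b_def)
          then show "fst (y [^]\<^bsub>A \<wr> B\<^esub> n) s = fst (g [^]\<^bsub>A \<wr> B\<^esub> n) s" using eq[OF s] by simp
        qed (use yc g snd_y snd b_def in auto)
        have "?K #>\<^bsub>A \<wr> B\<^esub> y = ?K #>\<^bsub>A \<wr> B\<^esub> x"
        proof -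
          have "y \<otimes>\<^bsub>A \<wr> B\<^esub> inv\<^bsub>A \<wr> B\<^esub> x = ?t \<otimes>\<^bsub>A \<wr> B\<^esub> (x \<otimes>\<^bsub>A \<wr> B\<^esub> inv\<^bsub>A \<wr> B\<^esub> ?t \<otimes>\<^bsub>A \<wr> B\<^esub> inv\<^bsub>A \<wr> B\<^esub> x)"
            using t x by (simp add: y_def W.m_assoc)
          also have "\<dots> \<in> ?K"
            using normal.inv_op_closed2[OF K'n x subgroup.m_inv_closed[OF K's t(1)]]
              subgroup.m_closed[OF K's t(1)] by simp
          finally show ?thesis using W.r_coset_eq_iff[OF K's yc x] by simp
        qed
        moreover have "?K #>\<^bsub>A \<wr> B\<^esub> g = ?K #>\<^bsub>A \<wr> B\<^esub> x" using W.r_coset_eq_iff[OF K's g x] gx by simp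
        ultimately have gy: "g \<otimes>\<^bsub>A \<wr> B\<^esub> inv\<^bsub>A \<wr> B\<^esub> y \<in> ?K" using W.r_coset_eq_iff[OF K's g yc] by simp
        have "\<exists>h\<in>?K. g = h \<otimes>\<^bsub>A \<wr> B\<^esub> y \<otimes>\<^bsub>A \<wr> B\<^esub> inv\<^bsub>A \<wr> B\<^esub> h"
        proof (rule c.conjugate_by_coset_subgroup[OF A.p_open_normal[OF K0] yc g, of \<iota> n "\<one>\<^bsub>A \<wr> B\<^esub>"])
          show "\<one>\<^bsub>A \<wr> B\<^esub> \<in> ?K" using K's by (rule subgroup.one_closed)
          show "fst (g [^]\<^bsub>A \<wr> B\<^esub> n \<otimes>\<^bsub>A \<wr> B\<^esub> \<one>\<^bsub>A \<wr> B\<^esub> \<otimes>\<^bsub>A \<wr> B\<^esub> inv\<^bsub>A \<wr> B\<^esub> (y [^]\<^bsub>A \<wr> B\<^esub> n)) s =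
            fst \<one>\<^bsub>A \<wr> B\<^esub> s" for s
            using g by (simp add: y_pow del: fst_mult)
        qed (use \<iota> gy snd snd_y b_def in auto)
        then obtain h where h: "h \<in> ?K" "g = h \<otimes>\<^bsub>A \<wr> B\<^esub> y \<otimes>\<^bsub>A \<wr> B\<^esub> inv\<^bsub>A \<wr> B\<^esub> h" by blast
        have "g = (h \<otimes>\<^bsub>A \<wr> B\<^esub> ?t) \<otimes>\<^bsub>A \<wr> B\<^esub> x \<otimes>\<^bsub>A \<wr> B\<^esub> inv\<^bsub>A \<wr> B\<^esub> (h \<otimes>\<^bsub>A \<wr> B\<^esub> ?t)"
          unfolding h(2) using subgroup.mem_carrier[OF K's h(1)] t(2) x
          by (simp add: y_def W.m_assoc W.inv_mult_group)
        then show False using ng subgroup.m_closed[OF K's h(1) t(1)] by blast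
      qed
    qed
    then show "\<exists>N. p_open p (A \<wr> B) N \<and> (\<forall>k\<in>?K.
        N #>\<^bsub>A \<wr> B\<^esub> g \<noteq> N #>\<^bsub>A \<wr> B\<^esub> (k \<otimes>\<^bsub>A \<wr> B\<^esub> x \<otimes>\<^bsub>A \<wr> B\<^esub> inv\<^bsub>A \<wr> B\<^esub> k))"
      unfolding c.coset_subgroup_def by blast
  qed
  then show "conj_closed p (A \<wr> B) K x" by (rule W.conj_closed_reduce[OF Ks K' sub x])
qed

end

section \<open>Necessity\<close>

lemma exists_coprime_divisor:
  fixes p m :: nat
  assumes "Factorial_Ring.prime p" "\<And>k. m \<noteq> p ^ k"
  shows "\<exists>q>1. coprime q p \<and> q dvd m"
proof (cases "m = 0")
  \<comment> \<open>The value 0 stands for an element of infinite order; \<open>p + 1\<close> is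
    prime to \<open>p\<close> and divides 0.\<close>
  case True
  then show ?thesis using prime_gt_0_nat[OF assms(1)] by (intro exI[of _ "Suc p"]) simp
next
  case False
  then obtain q where q: "m = p ^ multiplicity p m * q" "\<not> p dvd q"
    using multiplicity_decompose'[of m p] assms(1) by (metis not_prime_unit)
  have "coprime q p" using q(2) assms(1) by (simp add: prime_imp_coprime coprime_commute)
  moreover have "q \<noteq> 1" "q \<noteq> 0" using q assms(2) by (metis mult_1_right, metis dvd_0_right)
  moreover have "q dvd m" using q(1) by (metis dvd_triv_right)
  ultimately show ?thesis by (intro exI[of _ q]) simp
qed

lemma (in group) r_coset_conj_eq:
  assumes L: "L \<lhd> G" and z: "z \<in> L" and x: "x \<in> carrier G"
  shows "L #> (z \<otimes> x \<otimes> inv z) = L #> x"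
proof -
  have Ls: "subgroup L G" using L by (rule normal_imp_subgroup)
  have zc: "z \<in> carrier G" using subgroup.mem_carrier[OF Ls z] .
  have "z \<otimes> x \<otimes> inv z \<otimes> inv x = z \<otimes> (x \<otimes> inv z \<otimes> inv x)"
    using zc x by (simp add: m_assoc)
  also have "\<dots> \<in> L"
    using normal.inv_op_closed2[OF L x subgroup.m_inv_closed[OF Ls z]] subgroup.m_closed[OF Ls z]
    by simp
  finally show ?thesis using r_coset_eq_iff[OF Ls] zc x by simp
qed

section \<open>Obstructions to separability\<close>

context wreath
begin

lemma single_commute:
  assumes "a \<in> carrier A" "s \<in> carrier B" "t \<in> carrier B" "c \<in> carrier A" "s = t \<Longrightarrow> a \<otimes>\<^bsub>A\<^esub> c = c \<otimes>\<^bsub>A\<^esub> a"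
  shows "single a s \<otimes>\<^bsub>A \<wr> B\<^esub> single c t = single c t \<otimes>\<^bsub>A \<wr> B\<^esub> single a s"
  using assms by (intro wreath_eqI) auto

text \<open>With \<open>e i = single a (y^i)\<close>, the top element \<open>v\<close> of
  \<open>y\<close> conjugates \<open>e i\<close> to \<open>e (i + 1)\<close>, so conjugating
  \<open>v\<close> by the product \<open>e (m - 1) ... e 0\<close> telescopes to
  \<open>e 0 (e m)^-1 v\<close>. The factors commute because they sit at different points or are
  equal.\<close>

lemma single_pow_conjugate:
  assumes a: "a \<in> carrier A" and y: "y \<in> carrier B"
  shows "\<exists>k\<in>carrier (A \<wr> B). single a \<one>\<^bsub>B\<^esub> \<otimes>\<^bsub>A \<wr> B\<^esub> inv\<^bsub>A \<wr> B\<^esub> (single a (y [^]\<^bsub>B\<^esub> (m::nat)))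
    \<otimes>\<^bsub>A \<wr> B\<^esub> top_elem y = k \<otimes>\<^bsub>A \<wr> B\<^esub> top_elem y \<otimes>\<^bsub>A \<wr> B\<^esub> inv\<^bsub>A \<wr> B\<^esub> k"
proof (induction m)
  case 0
  show ?case using a y by (intro bexI[of _ "\<one>\<^bsub>A \<wr> B\<^esub>"]) auto
next
  case (Suc m)
  let ?v = "top_elem y"
  define e where "e i = single a (y [^]\<^bsub>B\<^esub> i)" for i :: nat
  have e0: "e 0 = single a \<one>\<^bsub>B\<^esub>" by (simp add: e_def)
  obtain k where k: "k \<in> carrier (A \<wr> B)"
    "e 0 \<otimes>\<^bsub>A \<wr> B\<^esub> inv\<^bsub>A \<wr> B\<^esub> (e m) \<otimes>\<^bsub>A \<wr> B\<^esub> ?v = k \<otimes>\<^bsub>A \<wr> B\<^esub> ?v \<otimes>\<^bsub>A \<wr> B\<^esub> inv\<^bsub>A \<wr> B\<^esub> k"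
    using Suc by (auto simp: e_def)
  have v: "?v \<in> carrier (A \<wr> B)" and c: "\<And>i. e i \<in> carrier (A \<wr> B)" using a y by (auto simp: e_def)
  have "e (Suc m) = ?v \<otimes>\<^bsub>A \<wr> B\<^esub> e m \<otimes>\<^bsub>A \<wr> B\<^esub> inv\<^bsub>A \<wr> B\<^esub> ?v"
    using conj_top_elem_single[OF a y, of "y [^]\<^bsub>B\<^esub> m"] y B.nat_pow_Suc2[OF y] by (simp add: e_def)
  then have "inv\<^bsub>A \<wr> B\<^esub> (e (Suc m)) \<otimes>\<^bsub>A \<wr> B\<^esub> ?v = ?v \<otimes>\<^bsub>A \<wr> B\<^esub> inv\<^bsub>A \<wr> B\<^esub> (e m)"
    using v c[of m] by (simp add: W.inv_mult_group W.m_assoc)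
  then have "e 0 \<otimes>\<^bsub>A \<wr> B\<^esub> inv\<^bsub>A \<wr> B\<^esub> (e (Suc m)) \<otimes>\<^bsub>A \<wr> B\<^esub> ?v = e 0 \<otimes>\<^bsub>A \<wr> B\<^esub> (?v \<otimes>\<^bsub>A \<wr> B\<^esub> inv\<^bsub>A \<wr> B\<^esub> (e m))"
    using v c by (simp add: W.m_assoc)
  also have "\<dots> = (e m \<otimes>\<^bsub>A \<wr> B\<^esub> inv\<^bsub>A \<wr> B\<^esub> (e m)) \<otimes>\<^bsub>A \<wr> B\<^esub> e 0 \<otimes>\<^bsub>A \<wr> B\<^esub> (?v \<otimes>\<^bsub>A \<wr> B\<^esub> inv\<^bsub>A \<wr> B\<^esub> (e m))"
    using v c by simp
  also have "\<dots> = e m \<otimes>\<^bsub>A \<wr> B\<^esub> (inv\<^bsub>A \<wr> B\<^esub> (e m) \<otimes>\<^bsub>A \<wr> B\<^esub> e 0) \<otimes>\<^bsub>A \<wr> B\<^esub> (?v \<otimes>\<^bsub>A \<wr> B\<^esub> inv\<^bsub>A \<wr> B\<^esub> (e m))"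
    using v c[of m] c[of 0] by (simp only: W.m_assoc W.inv_closed W.m_closed)
  also have "inv\<^bsub>A \<wr> B\<^esub> (e m) \<otimes>\<^bsub>A \<wr> B\<^esub> e 0 = e 0 \<otimes>\<^bsub>A \<wr> B\<^esub> inv\<^bsub>A \<wr> B\<^esub> (e m)"
  proof -
    have "e 0 \<otimes>\<^bsub>A \<wr> B\<^esub> e m = e m \<otimes>\<^bsub>A \<wr> B\<^esub> e 0" unfolding e_def using a y by (intro single_commute) auto
    then have "inv\<^bsub>A \<wr> B\<^esub> (e m) \<otimes>\<^bsub>A \<wr> B\<^esub> (e 0 \<otimes>\<^bsub>A \<wr> B\<^esub> e m) \<otimes>\<^bsub>A \<wr> B\<^esub> inv\<^bsub>A \<wr> B\<^esub> (e m) =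
      inv\<^bsub>A \<wr> B\<^esub> (e m) \<otimes>\<^bsub>A \<wr> B\<^esub> (e m \<otimes>\<^bsub>A \<wr> B\<^esub> e 0) \<otimes>\<^bsub>A \<wr> B\<^esub> inv\<^bsub>A \<wr> B\<^esub> (e m)" by (rule arg_cong)
    then show ?thesis using v c[of m] c[of 0] by (simp add: W.m_assoc)
  qed
  also have "e m \<otimes>\<^bsub>A \<wr> B\<^esub> (e 0 \<otimes>\<^bsub>A \<wr> B\<^esub> inv\<^bsub>A \<wr> B\<^esub> (e m)) \<otimes>\<^bsub>A \<wr> B\<^esub> (?v \<otimes>\<^bsub>A \<wr> B\<^esub> inv\<^bsub>A \<wr> B\<^esub> (e m)) =
      e m \<otimes>\<^bsub>A \<wr> B\<^esub> (e 0 \<otimes>\<^bsub>A \<wr> B\<^esub> inv\<^bsub>A \<wr> B\<^esub> (e m) \<otimes>\<^bsub>A \<wr> B\<^esub> ?v) \<otimes>\<^bsub>A \<wr> B\<^esub> inv\<^bsub>A \<wr> B\<^esub> (e m)"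
    using v c[of m] c[of 0] by (simp only: W.m_assoc W.inv_closed W.m_closed)
  also have "\<dots> = (e m \<otimes>\<^bsub>A \<wr> B\<^esub> k) \<otimes>\<^bsub>A \<wr> B\<^esub> ?v \<otimes>\<^bsub>A \<wr> B\<^esub> inv\<^bsub>A \<wr> B\<^esub> (e m \<otimes>\<^bsub>A \<wr> B\<^esub> k)"
    unfolding k(2) using v c[of m] k(1) by (simp add: W.m_assoc W.inv_mult_group)
  finally have "e 0 \<otimes>\<^bsub>A \<wr> B\<^esub> inv\<^bsub>A \<wr> B\<^esub> (e (Suc m)) \<otimes>\<^bsub>A \<wr> B\<^esub> ?v =
      (e m \<otimes>\<^bsub>A \<wr> B\<^esub> k) \<otimes>\<^bsub>A \<wr> B\<^esub> ?v \<otimes>\<^bsub>A \<wr> B\<^esub> inv\<^bsub>A \<wr> B\<^esub> (e m \<otimes>\<^bsub>A \<wr> B\<^esub> k)" .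
  then show ?case using k(1) c[of m] unfolding e0 unfolding e_def by (metis W.m_closed)
qed

text \<open>Written as \<open>u k = k v\<close> and read at the points \<open>y^i\<close>, none of
  which is \<open>x\<close>, the equation says that the sequence \<open>fst k (y^i)\<close> changes
  only where \<open>y^i\<close> is the identity, and there by the factor \<open>a\<close>. For
  infinite order, finite support forbids this single jump; for finite order, periodicity
  does.\<close>

lemma single_not_conjugate:
  assumes a: "a \<in> carrier A" "a \<noteq> \<one>\<^bsub>A\<^esub>" and x: "x \<in> carrier B" and y: "y \<in> carrier B"
    and xy: "\<And>i::int. y [^]\<^bsub>B\<^esub> i \<noteq> x" and k: "k \<in> carrier (A \<wr> B)"
  shows "single a \<one>\<^bsub>B\<^esub> \<otimes>\<^bsub>A \<wr> B\<^esub> inv\<^bsub>A \<wr> B\<^esub> (single a x) \<otimes>\<^bsub>A \<wr> B\<^esub> top_elem y \<noteq>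
    k \<otimes>\<^bsub>A \<wr> B\<^esub> top_elem y \<otimes>\<^bsub>A \<wr> B\<^esub> inv\<^bsub>A \<wr> B\<^esub> k"
proof
  assume "single a \<one>\<^bsub>B\<^esub> \<otimes>\<^bsub>A \<wr> B\<^esub> inv\<^bsub>A \<wr> B\<^esub> (single a x) \<otimes>\<^bsub>A \<wr> B\<^esub> top_elem y =
    k \<otimes>\<^bsub>A \<wr> B\<^esub> top_elem y \<otimes>\<^bsub>A \<wr> B\<^esub> inv\<^bsub>A \<wr> B\<^esub> k" (is "?u = _")
  then have "?u \<otimes>\<^bsub>A \<wr> B\<^esub> k = k \<otimes>\<^bsub>A \<wr> B\<^esub> top_elem y"
    using k y by (simp add: W.m_assoc)
  then have eq: "fst (?u \<otimes>\<^bsub>A \<wr> B\<^esub> k) s = fst (k \<otimes>\<^bsub>A \<wr> B\<^esub> top_elem y) s" for s by simp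
  define h where "h i = fst k (y [^]\<^bsub>B\<^esub> (i::int))" for i
  have hA: "h i \<in> carrier A" for i using k y by (simp add: h_def)
  have shift: "inv\<^bsub>B\<^esub> y \<otimes>\<^bsub>B\<^esub> y [^]\<^bsub>B\<^esub> i = y [^]\<^bsub>B\<^esub> (i - 1)" for i :: int
    using y B.int_pow_mult[of y "-1" i] by (simp add: B.int_pow_neg)
  have rec: "(if y [^]\<^bsub>B\<^esub> i = \<one>\<^bsub>B\<^esub> then a else \<one>\<^bsub>A\<^esub>) \<otimes>\<^bsub>A\<^esub> h (i - 1) = h i" for i
    using eq[of "y [^]\<^bsub>B\<^esub> i"] a x y k xy[of i] shift[of i] hA[of i] by (simp add: h_def)
  have up: "h (int j) = h 0" if "\<And>i. 0 < i \<Longrightarrow> i \<le> int j \<Longrightarrow> y [^]\<^bsub>B\<^esub> i \<noteq> \<one>\<^bsub>B\<^esub>" for j :: nat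
    using that
  proof (induction j)
    case (Suc j)
    then have "h (int j) = h 0" by simp
    moreover have "h (int (Suc j)) = h (int j)"
      using rec[of "int (Suc j)"] Suc.prems[of "int (Suc j)"] hA by simp
    ultimately show ?case by simp
  qed simp
  have zero: "a \<otimes>\<^bsub>A\<^esub> h (- 1) = h 0" using rec[of 0] y by simp
  show False
  proof (cases "B.ord y = 0")
    case True
    then have ne: "y [^]\<^bsub>B\<^esub> i \<noteq> \<one>\<^bsub>B\<^esub>" if "i \<noteq> 0" for i :: int
      using that B.int_pow_eq_id[OF y, of i] by simp
    have inj: "inj (\<lambda>i::int. y [^]\<^bsub>B\<^esub> i)"
      using B.int_pow_eq[OF y] True by (auto simp: inj_def)
    have down: "h (- 1 - int j) = h (- 1)" for j :: nat
    proof (induction j)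
      case (Suc j)
      then show ?case using rec[of "- 1 - int j"] ne[of "- 1 - int j"] hA by simp
    qed simp
    have fin: "finite {i. h i \<noteq> \<one>\<^bsub>A\<^esub>}"
    proof (rule finite_imageD)
      show "finite ((\<lambda>i. y [^]\<^bsub>B\<^esub> i) ` {i. h i \<noteq> \<one>\<^bsub>A\<^esub>})"
        by (rule finite_subset[of _ "{s \<in> carrier B. fst k s \<noteq> \<one>\<^bsub>A\<^esub>}"])
          (use y fst_closed[OF k] in \<open>auto simp: h_def base_iff\<close>)
      show "inj_on (\<lambda>i. y [^]\<^bsub>B\<^esub> i) {i. h i \<noteq> \<one>\<^bsub>A\<^esub>}" using inj by (rule inj_on_subset) simp
    qed
    have "h 0 = \<one>\<^bsub>A\<^esub>"
    proof (rule ccontr)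
      assume "h 0 \<noteq> \<one>\<^bsub>A\<^esub>"
      then have "range int \<subseteq> {i. h i \<noteq> \<one>\<^bsub>A\<^esub>}" using up ne by force
      then show False using fin by (meson finite_subset finite_imageD inj_of_nat infinite_UNIV_nat)
    qed
    moreover have "h (- 1) = \<one>\<^bsub>A\<^esub>"
    proof (rule ccontr)
      assume "h (- 1) \<noteq> \<one>\<^bsub>A\<^esub>"
      then have "range (\<lambda>j. - 1 - int j) \<subseteq> {i. h i \<noteq> \<one>\<^bsub>A\<^esub>}" using down by force
      moreover have "inj (\<lambda>j. - 1 - int j)" by (simp add: inj_def)
      ultimately show False using fin by (meson finite_subset finite_imageD infinite_UNIV_nat)
    qed
    ultimately show False using zero a by simp
  next
    case False
    define r where "r = B.ord y"
    have "y [^]\<^bsub>B\<^esub> i \<noteq> \<one>\<^bsub>B\<^esub>" if "0 < i" "i \<le> int (r - 1)" for i :: int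
      using that B.int_pow_eq_id[OF y, of i] False zdvd_imp_le[of "int r" i] by (auto simp: r_def)
    then have "h (int (r - 1)) = h 0" by (rule up)
    \<comment> \<open>Index \<open>r - 1\<close> denotes the same point as index \<open>-1\<close>,
      and no identity is passed on the way to it from 0; hence \<open>h (- 1) = h 0\<close>, against
      \<open>zero\<close>.\<close>
    moreover have "y [^]\<^bsub>B\<^esub> (int (r - 1)) = y [^]\<^bsub>B\<^esub> (- 1 :: int)"
      using B.int_pow_eq[OF y, of "int (r - 1)" "- 1"] False by (simp add: r_def of_nat_diff)
    ultimately have "h (- 1) = h 0" by (simp add: h_def)
    then show False using zero a hA[of 0] by (simp add: A.l_cancel_one)
  qed
qed

lemma top_p_group_of_separable:
  assumes p: "Factorial_Ring.prime p" and a: "a \<in> carrier A" "a \<noteq> \<one>\<^bsub>A\<^esub>"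
    and sep: "\<And>v. v \<in> carrier (A \<wr> B) \<Longrightarrow> conj_closed p (A \<wr> B) (carrier (A \<wr> B)) v"
  shows "p_group p B"
  unfolding p_group_def
proof (intro conjI ballI)
  show "group B" by (rule B.group_axioms)
  fix x assume x: "x \<in> carrier B"
  show "\<exists>k. B.ord x = p ^ k"
  proof (rule ccontr)
    assume "\<not> ?thesis"
    then obtain q where q: "q > 1" "coprime q p" "q dvd B.ord x"
      using exists_coprime_divisor[OF p] by blast
    define y where "y = x [^]\<^bsub>B\<^esub> q"
    have y: "y \<in> carrier B" using x by (simp add: y_def)
    \<comment> \<open>An equation \<open>y^i = x\<close> means that the order of \<open>x\<close>
      divides \<open>q i - 1\<close>; \<open>q\<close> divides that order, so \<open>q\<close> would
      divide 1. Infinite order is included, as order 0.\<close>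
    have xy: "y [^]\<^bsub>B\<^esub> i \<noteq> x" for i :: int
    proof
      assume "y [^]\<^bsub>B\<^esub> i = x"
      then have "x [^]\<^bsub>B\<^esub> (int q * i) = x [^]\<^bsub>B\<^esub> (1::int)"
        using x by (simp add: y_def B.int_pow_pow flip: int_pow_int)
      then have "int (B.ord x) dvd int q * i - 1" using B.int_pow_eq[OF x, of "int q * i" 1] by (simp add: dvd_diff_commute)
      then have "int q dvd int q * i - 1" using q(3) by (meson dvd_trans int_dvd_int_iff)
      then have "int q dvd 1" by (simp add: dvd_diff_right_iff)
      then show False using q(1) by simp
    qed
    let ?v = "top_elem y"
    define u where "u z = single a \<one>\<^bsub>B\<^esub> \<otimes>\<^bsub>A \<wr> B\<^esub> inv\<^bsub>A \<wr> B\<^esub> (single a z) \<otimes>\<^bsub>A \<wr> B\<^esub> ?v" for z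
    have uc: "u z \<in> carrier (A \<wr> B)" for z using a y by (simp add: u_def)
    have vc: "?v \<in> carrier (A \<wr> B)" using y by simp
    have "\<forall>k\<in>carrier (A \<wr> B). u x \<noteq> k \<otimes>\<^bsub>A \<wr> B\<^esub> ?v \<otimes>\<^bsub>A \<wr> B\<^esub> inv\<^bsub>A \<wr> B\<^esub> k"
      using single_not_conjugate[OF a x y xy] by (auto simp: u_def)
    then obtain L where L: "p_open p (A \<wr> B) L"
      "\<forall>k\<in>carrier (A \<wr> B). L #>\<^bsub>A \<wr> B\<^esub> u x \<noteq> L #>\<^bsub>A \<wr> B\<^esub> (k \<otimes>\<^bsub>A \<wr> B\<^esub> ?v \<otimes>\<^bsub>A \<wr> B\<^esub> inv\<^bsub>A \<wr> B\<^esub> k)"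
      using sep[OF vc] uc[of x] unfolding conj_closed_def by blast
    have Ln: "L \<lhd> A \<wr> B" and Ls: "subgroup L (A \<wr> B)"
      using L(1) W.p_open_normal W.p_open_subgroup by auto
    have "top_elem x \<in> carrier (A \<wr> B)" using x by simp
    then obtain e where e: "top_elem x [^]\<^bsub>A \<wr> B\<^esub> (p ^ e :: nat) \<in> L"
      using L(1) unfolding p_open_def by blast
    have "coprime q (p ^ e)" using q(2) by simp
    then obtain m r where mr: "q * m = p ^ e * r + 1"
      using bezout_nat[of q "p ^ e"] q(1) by auto
    define z where "z = top_elem (x [^]\<^bsub>B\<^esub> (p ^ e * r :: nat))"
    have "z = (top_elem x [^]\<^bsub>A \<wr> B\<^esub> (p ^ e :: nat)) [^]\<^bsub>A \<wr> B\<^esub> r"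
      using x group_hom.hom_nat_pow[OF top_elem_hom x, of "p ^ e * r"] by (simp add: z_def W.nat_pow_pow)
    then have zL: "z \<in> L" using W.subgroup_nat_pow_closed[OF Ls e] by simp
    have "y [^]\<^bsub>B\<^esub> m = x [^]\<^bsub>B\<^esub> (p ^ e * r :: nat) \<otimes>\<^bsub>B\<^esub> x"
      using x mr by (simp add: y_def B.nat_pow_pow)
    then have "single a (y [^]\<^bsub>B\<^esub> m) = z \<otimes>\<^bsub>A \<wr> B\<^esub> single a x \<otimes>\<^bsub>A \<wr> B\<^esub> inv\<^bsub>A \<wr> B\<^esub> z"
      using conj_top_elem_single[OF a(1), of "x [^]\<^bsub>B\<^esub> (p ^ e * r :: nat)" x] x by (simp add: z_def)
    then have "L #>\<^bsub>A \<wr> B\<^esub> single a (y [^]\<^bsub>B\<^esub> m) = L #>\<^bsub>A \<wr> B\<^esub> single a x"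
      using W.r_coset_conj_eq[OF Ln zL, of "single a x"] a by simp
    then have "L #>\<^bsub>A \<wr> B\<^esub> u (y [^]\<^bsub>B\<^esub> m) = L #>\<^bsub>A \<wr> B\<^esub> u x"
      unfolding u_def using a x y
      by (intro W.r_coset_cong_mult[OF Ln] W.r_coset_cong_inv[OF Ln]) auto
    then show False using single_pow_conjugate[OF a(1) y, of m] L(2) unfolding u_def by metis
  qed
qed

text \<open>By finiteness two different top elements agree modulo \<open>L\<close>, and with them
  the copies of \<open>A\<close> at two different points. These copies commute, so each becomes
  abelian modulo \<open>L\<close>. The commutator \<open>d\<close>, placed at the identity of
  \<open>B\<close>, thus lies in \<open>L\<close>, which was chosen to exclude it unless it is
  trivial.\<close>

lemma base_abelian_of_separable:
  assumes inf: "infinite (carrier B)"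
    and sep: "conj_closed p (A \<wr> B) (carrier (A \<wr> B)) \<one>\<^bsub>A \<wr> B\<^esub>"
  shows "comm_group A"
proof (rule A.group_comm_groupI)
  fix a c assume a: "a \<in> carrier A" and c: "c \<in> carrier A"
  define d where "d = a \<otimes>\<^bsub>A\<^esub> c \<otimes>\<^bsub>A\<^esub> inv\<^bsub>A\<^esub> (c \<otimes>\<^bsub>A\<^esub> a)"
  have d: "d \<in> carrier A" using a c by (simp add: d_def)
  obtain L where L: "p_open p (A \<wr> B) L" "L \<inter> {single d \<one>\<^bsub>B\<^esub>} \<subseteq> {\<one>\<^bsub>A \<wr> B\<^esub>}"
    using W.conj_closed_separates_finite[OF sep, of "{single d \<one>\<^bsub>B\<^esub>}"] d by auto
  have Ln: "L \<lhd> A \<wr> B" and Ls: "subgroup L (A \<wr> B)"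
    using L(1) W.p_open_normal W.p_open_subgroup by auto
  have "finite ((\<lambda>b. L #>\<^bsub>A \<wr> B\<^esub> top_elem b) ` carrier B)"
    by (rule finite_subset[OF _ W.p_open_finite_cosets[OF L(1)]]) auto
  then have "\<not> inj_on (\<lambda>b. L #>\<^bsub>A \<wr> B\<^esub> top_elem b) (carrier B)"
    using inf finite_imageD by blast
  then obtain s t where st: "s \<in> carrier B" "t \<in> carrier B" "s \<noteq> t"
    "L #>\<^bsub>A \<wr> B\<^esub> top_elem s = L #>\<^bsub>A \<wr> B\<^esub> top_elem t" by (auto simp: inj_on_def)
  have conj1: "single a b = top_elem b \<otimes>\<^bsub>A \<wr> B\<^esub> single a \<one>\<^bsub>B\<^esub> \<otimes>\<^bsub>A \<wr> B\<^esub> inv\<^bsub>A \<wr> B\<^esub> (top_elem b)"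
    if "b \<in> carrier B" for b
    using conj_top_elem_single[OF a that, of "\<one>\<^bsub>B\<^esub>"] that by simp
  have eq: "L #>\<^bsub>A \<wr> B\<^esub> single a s = L #>\<^bsub>A \<wr> B\<^esub> single a t"
    unfolding conj1[OF st(1)] conj1[OF st(2)] using a st
    by (intro W.r_coset_cong_mult[OF Ln] W.r_coset_cong_inv[OF Ln]) auto
  have "L #>\<^bsub>A \<wr> B\<^esub> (single a s \<otimes>\<^bsub>A \<wr> B\<^esub> single c s) = L #>\<^bsub>A \<wr> B\<^esub> (single a t \<otimes>\<^bsub>A \<wr> B\<^esub> single c s)"
    using a c st eq by (intro W.r_coset_cong_mult[OF Ln]) auto
  also have "single a t \<otimes>\<^bsub>A \<wr> B\<^esub> single c s = single c s \<otimes>\<^bsub>A \<wr> B\<^esub> single a t"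
    using a c st by (intro single_commute) auto
  also have "L #>\<^bsub>A \<wr> B\<^esub> \<dots> = L #>\<^bsub>A \<wr> B\<^esub> (single c s \<otimes>\<^bsub>A \<wr> B\<^esub> single a s)"
    using a c st eq by (intro W.r_coset_cong_mult[OF Ln]) auto
  finally have "single a s \<otimes>\<^bsub>A \<wr> B\<^esub> single c s \<otimes>\<^bsub>A \<wr> B\<^esub> inv\<^bsub>A \<wr> B\<^esub> (single c s \<otimes>\<^bsub>A \<wr> B\<^esub> single a s) \<in> L"
    using W.r_coset_eq_iff[OF Ls] a c by simp
  moreover have "single a s \<otimes>\<^bsub>A \<wr> B\<^esub> single c s \<otimes>\<^bsub>A \<wr> B\<^esub> inv\<^bsub>A \<wr> B\<^esub> (single c s \<otimes>\<^bsub>A \<wr> B\<^esub> single a s) = single d s"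
    using a c d st by (intro wreath_eqI) (auto simp: d_def)
  ultimately have "single d s \<in> L" by simp
  then have "top_elem (inv\<^bsub>B\<^esub> s) \<otimes>\<^bsub>A \<wr> B\<^esub> single d s \<otimes>\<^bsub>A \<wr> B\<^esub> inv\<^bsub>A \<wr> B\<^esub> (top_elem (inv\<^bsub>B\<^esub> s)) \<in> L"
    using st by (intro normal.inv_op_closed2[OF Ln]) auto
  then have "single d \<one>\<^bsub>B\<^esub> \<in> L"
    using conj_top_elem_single[OF d, of "inv\<^bsub>B\<^esub> s" s] st by simp
  then have "single d \<one>\<^bsub>B\<^esub> = \<one>\<^bsub>A \<wr> B\<^esub>" using L(2) by blast
  then have "fst (single d \<one>\<^bsub>B\<^esub>) \<one>\<^bsub>B\<^esub> = fst \<one>\<^bsub>A \<wr> B\<^esub> \<one>\<^bsub>B\<^esub>" by simp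
  then have "d = \<one>\<^bsub>A\<^esub>" by simp
  then show "a \<otimes>\<^bsub>A\<^esub> c = c \<otimes>\<^bsub>A\<^esub> a" using a c by (simp add: d_def A.m_inv_eq_one_iff)
qed

end

theorem corollary1p3:
  fixes p :: nat
    and A :: "('a, 'm) monoid_scheme"
    and B :: "('b, 'n) monoid_scheme"
  assumes "Factorial_Ring.prime p"
    and "group A" and "\<not> trivial_group A" and "p_hereditarily_conjugacy_separable p A"
    and "group B" and "\<not> trivial_group B" and "p_hereditarily_conjugacy_separable p B"
  shows "p_hereditarily_conjugacy_separable p (A \<wr> B) \<longleftrightarrow>
     finite_p_group p B \<or> (comm_group A \<and> p_group p B)"
proof -
  interpret wreath A B using assms(2,5) by (rule wreath.intro)
  obtain a where a: "a \<in> carrier A" "a \<noteq> \<one>\<^bsub>A\<^esub>"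
    using assms(2,3) by (auto simp: trivial_group_def)
  show ?thesis
  proof
    assume "p_hereditarily_conjugacy_separable p (A \<wr> B)"
    then have sep: "conj_closed p (A \<wr> B) (carrier (A \<wr> B)) v" if "v \<in> carrier (A \<wr> B)" for v
      using that W.p_open_carrier W.p_hereditarily_conjugacy_separable_iff[OF assms(1)] by blast
    have "p_group p B" using top_p_group_of_separable[OF assms(1) a sep] .
    moreover have "comm_group A" if "infinite (carrier B)"
      using base_abelian_of_separable[OF that sep[OF W.one_closed]] .
    ultimately show "finite_p_group p B \<or> (comm_group A \<and> p_group p B)"
      by (auto simp: finite_p_group_def)
  next
    assume "finite_p_group p B \<or> (comm_group A \<and> p_group p B)"
    then show "p_hereditarily_conjugacy_separable p (A \<wr> B)"
      using p_hereditarily_conjugacy_separable_finite[OF assms(1) _ assms(4)]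
        p_hereditarily_conjugacy_separable_abelian[OF assms(1) _ _ assms(4,7)] by blast
  qed
qed

end
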